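(* Let $D=\begin{pmatrix}2&0\\0&1\end{pmatrix}$ and set $\Gamma_\Theta=D^{-1}\Gamma_1(16)D\cap SL_2(\mathbb Z)$. Then $\Theta(\tau)$ is a strong quantum modular form of weight $1/2$ on $\mathbb Q$ with respect to $\Gamma_\Theta$. More precisely, \[ \Theta(\alpha)-(\Theta|_{1/2,\nu_\Theta}\delta)(\alpha)=R_{\delta,\psi}(\alpha),\qquad \delta\in\Gamma_\Theta,\quad \alpha\in\mathbb Q, \] where $\nu_\Theta(\delta)=\nu_\psi(D\delta D^{-1})$ and $R_{\delta,\psi}(\tau)=r_{D\delta D^{-1},\psi}(2\tau)$. The function $R_{\delta,\psi}$ extends smoothly to the real line and is real-analytic on $\mathbb R\setminus\{\delta^{-1}(i\infty)\}$.
   Context: Let $q=e^{2\pi i\tau}$, and write $(x;q^2)_0=1$, $(x;q^2)_n=\prod_{j=0}^{n-1}(1-xq^{2j})$. Put \[ A(q)=\sum_{\substack{l\ge2\\1\le k\le l-1}}\frac{(q^{2k+1};q^2)_{l-k-1}}{(-q^{2k};q^2)_{l-k}}q^{2k+l-1},\qquad \Theta(\tau)=\frac{q^{1/8}}{1-q}-q^{-7/8}(1+q)A(q). \] Let $\psi$ be the odd periodic function modulo $8$ with $\psi(r)=1$ for $r\equiv1,3\pmod 8$, $\psi(r)=-1$ for $r\equiv5,7\pmod 8$, and $\psi(r)=0$ for $r$ even. Let \[ \vartheta_\psi(z)=\sum_{r\ge0}\psi(r)e^{2\pi i z r^2/16}. \] Then $\Theta(\tau)=\vartheta_\psi(2\tau)$.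 For $N\ge1$, $\Gamma_1(N)$ is the group of matrices $\begin{pmatrix}a&b\\c&d\end{pmatrix}\in SL_2(\mathbb Z)$ with $c\equiv0\pmod N$ and $a\equiv d\equiv1\pmod N$. Matrices act by Möbius transformations, and $f|_{k,\chi}\gamma$ denotes the usual slash operator of weight $k$ with multiplier $\chi$. "Strong quantum modular form" is meant in the sense of Goswami and Osburn, whose theorem on partial theta series with periodic coefficients gives that $\vartheta_\psi$ is a strong quantum modular form of weight $1/2$ on $\mathbb Q$ with respect to $\Gamma_1(16)$. Here $\nu_\psi$ denotes the associated multiplier, the one occurring in the transformation law \[ \vartheta_\psi(\alpha)-(\vartheta_\psi|_{1/2,\nu_\psi}\gamma)(\alpha)=r_{\gamma,\psi}(\alpha),\qquad \gamma\in\Gamma_1(16),\ \alpha\in\mathbb Q. \] The modular obstruction is \[ r_{\gamma,\psi}(\tau)=\frac{1}{\sqrt{8i}}\int_{\gamma^{-1}(i\infty)}^{i\infty}\Theta_\psi(w)(w-\tau)^{-1/2}\,dw, \] where $\Theta_\psi$ is the weight $3/2$ unary theta series (the shadow) \[ \Theta_\psi(z)=\sum_{r\in\mathbb Z}r\psi(r)e^{2\pi i z r^2/16}. \] The function $r_{\gamma,\psi}$ is holomorphic on the lower half-plane, extends smoothly to the real line, and is real-analytic away from $\gamma^{-1}(i\infty)$.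
   Formalization: The constant 1/√(8i) in r_{γ,ψ} is corrected to 1/(2√(8i)), since Θ_ψ sums over both signs of r and the printed constant doubles the obstruction; for cα+d<0 the power (cα+d)^{-1/2} is the boundary value from the lower half-plane. *)

theory Defs
  imports
    "HOL-Analysis.Analysis"
    "HOL-Number_Theory.Cong"
    "HOL-Computational_Algebra.Formal_Power_Series"
begin

section \<open>Matrices and congruence subgroups\<close>

definition mat2 :: "real \<Rightarrow> real \<Rightarrow> real \<Rightarrow> real \<Rightarrow> real^2^2" where
  "mat2 a b c d = vector [vector [a, b], vector [c, d]]"

definition SL2Z :: "(real^2^2) set" where
  "SL2Z = {A. (\<forall>i j. A $ i $ j \<in> \<int>) \<and> det A = 1}"

definition Gamma1 :: "int \<Rightarrow> (real^2^2) set" where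
  "Gamma1 N = {\<gamma> \<in> SL2Z. \<exists>a b c d :: int.
     \<gamma> = mat2 (of_int a) (of_int b) (of_int c) (of_int d) \<and>
     [c = 0] (mod N) \<and> [a = 1] (mod N) \<and> [d = 1] (mod N)}"

definition mob :: "real^2^2 \<Rightarrow> real \<Rightarrow> real" where
  "mob \<gamma> x = (\<gamma>$1$1 * x + \<gamma>$1$2) / (\<gamma>$2$1 * x + \<gamma>$2$2)"

text \<open>The set of real points that \<open>\<gamma>\<close> sends to \<open>i\<infinity>\<close>. It is \<open>{- d / c}\<close>, and it is empty
  when \<open>\<gamma>\<close> fixes \<open>i\<infinity>\<close>.\<close>

definition cusp_preimage :: "real^2^2 \<Rightarrow> real set" where
  "cusp_preimage \<gamma> = {x. \<gamma>$2$1 * x + \<gamma>$2$2 = 0}"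


section \<open>Slash operators at real points\<close>

text \<open>The factor \<open>(c x + d) powr (-k)\<close> at a real point \<open>x\<close>. For \<open>c x + d < 0\<close> the power is the
  boundary value of the principal branch from the lower half-plane (\<open>autfac_boundary\<close> below), which
  is where the obstruction \<open>r_psi\<close> is holomorphic. For \<open>c > 0\<close> this is the conjugate of the
  principal value; with the principal value on both sides of \<open>- d / c\<close>, no single multiplier would
  satisfy the transformation law. At \<open>x = - d / c\<close> the factor is \<open>0\<close>, in accordance with the
  vanishing at \<open>i\<infinity>\<close> of the functions considered here.\<close>

definition autfac :: "real \<Rightarrow> real^2^2 \<Rightarrow> real \<Rightarrow> complex" where
  "autfac k \<gamma> x =
     (let p = complex_of_real (\<gamma>$2$1 * x + \<gamma>$2$2) powr complex_of_real (- k)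
      in if \<gamma>$2$1 > 0 \<and> \<gamma>$2$1 * x + \<gamma>$2$2 < 0 then cnj p else p)"

text \<open>The value of a function on the upper half-plane at a rational point.\<close>

definition radial_value :: "(complex \<Rightarrow> complex) \<Rightarrow> real \<Rightarrow> complex" where
  "radial_value f x = Lim (at_right 0) (\<lambda>t::real. f (Complex x t))"

definition slash ::
  "real \<Rightarrow> (real^2^2 \<Rightarrow> complex) \<Rightarrow> (complex \<Rightarrow> complex) \<Rightarrow> real^2^2 \<Rightarrow> real \<Rightarrow> complex" where
  "slash k v f \<gamma> x = inverse (v \<gamma>) * autfac k \<gamma> x * radial_value f (mob \<gamma> x)"


section \<open>Strong quantum modular forms\<close>

definition radial_expansion :: "(complex \<Rightarrow> complex) \<Rightarrow> real \<Rightarrow> complex fps \<Rightarrow> bool" where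
  "radial_expansion f x \<phi> \<longleftrightarrow>
     (\<forall>N. (\<lambda>t::real. f (Complex x t) - (\<Sum>n<N. fps_nth \<phi> n * (\<i> * of_real t) ^ n))
            \<in> O[at_right 0](\<lambda>t. of_real (t ^ N)))"

text \<open>The slash operator on formal power series: with \<open>j = c x + d\<close> and \<open>det \<gamma> = 1\<close>,
  \<open>c (x + X) + d = j (1 + (c / j) X)\<close> and
  \<open>\<gamma> (x + X) - \<gamma> x = X / (j\<^sup>2 (1 + (c / j) X))\<close>. The series \<open>\<psi>\<close> is the expansion at \<open>\<gamma> x\<close>.\<close>

definition slash_fps ::
  "real \<Rightarrow> (real^2^2 \<Rightarrow> complex) \<Rightarrow> complex fps \<Rightarrow> real^2^2 \<Rightarrow> real \<Rightarrow> complex fps" where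
  "slash_fps k v \<psi> \<gamma> x =
     (let j = complex_of_real (\<gamma>$2$1 * x + \<gamma>$2$2);
          u = fps_const (complex_of_real (\<gamma>$2$1) / j) * fps_X
      in fps_const (inverse (v \<gamma>) * autfac k \<gamma> x)
         * (fps_binomial (complex_of_real (- k)) oo u)
         * (\<psi> oo (fps_const (1 / j\<^sup>2) * fps_X * inverse (1 + u))))"

definition vderiv :: "nat \<Rightarrow> (real \<Rightarrow> complex) \<Rightarrow> real \<Rightarrow> complex" where
  "vderiv n g = ((\<lambda>h x. vector_derivative h (at x)) ^^ n) g"

definition smooth_on_reals :: "(real \<Rightarrow> complex) \<Rightarrow> bool" where
  "smooth_on_reals g \<longleftrightarrow> (\<forall>n x. vderiv n g differentiable (at x))"

definition taylor_fps :: "(real \<Rightarrow> complex) \<Rightarrow> real \<Rightarrow> complex fps" where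
  "taylor_fps g x = Abs_fps (\<lambda>n. vderiv n g x / fact n)"

definition real_analytic_on :: "(real \<Rightarrow> complex) \<Rightarrow> real set \<Rightarrow> bool" where
  "real_analytic_on g U \<longleftrightarrow>
     (\<forall>x\<in>U. \<exists>a :: nat \<Rightarrow> complex. \<exists>e>0. \<forall>y. \<bar>y - x\<bar> < e \<longrightarrow>
        (\<lambda>n. a n * of_real (y - x) ^ n) sums g y)"

text \<open>A function \<open>f\<close> on the upper half-plane determines a formal power series at every rational
  point (its radial expansion), and the obstructions to modularity of these series are the Taylor
  series of functions \<open>r \<gamma>\<close> on the real line that are smooth, and real-analytic away from finitely
  many points.\<close>

definition strong_quantum_modular_form ::
  "real \<Rightarrow> (real^2^2 \<Rightarrow> complex) \<Rightarrow> (real^2^2) set \<Rightarrow> (complex \<Rightarrow> complex)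
     \<Rightarrow> (real^2^2 \<Rightarrow> real \<Rightarrow> complex) \<Rightarrow> bool" where
  "strong_quantum_modular_form k v G f r \<longleftrightarrow>
     (\<forall>\<gamma>\<in>G. norm (v \<gamma>) = 1) \<and>
     (\<exists>\<phi> :: real \<Rightarrow> complex fps.
        (\<forall>x\<in>\<rat>. radial_expansion f x (\<phi> x)) \<and>
        (\<forall>\<gamma>\<in>G. \<forall>x\<in>\<rat> - cusp_preimage \<gamma>.
           \<phi> x - slash_fps k v (\<phi> (mob \<gamma> x)) \<gamma> x = taylor_fps (r \<gamma>) x)) \<and>
     (\<forall>\<gamma>\<in>G. smooth_on_reals (r \<gamma>) \<and> (\<exists>S. finite S \<and> real_analytic_on (r \<gamma>) (- S)))"

text \<open>\<open>f\<close> is holomorphic on the open lower half-plane, and all its derivatives extend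
  continuously, as one-sided complex derivatives, to the real line.\<close>

definition extends_smoothly_to_reals :: "(complex \<Rightarrow> complex) \<Rightarrow> bool" where
  "extends_smoothly_to_reals f \<longleftrightarrow>
     (\<exists>F :: nat \<Rightarrow> complex \<Rightarrow> complex.
        (\<forall>z. Im z \<le> 0 \<longrightarrow> F 0 z = f z) \<and>
        (\<forall>n z. Im z \<le> 0 \<longrightarrow>
           (F n has_field_derivative F (Suc n) z) (at z within {w. Im w \<le> 0})))"


section \<open>The partial theta series and its obstruction\<close>

definition psi :: "int \<Rightarrow> complex" where
  "psi r = (if r mod 8 \<in> {1, 3} then 1 else if r mod 8 \<in> {5, 7} then -1 else 0)"

definition theta_psi :: "complex \<Rightarrow> complex" where
  "theta_psi z = (\<Sum>r::nat. psi (int r) * exp (2 * of_real pi * \<i> * z * of_nat r ^ 2 / 16))"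

definition Theta_psi :: "complex \<Rightarrow> complex" where
  "Theta_psi z =
     (\<Sum>\<^sub>\<infinity>r::int. of_int r * psi r * exp (2 * of_real pi * \<i> * z * of_int r ^ 2 / 16))"

text \<open>The integral from \<open>\<gamma>\<^sup>-\<^sup>1(i\<infinity>)\<close> to \<open>i\<infinity>\<close>, along the vertical line above \<open>- d / c\<close>. The
  normalising constant is fixed by
  \<open>theta_psi \<alpha> = 1 / (2 sqrt (8 i)) * \<integral> Theta_psi w (w - \<alpha>) powr (- 1/2) dw\<close> over the vertical
  line from a rational \<open>\<alpha>\<close> to \<open>i\<infinity>\<close>; the \<open>2\<close> is there because \<open>Theta_psi\<close> sums over both signs
  of \<open>r\<close>.\<close>

definition r_psi :: "real^2^2 \<Rightarrow> complex \<Rightarrow> complex" where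
  "r_psi \<gamma> \<tau> =
     (if \<gamma>$2$1 = 0 then 0
      else 1 / (2 * csqrt (8 * \<i>)) *
        (LBINT y:{0<..}.
           (let w = Complex (- \<gamma>$2$2 / \<gamma>$2$1) y
            in Theta_psi w * (w - \<tau>) powr (- 1 / 2) * \<i>)))"

text \<open>The multiplier of \<open>theta_psi\<close> is the number that occurs in its transformation law under
  \<open>\<gamma>\<close>. It is only meaningful when \<open>\<gamma>\<close> has an even upper right entry: under \<open>z \<mapsto> z + 1\<close>, for
  instance, \<open>theta_psi\<close> is not mapped to a multiple of itself.\<close>

definition nu_psi :: "real^2^2 \<Rightarrow> complex" where
  "nu_psi \<gamma> = (THE \<nu>. \<forall>\<alpha>\<in>\<rat>.
     radial_value theta_psi \<alpha> - slash (1/2) (\<lambda>_. \<nu>) theta_psi \<gamma> \<alpha> = r_psi \<gamma> (of_real \<alpha>))"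


section \<open>The function \<open>Theta\<close>\<close>

definition qpoch :: "complex \<Rightarrow> complex \<Rightarrow> nat \<Rightarrow> complex" where
  "qpoch x p n = (\<Prod>j<n. 1 - x * p ^ j)"

definition A_series :: "complex \<Rightarrow> complex" where
  "A_series q = (\<Sum>\<^sub>\<infinity>(l, k)\<in>{(l, k). 2 \<le> l \<and> 1 \<le> k \<and> k \<le> l - 1}.
     qpoch (q ^ (2 * k + 1)) (q\<^sup>2) (l - k - 1) / qpoch (- (q ^ (2 * k))) (q\<^sup>2) (l - k)
       * q ^ (2 * k + l - 1))"

definition Theta :: "complex \<Rightarrow> complex" where
  "Theta \<tau> =
     (let e = (\<lambda>s::real. exp (2 * of_real pi * \<i> * \<tau> * of_real s)); q = e 1
      in e (1/8) / (1 - q) - e (-7/8) * (1 + q) * A_series q)"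

definition D_mat :: "real^2^2" where
  "D_mat = mat2 2 0 0 1"

definition Gamma_Theta :: "(real^2^2) set" where
  "Gamma_Theta = {matrix_inv D_mat ** \<gamma> ** D_mat | \<gamma>. \<gamma> \<in> Gamma1 16} \<inter> SL2Z"

definition nu_Theta :: "real^2^2 \<Rightarrow> complex" where
  "nu_Theta \<delta> = nu_psi (D_mat ** \<delta> ** matrix_inv D_mat)"

definition R_psi :: "real^2^2 \<Rightarrow> complex \<Rightarrow> complex" where
  "R_psi \<delta> \<tau> = r_psi (D_mat ** \<delta> ** matrix_inv D_mat) (2 * \<tau>)"


section \<open>Boundary values of the automorphy factor\<close>

lemma powr_boundary_upper:
  fixes j s a :: real
  assumes "j < 0" "s > 0"
  shows "((\<lambda>t. Complex j (s * t) powr of_real a) \<longlongrightarrow> of_real j powr of_real a) (at_right 0)"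
proof -
  have minus: "- Complex j (s * t) = Complex (- j) (- s * t)" for t
    by (simp add: complex_eq_iff)
  have "((\<lambda>t. Complex (- j) (- s * t)) \<longlongrightarrow> Complex (- j) (- s * 0)) (at_right 0)"
    by (intro tendsto_Complex tendsto_intros)
  hence "((\<lambda>t. exp (of_real a * (Ln (- Complex j (s * t)) + \<i> * of_real pi)))
           \<longlongrightarrow> exp (of_real a * (Ln (of_real (- j)) + \<i> * of_real pi))) (at_right 0)"
    unfolding minus using assms
    by (intro tendsto_intros) (auto simp: Complex_eq complex_nonpos_Reals_iff)
  moreover have "exp (of_real a * (Ln (of_real (- j)) + \<i> * of_real pi))
                   = complex_of_real j powr of_real a"
    using assms Ln_minus[of "of_real (- j)"] by (simp add: powr_def)
  moreover have "\<forall>\<^sub>F t in at_right 0. exp (of_real a * (Ln (- Complex j (s * t)) + \<i> * of_real pi))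
                   = Complex j (s * t) powr of_real a"
    using eventually_at_right_less[of 0]
  proof eventually_elim
    case (elim t)
    have "0 < s * t" using elim assms by simp
    hence "Complex j (s * t) \<noteq> 0" "Complex j (s * t) = - (- Complex j (s * t))"
      by (auto simp: complex_eq_iff)
    moreover have "Ln (- (- Complex j (s * t))) = Ln (- Complex j (s * t)) + \<i> * of_real pi"
      using \<open>0 < s * t\<close> assms by (subst Ln_minus) (auto simp: complex_eq_iff)
    ultimately show ?case
      by (simp add: powr_def)
  qed
  ultimately show ?thesis
    using tendsto_cong by force
qed

lemma autfac_boundary:
  assumes "\<gamma>$2$1 * x + \<gamma>$2$2 \<noteq> 0"
  shows "((\<lambda>t. (of_real (\<gamma>$2$1) * Complex x (- t) + of_real (\<gamma>$2$2)) powr of_real (- k))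
           \<longlongrightarrow> autfac k \<gamma> x) (at_right 0)"
proof -
  define c d j where "c = \<gamma>$2$1" and "d = \<gamma>$2$2" and "j = c * x + d"
  have j0: "j \<noteq> 0" using assms by (simp add: j_def c_def d_def)
  have eq: "of_real c * Complex x (- t) + of_real d = Complex j (- c * t)" for t
    by (simp add: complex_eq_iff j_def)
  have af: "autfac k \<gamma> x = (if c > 0 \<and> j < 0 then cnj (of_real j powr of_real (- k))
                            else of_real j powr of_real (- k))"
    by (simp add: autfac_def Let_def j_def c_def d_def)
  have "((\<lambda>t. Complex j (- c * t) powr of_real (- k)) \<longlongrightarrow> autfac k \<gamma> x) (at_right 0)"
  proof -
    consider "c = 0" | "j > 0" | "j < 0" "c < 0" | "j < 0" "c > 0"
      using j0 by linarith
    then show ?thesis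
    proof cases
      case 1
      then show ?thesis by (simp add: af Complex_eq)
    next
      case 2
      have "((\<lambda>t. Complex j (- c * t)) \<longlongrightarrow> Complex j (- c * 0)) (at_right 0)"
        by (intro tendsto_Complex tendsto_intros)
      hence "((\<lambda>t. Complex j (- c * t)) \<longlongrightarrow> of_real j) (at_right 0)"
        by (simp add: Complex_eq)
      from tendsto_powr_complex[OF _ this tendsto_const, of "of_real (- k)"] show ?thesis
        using 2 by (simp add: af)
    next
      case 3
      then show ?thesis using powr_boundary_upper[of j "- c" "- k"] by (simp add: af)
    next
      case 4
      have "Complex j (- c * t) powr of_real (- k) = cnj (Complex j (c * t) powr of_real (- k))"
        if "t > 0" for t
      proof -
        have "Complex j (c * t) \<notin> \<real>\<^sub>\<le>\<^sub>0"
          using that 4 by (simp add: complex_nonpos_Reals_iff)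
        from cnj_powr[of "Complex j (c * t)" "of_real (- k)"] this
        have "cnj (Complex j (c * t) powr of_real (- k))
                = cnj (Complex j (c * t)) powr cnj (of_real (- k))"
          by (auto simp: complex_nonpos_Reals_iff)
        thus ?thesis by (simp add: complex_cnj)
      qed
      hence "\<forall>\<^sub>F t in at_right 0. cnj (Complex j (c * t) powr of_real (- k))
               = Complex j (- c * t) powr of_real (- k)"
        using eventually_at_right_less[of 0] by (auto elim: eventually_mono)
      moreover have "((\<lambda>t. cnj (Complex j (c * t) powr of_real (- k))) \<longlongrightarrow> autfac k \<gamma> x) (at_right 0)"
        using 4 tendsto_cnj[OF powr_boundary_upper[of j c "- k"]] by (simp add: af)
      ultimately show ?thesis
        using tendsto_cong by force
    qed
  qed
  thus ?thesis by (simp only: eq flip: c_def d_def)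
qed

end

theory Submission
  imports Defs "HOL-Complex_Analysis.Complex_Analysis" "HOL-Probability.Probability"
begin

text \<open>Why the theorem holds. Write \<open>H v = Theta_psi (2 * v)\<close> for the rescaled shadow and
  \<open>e x = exp (2 \<pi> \<i> x)\<close>.

  The inner sum over \<open>k\<close> in \<open>A_series\<close> telescopes, which turns \<open>Theta \<tau>\<close> into \<open>e (\<tau> / 8)\<close> times the
  value at \<open>z = q\<close> of a single \<open>q\<close>-series in \<open>z\<close>. That series satisfies a first order functional
  equation relating \<open>z\<close> to \<open>z q\<^sup>2\<close>; its iteration produces the partial theta series, and so
  \<open>Theta \<tau> = theta_psi (2 * \<tau>)\<close> (\<open>Theta_eq_theta_psi\<close>).

  The shadow is modular of weight \<open>3/2\<close>. Poisson summation in every residue class gives an inversion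
  formula for theta series with periodic coefficients, in which the coefficients are replaced by their
  discrete Fourier transform (\<open>twisted_theta_inversion\<close>). For a matrix of the group, the coefficients
  of \<open>H\<close> at \<open>a / c\<close> are transformed into a multiple of those of \<open>H\<close> at \<open>- d / c\<close>: this is a Gauss sum
  (\<open>shadow_twist_dft\<close>), and Parseval's identity determines the absolute value of the factor. Hence
  \<open>H\<close> is modular with a factor of absolute value \<open>1\<close> (\<open>shadow_modular\<close>). The same inversion formula, at
  an arbitrary rational point, shows that \<open>H\<close> vanishes there faster than every power of the
  imaginary part (\<open>shadow_cusp_decay\<close>).

  Termwise integration gives \<open>Theta (x + i t) = 1/4 \<integral> H (x + i y) (y - t) powr (- 1/2) dy\<close> over
  \<open>y > t\<close> (\<open>Theta_integral\<close>). As \<open>H\<close> vanishes rapidly at a rational \<open>x\<close>, the half power may be expanded in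
  powers of \<open>t / y\<close>, and \<open>Theta\<close> has a radial expansion at \<open>x\<close> whose \<open>n\<close>-th coefficient is the
  integral of \<open>H w\<close> against a multiple of \<open>(w - x) powr (- 1/2 - n)\<close> over the vertical line from \<open>x\<close> to
  \<open>i\<infinity>\<close> (\<open>Theta_radial_expansion\<close>).

  The coefficients are thus period integrals, and Cauchy's theorem applies in the ideal triangle with
  vertices \<open>\<alpha>\<close>, \<open>- d / c\<close> and \<open>i\<infinity>\<close> (\<open>ideal_triangle\<close>). The side from \<open>\<alpha>\<close> to \<open>i\<infinity>\<close> is the coefficient at
  \<open>\<alpha>\<close>. The side from \<open>- d / c\<close> to \<open>i\<infinity>\<close> is the Taylor coefficient at \<open>\<alpha>\<close> of the obstruction. The matrix
  maps the third side to the vertical line above the image of \<open>\<alpha>\<close>, and the modularity of \<open>H\<close> together with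
  the binomial theorem turns its contribution into the slash action on the expansion there
  (\<open>theta_coeff_modular\<close>). The \<open>0\<close>-th coefficients give the transformation law of the values, all
  of them together the identity of formal power series.

  The obstruction integrates a rapidly decreasing function against \<open>(w - z) powr (- 1/2)\<close>. It can be
  differentiated under the integral sign for \<open>z\<close> in the closed lower half-plane, and expanded in a power
  series around every real point other than \<open>- d / c\<close>. Finally, the factor found in this way is the
  multiplier \<open>nu_psi\<close>, because the law determines it: some rational point is mapped to \<open>0\<close>, where the
  limit of \<open>Theta\<close> is not \<open>0\<close> (\<open>multiplier\<close>).\<close>

section \<open>A \<open>q\<close>-series with a partial theta expansion\<close>

lemma qpoch_0 [simp]: "qpoch x p 0 = 1"
  by (simp add: qpoch_def)

lemma qpoch_Suc: "qpoch x p (Suc n) = qpoch x p n * (1 - x * p ^ n)"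
  by (simp add: qpoch_def)

lemma qpoch_add: "qpoch x p (m + n) = qpoch x p m * qpoch (x * p ^ m) p n"
  by (induction n) (simp_all add: qpoch_Suc power_add mult_ac)

lemma qpoch_Suc_shift: "qpoch x p (Suc n) = (1 - x) * qpoch (x * p) p n"
  using qpoch_add[of x p 1 n] by (simp add: qpoch_Suc)

lemma qpoch_nonzero:
  assumes "norm x < 1" "norm p \<le> 1"
  shows "qpoch x p n \<noteq> 0"
proof -
  have "x * p ^ j \<noteq> 1" for j
  proof -
    have "norm (x * p ^ j) \<le> norm x * 1"
      unfolding norm_mult norm_power using assms by (intro mult_left_mono power_le_one) auto
    then show ?thesis using assms by auto
  qed
  then show ?thesis by (simp add: qpoch_def)
qed

text \<open>The infinite products converge to nonzero limits, so the finite ones stay bounded, and bounded away from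
  zero. This makes \<open>A_series\<close> absolutely convergent.\<close>

lemma qpoch_Bseq:
  assumes "norm x < 1" "norm p < 1"
  shows "Bseq (qpoch x p)" "Bseq (\<lambda>n. inverse (qpoch x p n))"
proof -
  have "summable (\<lambda>j. norm (x * p ^ j))"
    using assms by (simp add: norm_mult norm_power summable_mult)
  then have "abs_convergent_prod (\<lambda>j. 1 - x * p ^ j)"
    by (simp add: abs_convergent_prod_conv_summable)
  then have conv: "convergent_prod (\<lambda>j. 1 - x * p ^ j)"
    by (rule abs_convergent_prod_imp_convergent_prod)
  have nz: "1 - x * p ^ j \<noteq> 0" for j
    using qpoch_nonzero[of x p "Suc j"] assms by (simp add: qpoch_Suc)
  have lim: "(\<lambda>n. \<Prod>j\<le>n. 1 - x * p ^ j) \<longlonglongrightarrow> prodinf (\<lambda>j. 1 - x * p ^ j)"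
    using conv by (rule convergent_prod_LIMSEQ)
  have nz': "prodinf (\<lambda>j. 1 - x * p ^ j) \<noteq> 0"
    using conv nz by (rule prodinf_nonzero)
  have "(\<lambda>n. qpoch x p (Suc n)) \<longlonglongrightarrow> prodinf (\<lambda>j. 1 - x * p ^ j)"
    using lim by (simp add: qpoch_def lessThan_Suc_atMost)
  then have lim': "qpoch x p \<longlonglongrightarrow> prodinf (\<lambda>j. 1 - x * p ^ j)"
    by (simp only: filterlim_sequentially_Suc)
  from lim' show "Bseq (qpoch x p)"
    by (intro convergent_imp_Bseq convergentI)
  from tendsto_inverse[OF lim' nz'] show "Bseq (\<lambda>n. inverse (qpoch x p n))"
    by (intro convergent_imp_Bseq convergentI)
qed

text \<open>The Rogers--Fine type series \<open>\<Sum>n. z^n (z; q\<^sup>2)_n / (- z q; q\<^sup>2)_n\<close>, with \<open>z\<close> free because the functional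
  equation moves it.\<close>

definition fine_term :: "complex \<Rightarrow> complex \<Rightarrow> nat \<Rightarrow> complex" where
  "fine_term q z n = z ^ n * qpoch z (q\<^sup>2) n / qpoch (- (z * q)) (q\<^sup>2) n"

definition fine_sum :: "complex \<Rightarrow> complex \<Rightarrow> complex" where
  "fine_sum q z = (\<Sum>n. fine_term q z n)"

lemma fine_term_Suc:
  "fine_term q z (Suc n) = fine_term q z n * (z * (1 - z * q ^ (2 * n)) / (1 + z * q * q ^ (2 * n)))"
  by (simp add: fine_term_def qpoch_Suc power_mult)

lemma norm_mult_power_lt_1:
  fixes z q :: complex
  assumes "norm z < 1" "norm q < 1"
  shows "norm (z * q * q ^ n) < 1"
proof -
  have "norm (z * q * q ^ n) \<le> norm z * 1 * 1"
    unfolding norm_mult norm_power using assms by (intro mult_mono power_le_one) auto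
  then show ?thesis using assms by simp
qed

lemma fine_summable:
  assumes z: "norm z < 1" and q: "norm q < 1"
  shows "summable (fine_term q z)"
proof -
  have q2: "(\<lambda>n. q ^ (2 * n)) \<longlonglongrightarrow> 0"
    unfolding power_mult using q by (intro LIMSEQ_power_zero) (simp add: norm_power power_less_one_iff abs_square_less_1)
  have "(\<lambda>n. norm (z * (1 - z * q ^ (2 * n)) / (1 + z * q * q ^ (2 * n)))) \<longlonglongrightarrow>
          norm (z * (1 - z * 0) / (1 + z * q * 0))"
    by (intro tendsto_intros q2) auto
  then have "eventually (\<lambda>n. norm (z * (1 - z * q ^ (2 * n)) / (1 + z * q * q ^ (2 * n))) < (1 + norm z) / 2) sequentially"
    using z by (intro order_tendstoD) auto
  then obtain n0 where n0: "\<And>n. n \<ge> n0 \<Longrightarrow>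
      norm (z * (1 - z * q ^ (2 * n)) / (1 + z * q * q ^ (2 * n))) < (1 + norm z) / 2"
    by (auto simp: eventually_sequentially)
  show ?thesis
  proof (rule summable_ratio_test)
    show "(1 + norm z) / 2 < 1" using z by simp
    show "norm (fine_term q z (Suc n)) \<le> (1 + norm z) / 2 * norm (fine_term q z n)" if "n \<ge> n0" for n
      unfolding fine_term_Suc norm_mult[of "fine_term q z n"] mult.commute[of "norm (fine_term q z n)"]
      using n0[OF that] by (intro mult_right_mono) auto
  qed
qed

text \<open>A bound uniform in \<open>z\<close>: it makes the remainder vanish when the functional equation is iterated.\<close>

lemma fine_sum_bound:
  assumes z: "norm z \<le> 1/4" and q: "norm q < 1"
  shows "norm (fine_sum q z) \<le> 2"
proof -
  have b: "norm (fine_term q z n) \<le> (1/2) ^ n" for n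
  proof (induction n)
    case (Suc n)
    have q1: "norm (q ^ m) \<le> 1" for m
      unfolding norm_power using q by (intro power_le_one) auto
    have "norm (z * q ^ (2 * n)) \<le> 1/4 * 1"
      unfolding norm_mult using z q1 by (intro mult_mono) auto
    then have a: "norm (1 - z * q ^ (2 * n)) \<le> 5/4"
      using norm_triangle_ineq4[of 1 "z * q ^ (2 * n)"] by simp
    have "norm (z * q ^ Suc (2 * n)) \<le> 1/4 * 1"
      unfolding norm_mult using z q1[of "Suc (2 * n)"] by (intro mult_mono) simp_all
    then have c: "norm (1 + z * q * q ^ (2 * n)) \<ge> 3/4"
      using norm_triangle_ineq2[of 1 "- (z * q * q ^ (2 * n))"] by (simp add: mult_ac)
    have "norm (z * (1 - z * q ^ (2 * n)) / (1 + z * q * q ^ (2 * n))) \<le> (1/4 * (5/4)) / (3/4)"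
      unfolding norm_mult norm_divide using z a c by (intro frac_le mult_mono) auto
    then have "norm (z * (1 - z * q ^ (2 * n)) / (1 + z * q * q ^ (2 * n))) \<le> 1/2" by simp
    then show ?case
      unfolding fine_term_Suc norm_mult[of "fine_term q z n"] power_Suc2
      using Suc by (intro mult_mono) auto
  qed (simp add: fine_term_def)
  have s: "(\<lambda>n. (1/2::real) ^ n) sums 2"
    using geometric_sums[of "1/2::real"] by simp
  have "norm (fine_sum q z) \<le> (\<Sum>n. (1/2::real) ^ n)"
    unfolding fine_sum_def using b s by (intro norm_suminf_le) (auto simp: sums_iff)
  then show ?thesis using s by (simp add: sums_iff)
qed

text \<open>The sum of \<open>fine_sum q z\<close> and \<open>z\<^sup>2 * q * fine_sum q (z * q\<^sup>2)\<close> telescopes. The \<open>n\<close>-th terms of both are rational multiples of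
  \<open>fine_term q z n\<close>, and \<open>T\<close> in the proof is the rational multiple whose differences they are.\<close>

lemma fine_sum_rec:
  assumes z: "norm z < 1" and q: "norm q < 1"
  shows "fine_sum q z = 1 + z - z\<^sup>2 * q * fine_sum q (z * q\<^sup>2)"
proof -
  have z1: "z \<noteq> 1" using z by auto
  have nz: "1 + z * q * q ^ n \<noteq> 0" for n
    using norm_mult_power_lt_1[OF z q, of n] by (metis add_eq_0_iff norm_minus_cancel norm_one less_irrefl)
  have zq: "norm (z * q\<^sup>2) < 1"
  proof -
    have "norm (z * q\<^sup>2) = norm (z * q * q ^ 1)" by (simp add: power2_eq_square mult_ac)
    also have "\<dots> < 1" by (rule norm_mult_power_lt_1[OF z q])
    finally show ?thesis .
  qed
  have nzp: "qpoch (- (z * q)) (q\<^sup>2) n \<noteq> 0" for n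
  proof (rule qpoch_nonzero)
    show "norm (- (z * q)) < 1" using norm_mult_power_lt_1[OF z q, of 0] by simp
    show "norm (q\<^sup>2) \<le> 1" using q by (simp add: norm_power power_le_one)
  qed
  \<comment> \<open>the factor \<open>1 - z\<^sup>2 q^(2n)\<close> solves the first order difference equation \<open>tel\<close>\<close>
  define T where "T = (\<lambda>n. fine_term q z n * (1 - z\<^sup>2 * q ^ (2 * n)) / (1 - z))"
  have shift: "fine_term q (z * q\<^sup>2) n
      = fine_term q z n * q ^ (2 * n) * (1 - z * q ^ (2 * n)) * (1 + z * q) / ((1 - z) * (1 + z * q * q ^ (2 * n)))" for n
  proof -
    have a: "(1 - z) * qpoch (z * q\<^sup>2) (q\<^sup>2) n = qpoch z (q\<^sup>2) n * (1 - z * q ^ (2 * n))"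
      using qpoch_Suc_shift[of z "q\<^sup>2" n] qpoch_Suc[of z "q\<^sup>2" n] by (simp add: power_mult)
    have b: "(1 + z * q) * qpoch (- (z * q\<^sup>2 * q)) (q\<^sup>2) n
        = qpoch (- (z * q)) (q\<^sup>2) n * (1 + z * q * q ^ (2 * n))"
      using qpoch_Suc_shift[of "- (z * q)" "q\<^sup>2" n] qpoch_Suc[of "- (z * q)" "q\<^sup>2" n]
      unfolding power_mult[of q 2 n] by (simp add: mult_ac)
    have a': "qpoch (z * q\<^sup>2) (q\<^sup>2) n = qpoch z (q\<^sup>2) n * (1 - z * q ^ (2 * n)) / (1 - z)"
      using a z1 by (simp add: field_simps)
    have b': "qpoch (- (z * q\<^sup>2 * q)) (q\<^sup>2) n
        = qpoch (- (z * q)) (q\<^sup>2) n * (1 + z * q * q ^ (2 * n)) / (1 + z * q)"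
      using b nz[of 0] by (simp add: field_simps)
    show ?thesis
      unfolding fine_term_def a' b' using nz[of "2 * n"] nz[of 0] nzp z1
      by (simp add: power_mult_distrib mult_ac flip: power_mult)
  qed
  have tel: "fine_term q z n + z\<^sup>2 * q * fine_term q (z * q\<^sup>2) n = T n - T (Suc n)" for n
  proof -
    define x where "x = q ^ (2 * n)"
    have xS: "q ^ (2 * Suc n) = x * q\<^sup>2" by (simp add: x_def power2_eq_square mult_ac)
    have nx: "1 + z * q * x \<noteq> 0" using nz[of "2 * n"] by (simp add: x_def)
    have "1 + z\<^sup>2 * q * (x * (1 - z * x) * (1 + z * q) / ((1 - z) * (1 + z * q * x)))
       = (1 - z\<^sup>2 * x) / (1 - z) - z * (1 - z * x) / (1 + z * q * x) * ((1 - z\<^sup>2 * (x * q\<^sup>2)) / (1 - z))"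
      using nx z1 by (simp add: divide_simps) (simp add: algebra_simps power2_eq_square)
    then have "fine_term q z n * (1 + z\<^sup>2 * q * (x * (1 - z * x) * (1 + z * q) / ((1 - z) * (1 + z * q * x))))
       = fine_term q z n * ((1 - z\<^sup>2 * x) / (1 - z) - z * (1 - z * x) / (1 + z * q * x) * ((1 - z\<^sup>2 * (x * q\<^sup>2)) / (1 - z)))"
      by simp
    then show ?thesis
      unfolding T_def fine_term_Suc shift xS x_def[symmetric] by (simp add: algebra_simps)
  qed
  have "T \<longlonglongrightarrow> 0"
  proof -
    have q2: "(\<lambda>n. q ^ (2 * n)) \<longlonglongrightarrow> 0"
      unfolding power_mult using q by (intro LIMSEQ_power_zero) (simp add: norm_power abs_square_less_1)
    have "T \<longlonglongrightarrow> 0 * (1 - z\<^sup>2 * 0) / (1 - z)"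
      unfolding T_def using fine_summable[OF z q] z1 by (intro tendsto_intros q2 summable_LIMSEQ_zero) auto
    then show ?thesis by simp
  qed
  then have "(\<lambda>n. T n - T (Suc n)) sums (T 0 - 0)"
    by (rule telescope_sums')
  moreover have "(\<lambda>n. fine_term q z n + z\<^sup>2 * q * fine_term q (z * q\<^sup>2) n) sums
      (fine_sum q z + z\<^sup>2 * q * fine_sum q (z * q\<^sup>2))"
    unfolding fine_sum_def
    by (intro sums_add sums_mult summable_sums fine_summable z q zq)
  moreover have "T 0 = 1 + z"
    using z1 by (simp add: T_def fine_term_def field_simps power2_eq_square)
  ultimately show ?thesis
    unfolding tel using sums_unique2 by (fastforce simp: algebra_simps)
qed

lemma fine_sum_iterate:
  assumes q: "norm q < 1"
  shows "fine_sum q q = (\<Sum>i<n. (-1) ^ i * q ^ (2 * i\<^sup>2 + i) * (1 + q ^ (2 * i + 1)))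
           + (-1) ^ n * q ^ (2 * n\<^sup>2 + n) * fine_sum q (q ^ (2 * n + 1))"
proof (induction n)
  case (Suc n)
  have *: "fine_sum q (q ^ (2 * n + 1)) = 1 + q ^ (2 * n + 1) - (q ^ (2 * n + 1))\<^sup>2 * q * fine_sum q (q ^ (2 * n + 1) * q\<^sup>2)"
    using q by (intro fine_sum_rec) (auto simp: norm_power power_less_one_iff simp del: power_Suc)
  have e: "q ^ (2 * n + 1) * q\<^sup>2 = q ^ (2 * Suc n + 1)" "(q ^ (2 * n + 1))\<^sup>2 * q = q ^ (4 * n + 3)"
  proof -
    have "2 * n + 1 + 2 = 2 * Suc n + 1" "(2 * n + 1) * 2 + 1 = 4 * n + 3" by simp_all
    then show "q ^ (2 * n + 1) * q\<^sup>2 = q ^ (2 * Suc n + 1)" "(q ^ (2 * n + 1))\<^sup>2 * q = q ^ (4 * n + 3)"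
      by (metis power_add, metis power_add power_mult power_one_right)
  qed
  have e2: "q ^ (2 * n\<^sup>2 + n) * q ^ (4 * n + 3) = q ^ (2 * (Suc n)\<^sup>2 + Suc n)"
  proof -
    have "2 * n\<^sup>2 + n + (4 * n + 3) = 2 * (Suc n)\<^sup>2 + Suc n" by (simp add: power2_eq_square)
    then show ?thesis by (metis power_add)
  qed
  have ring: "S + A * B * (1 + z - W * g) = (S + A * B * (1 + z)) + (- A) * (B * W) * g"
    for S A B z W g :: complex
    by (simp add: algebra_simps)
  have minus: "(-1) ^ Suc n = - ((-1) ^ n :: complex)" by simp
  show ?case
    by (subst Suc, subst *[unfolded e], unfold e2[symmetric] sum.lessThan_Suc minus, rule ring)
qed simp

text \<open>Each application of the functional equation to \<open>z = q ^ (2 n + 1)\<close> splits off two terms of the partial theta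
  series and multiplies the remainder by a further power of \<open>q\<close>.\<close>

theorem fine_sum_partial_theta:
  assumes q: "norm q < 1"
  shows "(\<lambda>n. (-1) ^ n * q ^ (2 * n\<^sup>2 + n) * (1 + q ^ (2 * n + 1))) sums fine_sum q q"
proof -
  define R where "R = (\<lambda>n. (-1) ^ n * q ^ (2 * n\<^sup>2 + n) * fine_sum q (q ^ (2 * n + 1)))"
  have "R \<longlonglongrightarrow> 0"
  proof (rule Lim_null_comparison)
    have q0: "(\<lambda>n. norm q ^ n) \<longlonglongrightarrow> 0" using q by (intro LIMSEQ_power_zero) simp
    then have "eventually (\<lambda>n. norm q ^ n < 1/4) sequentially" by (rule order_tendstoD) simp
    then show "eventually (\<lambda>n. norm (R n) \<le> norm q ^ n * 2) sequentially"
    proof eventually_elim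
      case (elim n)
      have "norm (q ^ (2 * n + 1)) \<le> norm q ^ n"
        unfolding norm_power using q by (intro power_decreasing) auto
      then have "norm (fine_sum q (q ^ (2 * n + 1))) \<le> 2"
        using elim q by (intro fine_sum_bound) linarith+
      moreover have "norm q ^ (2 * n\<^sup>2 + n) \<le> norm q ^ n"
        using q by (intro power_decreasing) auto
      ultimately have "norm q ^ (2 * n\<^sup>2 + n) * norm (fine_sum q (q ^ (2 * n + 1))) \<le> norm q ^ n * 2"
        by (intro mult_mono) auto
      then show ?case
        unfolding R_def norm_mult norm_power by simp
    qed
    show "(\<lambda>n. norm q ^ n * 2) \<longlonglongrightarrow> 0"
      by (rule tendsto_mult_left_zero[OF q0])
  qed
  then have "(\<lambda>n. fine_sum q q - R n) \<longlonglongrightarrow> fine_sum q q - 0"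
    by (intro tendsto_diff tendsto_const)
  moreover have "fine_sum q q - R n = (\<Sum>i<n. (-1) ^ i * q ^ (2 * i\<^sup>2 + i) * (1 + q ^ (2 * i + 1)))" for n
    unfolding R_def using fine_sum_iterate[OF q, of n] by (simp only: add_diff_cancel_right')
  ultimately show ?thesis
    unfolding sums_def by (simp only: diff_zero)
qed

section \<open>The double series \<open>A_series\<close>\<close>

text \<open>The summands are differences of \<open>(- q\<^sup>2; q\<^sup>2)_k / (q; q\<^sup>2)_k\<close>, up to the factor \<open>(1 + q) / q\<close>.\<close>

lemma A_series_telescope:
  assumes q: "norm q < 1"
  shows "(1 + q) * (\<Sum>k=1..n. q ^ (2 * k) * qpoch (- (q\<^sup>2)) (q\<^sup>2) (k - 1) / qpoch q (q\<^sup>2) k)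
    = q * (qpoch (- (q\<^sup>2)) (q\<^sup>2) n / qpoch q (q\<^sup>2) n - 1)"
proof (induction n)
  case (Suc n)
  have nz: "qpoch q (q\<^sup>2) m \<noteq> 0" for m
    using q by (intro qpoch_nonzero) (simp_all add: norm_power power_le_one)
  have nz': "1 - q * q ^ (2 * n) \<noteq> 0"
    using nz[of "Suc n"] by (simp add: qpoch_Suc power_mult)
  define a b x where "a = qpoch (- (q\<^sup>2)) (q\<^sup>2) n" and "b = qpoch q (q\<^sup>2) n" and "x = q ^ (2 * n)"
  have xS: "q ^ (2 * Suc n) = x * q\<^sup>2" by (simp add: x_def power2_eq_square mult_ac)
  have S: "qpoch (- (q\<^sup>2)) (q\<^sup>2) (Suc n) = a * (1 + q\<^sup>2 * x)" "qpoch q (q\<^sup>2) (Suc n) = b * (1 - q * x)"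
    by (simp_all add: a_def b_def x_def qpoch_Suc power_mult)
  have b0: "b \<noteq> 0" "1 - q * x \<noteq> 0" using nz nz' by (simp_all add: b_def x_def)
  have "q * (a / b - 1) + (1 + q) * (x * q\<^sup>2 * a / (b * (1 - q * x)))
      = q * (a * (1 + q\<^sup>2 * x) / (b * (1 - q * x)) - 1)"
    using b0 by (simp add: divide_simps) (simp add: algebra_simps power2_eq_square)
  then show ?case
    unfolding sum.cl_ivl_Suc xS S using Suc by (simp add: distrib_left[of "1 + q"] flip: a_def b_def)
qed simp

text \<open>With \<open>l = n + 1\<close>, the summand of \<open>A_series\<close> separates into a function of \<open>n\<close> and a function of \<open>k\<close>, because
  \<open>(x p\<^sup>k; p)_(n - k) = (x; p)_n / (x; p)_k\<close>.\<close>

lemma A_series_summand: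
  assumes q: "norm q < 1" and k: "1 \<le> k" "k \<le> n"
  shows "qpoch (q ^ (2 * k + 1)) (q\<^sup>2) (n - k) / qpoch (- (q ^ (2 * k))) (q\<^sup>2) (Suc n - k) * q ^ (2 * k + n)
    = q ^ n * qpoch q (q\<^sup>2) n / qpoch (- (q\<^sup>2)) (q\<^sup>2) n
        * (q ^ (2 * k) * qpoch (- (q\<^sup>2)) (q\<^sup>2) (k - 1) / qpoch q (q\<^sup>2) k)"
proof -
  have "norm (q\<^sup>2) < 1" using q by (simp add: norm_power abs_square_less_1)
  then have nz: "qpoch q (q\<^sup>2) m \<noteq> 0" "qpoch (- (q\<^sup>2)) (q\<^sup>2) m \<noteq> 0" for m
    using q by (intro qpoch_nonzero; simp)+
  have 1: "qpoch q (q\<^sup>2) k * qpoch (q ^ (2 * k + 1)) (q\<^sup>2) (n - k) = qpoch q (q\<^sup>2) n"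
    using qpoch_add[of q "q\<^sup>2" k "n - k"] k by (simp add: power_mult)
  have "- (q\<^sup>2) * (q\<^sup>2) ^ (k - 1) = - (q ^ (2 * k))"
    using k by (cases k) (simp_all add: power_mult power2_eq_square)
  moreover have "k - 1 + (Suc n - k) = n" using k by simp
  ultimately have 2: "qpoch (- (q\<^sup>2)) (q\<^sup>2) (k - 1) * qpoch (- (q ^ (2 * k))) (q\<^sup>2) (Suc n - k) = qpoch (- (q\<^sup>2)) (q\<^sup>2) n"
    using qpoch_add[of "- (q\<^sup>2)" "q\<^sup>2" "k - 1" "Suc n - k"] by simp
  have nz': "qpoch (- (q ^ (2 * k))) (q\<^sup>2) (Suc n - k) \<noteq> 0"
    using 2 nz by (metis mult_zero_right)
  show ?thesis
    unfolding 1[symmetric] 2[symmetric] power_add using nz nz' by (simp add: field_simps)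
qed

text \<open>Summing over \<open>k\<close> first leaves a geometric series minus the \<open>q\<close>-series at \<open>z = q\<close>.\<close>

lemma A_series_eq:
  assumes q: "norm q < 1"
  shows "(1 + q) * A_series q = q * (1 / (1 - q) - fine_sum q q)"
proof -
  define r where "r = norm q"
  have r: "0 \<le> r" "r < 1" using q by (auto simp: r_def)
  have q2: "norm (q\<^sup>2) < 1" "norm (- (q\<^sup>2)) < 1" using q by (auto simp: norm_power abs_square_less_1)
  define t where "t = (\<lambda>l k. qpoch (q ^ (2 * k + 1)) (q\<^sup>2) (l - k - 1) / qpoch (- (q ^ (2 * k))) (q\<^sup>2) (l - k)
       * q ^ (2 * k + l - 1))"
  define u where "u = (\<lambda>n k. q ^ n * qpoch q (q\<^sup>2) n / qpoch (- (q\<^sup>2)) (q\<^sup>2) n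
        * (q ^ (2 * k) * qpoch (- (q\<^sup>2)) (q\<^sup>2) (k - 1) / qpoch q (q\<^sup>2) k))"
  define S where "S = (SIGMA n:UNIV. {1..n::nat})"
  have bij: "bij_betw (\<lambda>(n, k). (Suc n, k)) S {(l, k). 2 \<le> l \<and> 1 \<le> k \<and> k \<le> l - 1}"
    by (rule bij_betwI[where g = "\<lambda>(l, k). (l - 1, k)"]) (auto simp: S_def)
  have "A_series q = (\<Sum>\<^sub>\<infinity>(l, k)\<in>{(l, k). 2 \<le> l \<and> 1 \<le> k \<and> k \<le> l - 1}. t l k)"
    by (simp add: A_series_def t_def)
  also have "\<dots> = (\<Sum>\<^sub>\<infinity>(n, k)\<in>S. t (Suc n) k)"
    using infsum_reindex_bij_betw[OF bij, of "\<lambda>(l, k). t l k"] by (simp add: case_prod_unfold)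
  also have "\<dots> = (\<Sum>\<^sub>\<infinity>(n, k)\<in>S. u n k)"
  proof (rule infsum_cong, clarify)
    fix n k assume "(n, k) \<in> S"
    then have k: "1 \<le> k" "k \<le> n" by (auto simp: S_def)
    then have "Suc n - k - 1 = n - k" "2 * k + Suc n - 1 = 2 * k + n" by auto
    then show "t (Suc n) k = u n k"
      using A_series_summand[OF q k] by (simp only: t_def u_def)
  qed
  finally have A: "A_series q = (\<Sum>\<^sub>\<infinity>(n, k)\<in>S. u n k)" .

  obtain K1 where K1: "\<And>n. norm (qpoch q (q\<^sup>2) n) \<le> K1"
    using qpoch_Bseq(1)[OF q q2(1)] by (auto simp: Bseq_def)
  obtain K2 where K2: "\<And>n. norm (inverse (qpoch q (q\<^sup>2) n)) \<le> K2"
    using qpoch_Bseq(2)[OF q q2(1)] by (auto simp: Bseq_def)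
  obtain K3 where K3: "\<And>n. norm (qpoch (- (q\<^sup>2)) (q\<^sup>2) n) \<le> K3"
    using qpoch_Bseq(1)[OF q2(2) q2(1)] by (auto simp: Bseq_def)
  obtain K4 where K4: "\<And>n. norm (inverse (qpoch (- (q\<^sup>2)) (q\<^sup>2) n)) \<le> K4"
    using qpoch_Bseq(2)[OF q2(2) q2(1)] by (auto simp: Bseq_def)
  have K0: "K1 \<ge> 0" "K2 \<ge> 0" "K3 \<ge> 0" "K4 \<ge> 0"
    using K1[of 0] K2[of 0] K3[of 0] K4[of 0] by (auto intro: order_trans[rotated])
  define K where "K = K1 * K4 * (K3 * K2)"
  \<comment> \<open>one of the two factors \<open>r ^ k\<close> of \<open>r ^ (2 * k)\<close> is enough for convergence\<close>
  have bound: "norm (u n k) \<le> K * r ^ n * r ^ k" for n k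
  proof -
    have "norm (u n k) = r ^ n * (r ^ (2 * k)) * (norm (qpoch q (q\<^sup>2) n) * norm (inverse (qpoch (- (q\<^sup>2)) (q\<^sup>2) n))
        * (norm (qpoch (- (q\<^sup>2)) (q\<^sup>2) (k - 1)) * norm (inverse (qpoch q (q\<^sup>2) k))))"
      by (simp add: u_def r_def norm_mult norm_divide norm_power norm_inverse divide_simps)
    also have "\<dots> \<le> r ^ n * r ^ k * (K1 * K4 * (K3 * K2))"
      using r K0 by (intro mult_mono K1 K2 K3 K4 power_decreasing mult_nonneg_nonneg) auto
    finally show ?thesis by (simp add: K_def mult_ac)
  qed
  have "(\<lambda>(n, k). K * r ^ n * r ^ k) summable_on (UNIV \<times> UNIV :: (nat \<times> nat) set)"
  proof (rule summable_on_SigmaI)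
    have geo: "((\<lambda>k. r ^ k) has_sum (1 / (1 - r))) UNIV"
      using r by (intro sums_nonneg_imp_has_sum geometric_sums) auto
    show "((\<lambda>k. case (n, k) of (n, k) \<Rightarrow> K * r ^ n * r ^ k) has_sum (K * r ^ n * (1 / (1 - r)))) UNIV" for n
      using has_sum_cmult_right[OF geo] by simp
    show "(\<lambda>n. K * r ^ n * (1 / (1 - r))) summable_on UNIV"
      using has_sum_cmult_left[OF has_sum_cmult_right[OF geo]] by (rule has_sum_imp_summable)
  qed (use r K0 in \<open>auto simp: K_def\<close>)
  then have "(\<lambda>(n, k). K * r ^ n * r ^ k) summable_on S"
    by (rule summable_on_subset) (auto simp: S_def)
  then have "(\<lambda>x. norm (case x of (n, k) \<Rightarrow> u n k)) summable_on S"
    by (rule summable_on_comparison_test) (use bound in auto)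
  then have "(\<lambda>(n, k). u n k) summable_on S"
    by (rule abs_summable_summable)
  then have "((\<lambda>(n, k). u n k) has_sum A_series q) S"
    unfolding A by (rule has_sum_infsum)
  then have "((\<lambda>n. \<Sum>k=1..n. u n k) has_sum A_series q) UNIV"
    unfolding S_def by (rule has_sum_SigmaD) (auto intro!: has_sum_finiteI)
  then have "(\<lambda>n. \<Sum>k=1..n. u n k) sums A_series q"
    by (rule has_sum_imp_sums)
  then have "(\<lambda>n. (1 + q) * (\<Sum>k=1..n. u n k)) sums ((1 + q) * A_series q)"
    by (rule sums_mult)
  moreover have "(1 + q) * (\<Sum>k=1..n. u n k) = q * (q ^ n - fine_term q q n)" for n
  proof -
    have nz: "qpoch q (q\<^sup>2) n \<noteq> 0" "qpoch (- (q\<^sup>2)) (q\<^sup>2) n \<noteq> 0"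
      using q q2 by (intro qpoch_nonzero; simp)+
    have "(1 + q) * (\<Sum>k=1..n. u n k) = q ^ n * qpoch q (q\<^sup>2) n / qpoch (- (q\<^sup>2)) (q\<^sup>2) n
       * ((1 + q) * (\<Sum>k=1..n. q ^ (2 * k) * qpoch (- (q\<^sup>2)) (q\<^sup>2) (k - 1) / qpoch q (q\<^sup>2) k))"
      unfolding u_def sum_distrib_left[symmetric] by (simp only: mult_ac)
    also have "\<dots> = q * (q ^ n - fine_term q q n)"
      unfolding A_series_telescope[OF q] fine_term_def power2_eq_square[of q, symmetric]
      using nz by (simp add: field_simps)
    finally show ?thesis .
  qed
  moreover have "(\<lambda>n. q * (q ^ n - fine_term q q n)) sums (q * (1 / (1 - q) - fine_sum q q))"
    unfolding fine_sum_def using q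
    by (intro sums_mult sums_diff geometric_sums summable_sums fine_summable)
  ultimately show ?thesis
    using sums_unique2 by (simp add: sums_unique2)
qed

section \<open>Gaussian sums and the partial theta series\<close>

lemma summable_power_exp:
  fixes a :: real
  assumes "a > 0"
  shows "summable (\<lambda>r::nat. real r ^ k * exp (- a * real r))"
proof (rule summable_comparison_test_ev)
  have "((\<lambda>x::real. x ^ k / exp x) \<longlongrightarrow> 0) at_top" by (rule tendsto_power_div_exp_0)
  then have "((\<lambda>r::nat. (a / 2 * real r) ^ k / exp (a / 2 * real r)) \<longlongrightarrow> 0) sequentially"
    by (rule filterlim_compose)
       (intro filterlim_tendsto_pos_mult_at_top[OF tendsto_const] filterlim_real_sequentially, use assms in simp)
  then have "eventually (\<lambda>r::nat. (a / 2 * real r) ^ k / exp (a / 2 * real r) < 1) sequentially"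
    by (rule order_tendstoD) simp
  then show "eventually (\<lambda>r::nat. norm (real r ^ k * exp (- a * real r)) \<le> (2 / a) ^ k * exp (- a / 2) ^ r) sequentially"
  proof eventually_elim
    case (elim r)
    have "real r ^ k = (2 / a) ^ k * (a / 2 * real r) ^ k"
      using assms by (simp flip: power_mult_distrib)
    also have "\<dots> \<le> (2 / a) ^ k * exp (a / 2 * real r)"
      using elim assms by (intro mult_left_mono) (auto simp: divide_simps mult_ac intro: less_imp_le)
    finally have "real r ^ k * exp (- a * real r) \<le> (2 / a) ^ k * exp (a / 2 * real r) * exp (- a * real r)"
      by (intro mult_right_mono) auto
    also have "\<dots> = (2 / a) ^ k * exp (- a / 2) ^ r"
      by (simp add: mult.assoc flip: exp_add exp_of_nat_mult)
    finally show ?case by simp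
  qed
  show "summable (\<lambda>r. (2 / a) ^ k * exp (- a / 2) ^ r)"
    using assms by (intro summable_mult summable_geometric) auto
qed

lemma summable_power_gauss:
  fixes a :: real
  assumes "a > 0"
  shows "summable (\<lambda>r::nat. real r ^ k * exp (- a * real r ^ 2))"
proof (rule summable_comparison_test'[OF summable_power_exp[OF assms, of k], of 0])
  fix r :: nat
  have "real r \<le> real r ^ 2" by (cases r) (auto simp: power2_eq_square)
  then show "norm (real r ^ k * exp (- a * real r ^ 2)) \<le> real r ^ k * exp (- a * real r)"
    using assms by (auto intro!: mult_left_mono)
qed

lemma summable_on_int:
  fixes f :: "int \<Rightarrow> real"
  assumes "summable (\<lambda>n::nat. f (int n))" "summable (\<lambda>n::nat. f (- int n))" "\<And>n. f n \<ge> 0"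
  shows "f summable_on UNIV"
proof -
  have "f summable_on (range int)"
    using assms by (subst summable_on_reindex) (auto simp: o_def intro!: summable_nonneg_imp_summable_on)
  moreover have "f summable_on (range (\<lambda>n. - int n))"
    using assms by (subst summable_on_reindex) (auto simp: o_def inj_on_def intro!: summable_nonneg_imp_summable_on)
  ultimately have "f summable_on (range int \<union> range (\<lambda>n. - int n))"
    by (rule summable_on_union)
  also have "range int \<union> range (\<lambda>n. - int n) = UNIV"
    by (auto simp: image_iff) (metis int_cases2)
  finally show ?thesis .
qed

text \<open>The majorant of all theta series below.\<close>

lemma summable_on_power_gauss:
  fixes a :: real
  assumes "a > 0"
  shows "(\<lambda>r::int. \<bar>real_of_int r\<bar> ^ k * exp (- a * real_of_int r ^ 2)) summable_on UNIV"
  by (rule summable_on_int) (use summable_power_gauss[OF assms, of k] in auto)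

lemma norm_psi_le: "norm (psi r) \<le> 1"
  by (simp add: psi_def)

lemma psi_minus: "psi (- r) = - psi r"
  by (auto simp: psi_def zmod_zminus1_eq_if)

lemma psi_cong: "[r = s] (mod 8) \<Longrightarrow> psi r = psi s"
  by (simp add: psi_def cong_def)

lemma norm_exp_gauss: "norm (exp (2 * of_real pi * \<i> * z * of_nat r ^ 2 / 16)) = exp (- (pi * Im z / 8) * real r ^ 2)"
  by (simp add: norm_exp_eq_Re power2_eq_square)

lemma theta_psi_sums:
  assumes "Im z > 0"
  shows "(\<lambda>r::nat. psi (int r) * exp (2 * of_real pi * \<i> * z * of_nat r ^ 2 / 16)) sums theta_psi z"
  unfolding theta_psi_def
proof (rule summable_sums, rule summable_norm_cancel, rule summable_comparison_test')
  show "summable (\<lambda>r::nat. real r ^ 0 * exp (- (pi * Im z / 8) * real r ^ 2))"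
    using assms by (intro summable_power_gauss) auto
  show "norm (norm (psi (int r) * exp (2 * of_real pi * \<i> * z * of_nat r ^ 2 / 16)))
      \<le> real r ^ 0 * exp (- (pi * Im z / 8) * real r ^ 2)" if "r \<ge> 0" for r
    unfolding real_norm_def abs_norm_cancel norm_mult norm_exp_gauss
    using norm_psi_le[of "int r"] by (auto intro!: mult_left_le_one_le)
qed

text \<open>The geometric series in \<open>A_series_eq\<close> cancels the term \<open>e (1/8) / (1 - q)\<close> of \<open>Theta\<close>.\<close>

lemma Theta_eq_fine_sum:
  assumes \<tau>: "Im \<tau> > 0"
  shows "Theta \<tau> = exp (2 * of_real pi * \<i> * \<tau> * of_real (1/8)) * fine_sum (exp (2 * of_real pi * \<i> * \<tau>)) (exp (2 * of_real pi * \<i> * \<tau>))"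
proof -
  define e where "e = (\<lambda>s::real. exp (2 * of_real pi * \<i> * \<tau> * of_real s))"
  define q where "q = e 1"
  have add: "e (s + t) = e s * e t" for s t
    by (simp add: e_def distrib_left exp_add)
  have q: "norm q < 1" using \<tau> by (simp add: q_def e_def)
  have "e (-7/8) * q = e (1/8)"
    unfolding q_def add[symmetric] by simp
  have "Theta \<tau> = e (1/8) / (1 - q) - e (-7/8) * ((1 + q) * A_series q)"
    by (simp add: Theta_def e_def q_def Let_def)
  also have "\<dots> = e (1/8) * fine_sum q q"
    unfolding A_series_eq[OF q] mult.assoc[symmetric] \<open>e (-7/8) * q = e (1/8)\<close>
    by (simp add: algebra_simps)
  finally show ?thesis by (simp add: e_def q_def)
qed

text \<open>Among four consecutive indices \<open>4 n, \<dots>, 4 n + 3\<close> only the odd ones contribute, both with the sign \<open>(-1) ^ n\<close>,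
  and their squares match the exponents \<open>2 n\<^sup>2 + n\<close> and \<open>2 n\<^sup>2 + 3 n + 1\<close> of the \<open>q\<close>-series.\<close>

theorem Theta_eq_theta_psi:
  assumes \<tau>: "Im \<tau> > 0"
  shows "Theta \<tau> = theta_psi (2 * \<tau>)"
proof -
  define e where "e = (\<lambda>s::real. exp (2 * of_real pi * \<i> * \<tau> * of_real s))"
  define q where "q = e 1"
  have add: "e (s + t) = e s * e t" for s t
    by (simp add: e_def distrib_left exp_add)
  have pw: "e s ^ n = e (real n * s)" for s n
    by (simp add: e_def exp_of_nat_mult[symmetric] mult_ac)
  have q: "norm q < 1" using \<tau> by (simp add: q_def e_def)
  have 1: "Theta \<tau> = e (1/8) * fine_sum q q"
    using Theta_eq_fine_sum[OF \<tau>] by (simp add: e_def q_def)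
  have "(\<lambda>r::nat. psi (int r) * e (real r ^ 2 / 8)) sums theta_psi (2 * \<tau>)"
    using theta_psi_sums[of "2 * \<tau>"] \<tau> by (simp add: e_def mult_ac)
  then have "(\<lambda>n. \<Sum>r\<in>{n*4..<n*4+4}. psi (int r) * e (real r ^ 2 / 8)) sums theta_psi (2 * \<tau>)"
    by (rule sums_group) simp
  moreover have "(\<Sum>r\<in>{n*4..<n*4+4}. psi (int r) * e (real r ^ 2 / 8))
      = e (1/8) * ((-1) ^ n * q ^ (2 * n\<^sup>2 + n) * (1 + q ^ (2 * n + 1)))" for n
  proof -
    have ps: "psi (int (n*4)) = 0" "psi (int (n*4+1)) = (-1) ^ n" "psi (int (n*4+2)) = 0" "psi (int (n*4+3)) = (-1) ^ n"
    proof -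
      have "int (n*4) mod 8 = (if even n then 0 else 4)" "int (n*4+1) mod 8 = (if even n then 1 else 5)"
        "int (n*4+2) mod 8 = (if even n then 2 else 6)" "int (n*4+3) mod 8 = (if even n then 3 else 7)"
        by presburger+
      then show "psi (int (n*4)) = 0" "psi (int (n*4+1)) = (-1) ^ n" "psi (int (n*4+2)) = 0" "psi (int (n*4+3)) = (-1) ^ n"
        unfolding psi_def by auto
    qed
    have "(\<Sum>r\<in>{m..<m+4}. f r) = f m + f (m+1) + f (m+2) + f (m+3)" for f :: "nat \<Rightarrow> complex" and m
      by (simp add: numeral_eq_Suc)
    then have "(\<Sum>r\<in>{n*4..<n*4+4}. psi (int r) * e (real r ^ 2 / 8))
       = (-1) ^ n * e (real (n*4+1) ^ 2 / 8) + (-1) ^ n * e (real (n*4+3) ^ 2 / 8)"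
      by (simp only: ps) simp
    also have "e (real (n*4+1) ^ 2 / 8) = e (1/8) * q ^ (2 * n\<^sup>2 + n)"
      unfolding q_def pw add[symmetric] by (rule arg_cong[where f = e]) (simp add: power2_eq_square field_simps)
    also have "e (real (n*4+3) ^ 2 / 8) = e (1/8) * (q ^ (2 * n\<^sup>2 + n) * q ^ (2 * n + 1))"
      unfolding power_add[symmetric] unfolding q_def pw add[symmetric]
      by (rule arg_cong[where f = e]) (simp add: power2_eq_square field_simps)
    finally show ?thesis by (simp only: distrib_left mult_1_right) (simp only: mult_ac)
  qed
  moreover have "(\<lambda>n. e (1/8) * ((-1) ^ n * q ^ (2 * n\<^sup>2 + n) * (1 + q ^ (2 * n + 1)))) sums (e (1/8) * fine_sum q q)"
    by (intro sums_mult fine_sum_partial_theta q)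
  ultimately show ?thesis
    unfolding 1 using sums_unique2 by fastforce
qed

section \<open>Fourier coefficients of continuous periodic functions\<close>

text \<open>The characters of the circle. With \<open>k = 1\<close> the function also serves as \<open>x \<mapsto> exp (2 \<pi> \<i> x)\<close>.\<close>

definition echar :: "int \<Rightarrow> real \<Rightarrow> complex" where
  "echar k x = exp (2 * of_real pi * \<i> * of_int k * of_real x)"

lemma echar_0 [simp]: "echar 0 x = 1" "echar k 0 = 1"
  by (simp_all add: echar_def)

lemma echar_add: "echar (k + l) x = echar k x * echar l x"
  by (simp add: echar_def exp_add[symmetric] algebra_simps)

lemma norm_echar [simp]: "norm (echar k x) = 1"
  by (simp add: echar_def norm_exp_eq_Re)

lemma continuous_on_echar [continuous_intros]: "continuous_on A (echar k)"
  unfolding echar_def by (intro continuous_intros)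

lemma echar_int: "echar k (of_int n) = 1"
proof -
  have "echar k (of_int n) = exp (2 * of_real pi * \<i> * of_int (k * n))"
    by (simp add: echar_def mult_ac)
  also have "\<dots> = 1" by (rule exp_eq_1[THEN iffD2]) (auto simp: mult_ac intro!: exI[of _ "k * n"])
  finally show ?thesis .
qed

lemma echar_add_right: "echar k (x + y) = echar k x * echar k y"
  by (simp add: echar_def exp_add[symmetric] algebra_simps)

lemma echar_add_int [simp]: "echar k (x + of_int n) = echar k x"
  by (simp add: echar_add_right echar_int)

lemma echar_has_integral:
  "(echar k has_integral (if k = 0 then 1 else 0)) {0..1}"
proof (cases "k = 0")
  case True
  have "((\<lambda>x::real. 1::complex) has_integral of_real (1 - 0)) {0..1}"
    using has_integral_const_real[of "1::complex" 0 1] by simp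
  with True show ?thesis by (simp add: echar_def[abs_def])
next
  case False
  define c where "c = 2 * of_real pi * \<i> * of_int k"
  have c: "c \<noteq> 0" using False by (simp add: c_def)
  have "((\<lambda>x. exp (c * of_real x)) has_integral (exp (c * of_real 1) / c - exp (c * of_real 0) / c)) {0..1}"
    by (rule fundamental_theorem_of_calculus)
       (auto intro!: derivative_eq_intros has_vector_derivative_real_field simp: c)
  moreover have "exp (c * of_real 1) = 1"
    using echar_int[of k 1] by (simp add: echar_def c_def)
  ultimately show ?thesis using False by (simp add: echar_def[abs_def] c_def)
qed

lemma periodic_add_int:
  fixes g :: "real \<Rightarrow> complex"
  assumes "\<And>x. g (x + 1) = g x"
  shows "g (x + of_int n) = g x"
proof (induction n rule: int_induct[of _ 0])
  case (step1 i)
  then show ?case using assms[of "x + of_int i"] by (simp add: add_ac)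
next
  case (step2 i)
  then show ?case using assms[of "x + of_int (i - 1)"] by (simp add: add_ac)
qed simp

lemma continuous_on_polynomial_circle:
  fixes r :: "complex \<Rightarrow> real"
  assumes "real_polynomial_function r"
  shows "continuous_on {0..1} (\<lambda>x. r (cis (2 * pi * x)))"
proof -
  have "polynomial_function r" using assms by (simp add: real_polynomial_function_eq)
  then have "continuous_on UNIV r" by (rule continuous_on_polymonial_function)
  then show ?thesis
    by (rule continuous_on_compose2) (auto intro!: continuous_intros)
qed

text \<open>Multiplication by a real-linear function of \<open>cis (2 \<pi> x)\<close> only shifts Fourier coefficients by \<open>1\<close> and \<open>-1\<close>, so a
  function whose coefficients all vanish stays so after multiplication by a polynomial.\<close>

lemma fourier_coefficient_polynomial:
  fixes r :: "complex \<Rightarrow> real" and h :: "real \<Rightarrow> complex"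
  assumes "real_polynomial_function r" "continuous_on {0..1} h"
    and "\<And>k. integral {0..1} (\<lambda>x. h x * echar k x) = 0"
  shows "integral {0..1} (\<lambda>x. h x * of_real (r (cis (2 * pi * x))) * echar k x) = 0"
  using assms
proof (induction arbitrary: h k rule: real_polynomial_function.induct)
  case (linear r)
  interpret bounded_linear r by fact
  define a b where "a = r 1" and "b = r \<i>"
  have r: "complex_of_real (r (cis (2 * pi * x))) = (of_real a - \<i> * of_real b) / 2 * echar 1 x + (of_real a + \<i> * of_real b) / 2 * echar (-1) x" for x
  proof -
    have "cis (2 * pi * x) = cos (2 * pi * x) *\<^sub>R 1 + sin (2 * pi * x) *\<^sub>R \<i>"
      by (simp add: complex_eq_iff)
    then have "r (cis (2 * pi * x)) = cos (2 * pi * x) * a + sin (2 * pi * x) * b"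
      unfolding a_def b_def by (simp only: add scaleR) simp
    then show ?thesis
      by (simp add: echar_def complex_eq_iff exp_eq_polar mult_ac Re_exp Im_exp field_simps)
  qed
  have int: "(\<lambda>x. h x * echar k x) integrable_on {0..1}" for k
    by (intro integrable_continuous_real continuous_intros linear.prems(1))
  have "integral {0..1} (\<lambda>x. h x * of_real (r (cis (2 * pi * x))) * echar k x)
     = integral {0..1} (\<lambda>x. (of_real a - \<i> * of_real b) / 2 * (h x * echar (k + 1) x) + (of_real a + \<i> * of_real b) / 2 * (h x * echar (k + (-1)) x))"
    unfolding r echar_add by (simp only: algebra_simps)
  also have "\<dots> = 0"
    by (subst integral_add)
       (simp_all only: integral_mult_right linear.prems(2) mult_zero_right add_0 integrable_on_mult_right int)
  finally show ?case .
next
  case (const c)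
  then show ?case
    using integral_mult_left[of "{0..1::real}" "\<lambda>x. h x * echar k x" "of_real c"] by (simp add: mult_ac)
next
  case (add f g)
  have cf: "continuous_on {0..1} (\<lambda>x. f (cis (2 * pi * x)))" "continuous_on {0..1} (\<lambda>x. g (cis (2 * pi * x)))"
    using add.hyps by (auto intro: continuous_on_polynomial_circle)
  have "integral {0..1} (\<lambda>x. h x * of_real (f (cis (2 * pi * x)) + g (cis (2 * pi * x))) * echar k x)
     = integral {0..1} (\<lambda>x. h x * of_real (f (cis (2 * pi * x))) * echar k x + h x * of_real (g (cis (2 * pi * x))) * echar k x)"
    by (simp add: algebra_simps)
  also have "\<dots> = 0"
    by (subst integral_add)
       (auto simp: add.IH(1)[OF add.prems] add.IH(2)[OF add.prems]
             intro!: integrable_continuous_real continuous_intros add.prems(1) cf)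
  finally show ?case .
next
  case (mult f g)
  have cf: "continuous_on {0..1} (\<lambda>x. f (cis (2 * pi * x)))"
    using mult.hyps by (auto intro: continuous_on_polynomial_circle)
  have "integral {0..1} (\<lambda>x. (h x * of_real (f (cis (2 * pi * x)))) * of_real (g (cis (2 * pi * x))) * echar k x) = 0"
    by (rule mult.IH(2)) (intro continuous_intros mult.prems(1) cf, rule mult.IH(1)[OF mult.prems])
  then show ?case by (simp add: mult_ac)
qed

text \<open>A continuous periodic function is orthogonal to every polynomial in \<open>cis (2 \<pi> x)\<close> if its Fourier
  coefficients vanish. By the theorem of Stone and Weierstrass it is then orthogonal to itself.\<close>

lemma fourier_uniqueness:
  fixes g :: "real \<Rightarrow> complex"
  assumes cont: "continuous_on UNIV g" and per: "\<And>x. g (x + 1) = g x"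
    and zero: "\<And>k. integral {0..1} (\<lambda>x. g x * echar k x) = 0"
  shows "g x = 0"
proof -
  \<comment> \<open>\<open>g\<close> as a function on the unit circle; continuity at \<open>-1\<close>, where \<open>Arg\<close> jumps, uses the periodicity\<close>
  define G where "G = (\<lambda>z. g (Arg z / (2 * pi)))"
  have G: "G (cis (2 * pi * y)) = g y" for y
  proof -
    have "cis (Arg (cis (2 * pi * y))) = cis (2 * pi * y)"
      by (subst cis_Arg) (auto simp: sgn_eq)
    then have "exp (\<i> * of_real (Arg (cis (2 * pi * y)))) = exp (\<i> * of_real (2 * pi * y))"
      by (simp add: cis_conv_exp)
    then obtain n :: int where "\<i> * of_real (Arg (cis (2 * pi * y))) = \<i> * of_real (2 * pi * y) + of_int (2 * n) * of_real pi * \<i>"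
      by (auto simp: exp_eq)
    then have "Arg (cis (2 * pi * y)) = 2 * pi * y + 2 * pi * of_int n"
      by (simp add: complex_eq_iff algebra_simps)
    then have "Arg (cis (2 * pi * y)) / (2 * pi) = y + of_int n"
      by (simp add: field_simps)
    then show ?thesis by (simp add: G_def periodic_add_int[where g = g, OF per])
  qed
  have gC: "isCont g y" for y using cont by (simp add: continuous_on_eq_continuous_at)
  have AC: "isCont Arg z" if "z \<notin> \<real>\<^sub>\<le>\<^sub>0" for z using continuous_at_Arg[OF that] .
  have "continuous_on (sphere 0 1) G"
    unfolding continuous_on_eq_continuous_within
  proof
    fix z :: complex assume z: "z \<in> sphere 0 1"
    show "continuous (at z within sphere 0 1) G"
    proof (cases "z \<in> \<real>\<^sub>\<le>\<^sub>0")
      case False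
      have "isCont G z"
        unfolding G_def using False by (intro isCont_o2[OF _ gC] continuous_intros AC) auto
      then show ?thesis by (rule continuous_at_imp_continuous_at_within)
    next
      case True
      then have "- z \<notin> \<real>\<^sub>\<le>\<^sub>0" using z by (auto elim!: nonpos_Reals_cases)
      then have "isCont (\<lambda>z. g (Arg (- z) / (2 * pi) + 1 / 2)) z"
        by (intro isCont_o2[OF _ gC] continuous_intros isCont_o2[OF _ AC]) auto
      then have *: "continuous (at z within sphere 0 1) (\<lambda>z. g (Arg (- z) / (2 * pi) + 1 / 2))"
        by (rule continuous_at_imp_continuous_at_within)
      have eq: "g (Arg (- w) / (2 * pi) + 1 / 2) = G w" if "w \<in> sphere 0 1" for w
      proof -
        have "cis (Arg (- w)) = - w" using that by (subst cis_Arg) (auto simp: sgn_eq)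
        moreover have "2 * pi * (Arg (- w) / (2 * pi) + 1 / 2) = Arg (- w) + pi" by (simp add: field_simps)
        ultimately have "cis (2 * pi * (Arg (- w) / (2 * pi) + 1 / 2)) = w"
          by (simp add: cis_mult[symmetric])
        then show ?thesis using G by metis
      qed
      show ?thesis
        by (rule continuous_transform_within[OF * zero_less_one z]) (simp add: eq)
    qed
  qed
  define I where "I = integral {0..1} (\<lambda>x. norm (g x))"
  have contg: "continuous_on {0..1} g" using cont by (rule continuous_on_subset) auto
  have I0: "I \<ge> 0" unfolding I_def by (intro integral_nonneg integrable_continuous_real continuous_intros contg) auto
  have small: "integral {0..1} (\<lambda>x. (norm (g x))\<^sup>2) \<le> e * I" if e: "e > 0" for e
  proof -
    obtain p where p: "polynomial_function p" "\<And>z. z \<in> sphere 0 1 \<Longrightarrow> norm (G z - p z) < e"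
      using Stone_Weierstrass_polynomial_function[OF compact_sphere \<open>continuous_on (sphere 0 1) G\<close> e] by blast
    define P where "P = (\<lambda>x. p (cis (2 * pi * x)))"
    have P: "norm (g x - P x) \<le> e" for x
      using p(2)[of "cis (2 * pi * x)"] by (simp add: G P_def)
    have rp: "real_polynomial_function (Re \<circ> p)" "real_polynomial_function (Im \<circ> p)"
      using p(1) bounded_linear_Re bounded_linear_Im unfolding polynomial_function_def by blast+
    have contP: "continuous_on {0..1} P"
      unfolding P_def
      by (rule continuous_on_compose2[OF continuous_on_polymonial_function[OF p(1), of UNIV]])
         (auto intro!: continuous_intros)
    have z: "integral {0..1} (\<lambda>x. g x * of_real (Re (P x))) = 0" "integral {0..1} (\<lambda>x. g x * of_real (Im (P x))) = 0"
      using fourier_coefficient_polynomial[OF rp(1) contg zero, of 0]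
        fourier_coefficient_polynomial[OF rp(2) contg zero, of 0] by (simp_all add: P_def)
    have "integral {0..1} (\<lambda>x. g x * cnj (P x))
        = integral {0..1} (\<lambda>x. g x * of_real (Re (P x)) + (- \<i>) * (g x * of_real (Im (P x))))"
      by (intro integral_cong) (simp add: complex_eq_iff algebra_simps)
    also have "\<dots> = 0"
      by (subst integral_add)
         (auto simp: z intro!: integrable_continuous_real continuous_intros contg contP)
    finally have zP: "integral {0..1} (\<lambda>x. g x * cnj (P x)) = 0" .
    have int2: "(\<lambda>x. (norm (g x))\<^sup>2) integrable_on {0..1}"
      by (intro integrable_continuous_real continuous_intros contg)
    have "complex_of_real (integral {0..1} (\<lambda>x. (norm (g x))\<^sup>2)) = integral {0..1} (\<lambda>x. complex_of_real ((norm (g x))\<^sup>2))"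
      using integral_linear[OF int2 bounded_linear_of_real[where 'a = complex]] by (simp add: o_def)
    also have "\<dots> = integral {0..1} (\<lambda>x. g x * cnj (g x))"
      by (simp only: complex_norm_square)
    also have "\<dots> = integral {0..1} (\<lambda>x. g x * cnj (g x)) - integral {0..1} (\<lambda>x. g x * cnj (P x))"
      by (simp add: zP)
    also have "\<dots> = integral {0..1} (\<lambda>x. g x * cnj (g x) - g x * cnj (P x))"
      by (rule integral_diff[symmetric]; intro integrable_continuous_real continuous_intros contg contP)
    also have "\<dots> = integral {0..1} (\<lambda>x. g x * cnj (g x - P x))"
      by (simp add: algebra_simps)
    finally have "norm (complex_of_real (integral {0..1} (\<lambda>x. (norm (g x))\<^sup>2)))
        = norm (integral {0..1} (\<lambda>x. g x * cnj (g x - P x)))" by simp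
    also have "\<dots> \<le> integral {0..1} (\<lambda>x. norm (g x) * e)"
    proof (rule integral_norm_bound_integral)
      show "norm (g x * cnj (g x - P x)) \<le> norm (g x) * e" for x
        unfolding norm_mult complex_mod_cnj by (intro mult_left_mono P) auto
    qed (intro integrable_continuous_real continuous_intros contg contP)+
    also have "\<dots> = e * I" by (simp add: I_def)
    finally show ?thesis by simp
  qed
  have "integral {0..1} (\<lambda>x. (norm (g x))\<^sup>2) \<le> 0"
  proof (rule field_le_epsilon)
    fix e :: real assume "e > 0"
    then have "e / (I + 1) > 0" using I0 by simp
    from small[OF this] have "integral {0..1} (\<lambda>x. (norm (g x))\<^sup>2) \<le> e / (I + 1) * I" .
    also have "\<dots> \<le> e" using I0 \<open>e > 0\<close> by (simp add: field_simps)
    finally show "integral {0..1} (\<lambda>x. (norm (g x))\<^sup>2) \<le> 0 + e" by simp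
  qed
  moreover have "integral {0..1} (\<lambda>x. (norm (g x))\<^sup>2) \<ge> 0"
    by (intro integral_nonneg integrable_continuous_real continuous_intros contg) auto
  ultimately have "integral {0..1} (\<lambda>x. (norm (g x))\<^sup>2) = 0" by simp
  moreover have "continuous_on {0..1} (\<lambda>x. (norm (g x))\<^sup>2)"
    by (intro continuous_intros contg)
  ultimately have "\<forall>y\<in>{0..1}. (norm (g y))\<^sup>2 = 0"
    using integral_eq_0_iff[of 0 1 "\<lambda>x. (norm (g x))\<^sup>2"] by simp
  then have g0: "g y = 0" if "y \<in> {0..1}" for y
    using that by simp
  have "g x = g (frac x + of_int \<lfloor>x\<rfloor>)" by (simp add: frac_def)
  also have "\<dots> = 0"
    unfolding periodic_add_int[where g = g, OF per] by (rule g0) (simp add: frac_lt_1 less_imp_le)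
  finally show ?thesis .
qed

text \<open>Locally uniform convergence by the Weierstrass test. Both the periodised Gaussian and its candidate Fourier series
  are of this form.\<close>

lemma series_continuous_integral:
  fixes f :: "int \<Rightarrow> real \<Rightarrow> complex" and M :: "real \<Rightarrow> int \<Rightarrow> real"
  assumes cont: "\<And>n. continuous_on UNIV (f n)"
    and bound: "\<And>R n x. \<bar>x\<bar> \<le> R \<Longrightarrow> norm (f n x) \<le> M R n"
    and summable: "\<And>R. M R summable_on UNIV"
  shows "continuous_on UNIV (\<lambda>x. \<Sum>\<^sub>\<infinity>n. f n x)"
    and "((\<lambda>n. integral {0..1} (f n)) has_sum integral {0..1} (\<lambda>x. \<Sum>\<^sub>\<infinity>n. f n x)) UNIV"
proof -
  define S where "S = (\<lambda>x. \<Sum>\<^sub>\<infinity>n. f n x)"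
  have ul: "uniform_limit {-R..R} (\<lambda>X y. \<Sum>n\<in>X. f n y) S (finite_subsets_at_top UNIV)" for R
    unfolding S_def by (rule Weierstrass_m_test_general[OF bound[of _ R] summable]) auto
  have cs: "continuous_on A (\<lambda>y. \<Sum>n\<in>X. f n y)" for A X
    by (rule continuous_on_subset[OF _ subset_UNIV], intro continuous_intros cont)
  have "isCont S x" for x
  proof -
    have x: "x \<in> {-(\<bar>x\<bar>+1)<..<\<bar>x\<bar>+1}" by auto
    have "continuous_on {-(\<bar>x\<bar>+1)..\<bar>x\<bar>+1} S"
      by (rule uniform_limit_theorem[OF _ ul]) (auto intro!: always_eventually cs)
    then have "continuous_on {-(\<bar>x\<bar>+1)<..<\<bar>x\<bar>+1} S"
      by (rule continuous_on_subset) auto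
    then show ?thesis
      using continuous_on_eq_continuous_at[OF open_greaterThanLessThan] x by blast
  qed
  then show "continuous_on UNIV (\<lambda>x. \<Sum>\<^sub>\<infinity>n. f n x)"
    by (simp add: continuous_on_eq_continuous_at S_def)
  have ul': "uniform_limit {0..1} (\<lambda>X y. \<Sum>n\<in>X. f n y) S (finite_subsets_at_top UNIV)"
    by (rule uniform_limit_on_subset[OF ul[of 1]]) auto
  obtain I J where IJ: "\<And>X. ((\<lambda>y. \<Sum>n\<in>X. f n y) has_integral I X) {0..1}" "(S has_integral J) {0..1}"
     "(I \<longlongrightarrow> J) (finite_subsets_at_top UNIV)"
    using uniform_limit_integral[OF ul' cs] by (metis finite_subsets_at_top_neq_bot)
  have "I X = (\<Sum>n\<in>X. integral {0..1} (f n))" if "finite X" for X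
  proof -
    have "f n integrable_on {0..1}" for n
      using cont by (intro integrable_continuous_real) (rule continuous_on_subset, auto)
    then have "((\<lambda>y. \<Sum>n\<in>X. f n y) has_integral (\<Sum>n\<in>X. integral {0..1} (f n))) {0..1}"
      using that by (intro has_integral_sum) auto
    with IJ(1) show ?thesis by (metis has_integral_unique)
  qed
  then have "((\<lambda>X. \<Sum>n\<in>X. integral {0..1} (f n)) \<longlongrightarrow> J) (finite_subsets_at_top UNIV)"
    by (intro Lim_transform_eventually[OF IJ(3)] eventually_finite_subsets_at_top_weakI) auto
  moreover have "integral {0..1} S = J" using IJ(2) by (rule integral_unique)
  ultimately show "((\<lambda>n. integral {0..1} (f n)) has_sum integral {0..1} (\<lambda>x. \<Sum>\<^sub>\<infinity>n. f n x)) UNIV"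
    unfolding has_sum_def S_def[symmetric] by simp
qed

section \<open>Poisson summation for an odd Gaussian\<close>

text \<open>The Gaussian is its own Fourier transform: this is the characteristic function of the standard normal
  distribution after a linear substitution.\<close>

lemma gaussian_integral:
  fixes t :: real
  assumes t: "t > 0"
  shows "integrable lborel (\<lambda>y. of_real (exp (- pi * t * y\<^sup>2)) * echar k y)"
    and "(LBINT y. of_real (exp (- pi * t * y\<^sup>2)) * echar k y) = of_real (exp (- pi * of_int k ^ 2 / t) / sqrt t)"
proof -
  define c where "c = sqrt (2 * pi * t)"
  have c: "c > 0" "c\<^sup>2 = 2 * pi * t" using t by (auto simp: c_def)
  define s where "s = 2 * pi * of_int k / c"
  define f where "f = (\<lambda>x. std_normal_density x *\<^sub>R iexp (s * x))"
  have f: "f (0 + c * y) = (1 / sqrt (2 * pi)) *\<^sub>R (of_real (exp (- pi * t * y\<^sup>2)) * echar k y)" for y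
  proof -
    have "(c * y)\<^sup>2 / 2 = pi * t * y\<^sup>2" using c by (simp add: power_mult_distrib)
    moreover have "\<i> * of_real (s * (c * y)) = 2 * of_real pi * \<i> * of_int k * of_real y"
      using c by (simp add: s_def field_simps)
    ultimately have "iexp (s * (c * y)) = echar k y" "exp (- (c * y)\<^sup>2 / 2) = exp (- pi * t * y\<^sup>2)"
      unfolding echar_def by (simp_all only: minus_divide_left[symmetric] mult_minus_left)
    then show ?thesis
      unfolding f_def std_normal_density_def add_0 scaleR_conv_of_real by (simp only: of_real_mult mult.assoc)
  qed
  have "integrable std_normal_distribution (\<lambda>x. iexp (s * x))"
  proof -
    interpret real_distribution std_normal_distribution by (rule real_dist_normal_dist)
    show ?thesis by (intro integrable_const_bound[of _ 1]) auto
  qed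
  then have int: "integrable lborel f"
    unfolding f_def by (subst (asm) integrable_density) auto
  have "integrable lborel (\<lambda>y. f (0 + c * y))"
    using c by (intro lborel_integrable_real_affine int) auto
  then have "integrable lborel (\<lambda>y. sqrt (2 * pi) *\<^sub>R f (0 + c * y))"
    by (rule integrable_scaleR_right)
  then show "integrable lborel (\<lambda>y. of_real (exp (- pi * t * y\<^sup>2)) * echar k y)"
    unfolding f by simp
  have "(LINT x|lborel. f x) = char std_normal_distribution s"
    unfolding char_def f_def by (subst integral_density) auto
  also have "\<dots> = of_real (exp (- pi * of_int k ^ 2 / t))"
  proof -
    have "s\<^sup>2 / 2 = pi * of_int k ^ 2 / t"
      using c t by (simp add: s_def power_divide power_mult_distrib power2_eq_square field_simps)
    then show ?thesis by (simp add: char_std_normal_distribution)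
  qed
  also have "(LINT x|lborel. f x) = \<bar>c\<bar> *\<^sub>R (LINT y|lborel. f (0 + c * y))"
    using c by (intro lborel_integral_real_affine) auto
  also have "\<dots> = (c / sqrt (2 * pi)) *\<^sub>R (LBINT y. of_real (exp (- pi * t * y\<^sup>2)) * echar k y)"
    unfolding f using c by simp
  also have "c / sqrt (2 * pi) = sqrt t"
    by (simp add: c_def real_sqrt_mult)
  finally show "(LBINT y. of_real (exp (- pi * t * y\<^sup>2)) * echar k y) = of_real (exp (- pi * of_int k ^ 2 / t) / sqrt t)"
    using t by (simp add: scaleR_conv_of_real field_simps)
qed

text \<open>Integration by parts reduces the first moment to the Gaussian itself. Symmetric intervals suffice because they
  exhaust the line along the partial sums in the Poisson summation.\<close>

lemma gaussian_moment_limit: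
  fixes t :: real
  assumes t: "t > 0"
  shows "(\<lambda>N. integral {- real N..real N} (\<lambda>y. of_real (y * exp (- pi * t * y\<^sup>2)) * echar (- k) y))
    \<longlonglongrightarrow> - \<i> * of_int k * of_real (exp (- pi * of_int k ^ 2 / t) / (t * sqrt t))"
proof -
  define E where "E = (\<lambda>y. of_real (exp (- pi * t * y\<^sup>2)) * echar (- k) y)"
  have E': "E y = exp (- of_real pi * of_real t * of_real y ^ 2 - 2 * of_real pi * \<i> * of_int k * of_real y)" for y
    by (simp add: E_def echar_def exp_of_real[symmetric] exp_add[symmetric] exp_diff exp_minus field_simps)
  have contE: "continuous_on A E" for A
    unfolding E' by (intro continuous_intros)
  have der: "(E has_vector_derivative (- 2 * of_real (pi * t * y) - 2 * of_real pi * \<i> * of_int k) * E y) (at y within A)" for y A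
    unfolding E' by (rule has_vector_derivative_real_field)
      (auto intro!: derivative_eq_intros simp: algebra_simps)
  have parts: "integral {- real N..real N} (\<lambda>y. of_real (y * exp (- pi * t * y\<^sup>2)) * echar (- k) y)
     = - (1 / (2 * of_real pi * of_real t)) * (E (real N) - E (- real N))
        - \<i> * of_int k / of_real t * integral {- real N..real N} E" for N
  proof -
    have "((\<lambda>y. (- 2 * of_real (pi * t * y) - 2 * of_real pi * \<i> * of_int k) * E y) has_integral (E (real N) - E (- real N))) {- real N..real N}"
      using der by (intro fundamental_theorem_of_calculus) auto
    moreover have "(E has_integral integral {- real N..real N} E) {- real N..real N}"
      by (intro integrable_integral integrable_continuous_real contE)
    ultimately have "((\<lambda>y. - (1 / (2 * of_real pi * of_real t)) * ((- 2 * of_real (pi * t * y) - 2 * of_real pi * \<i> * of_int k) * E y)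
       - \<i> * of_int k / of_real t * E y) has_integral
       (- (1 / (2 * of_real pi * of_real t)) * (E (real N) - E (- real N))
        - \<i> * of_int k / of_real t * integral {- real N..real N} E)) {- real N..real N}"
      by (intro has_integral_diff has_integral_mult_right)
    moreover have "- (1 / (2 * of_real pi * of_real t)) * ((- 2 * of_real (pi * t * y) - 2 * of_real pi * \<i> * of_int k) * E y)
       - \<i> * of_int k / of_real t * E y = of_real (y * exp (- pi * t * y\<^sup>2)) * echar (- k) y" for y
      using t by (simp add: E_def field_simps)
    ultimately show ?thesis by (auto dest!: integral_unique)
  qed
  have lim0: "(\<lambda>N. E (real N)) \<longlonglongrightarrow> 0" "(\<lambda>N. E (- real N)) \<longlonglongrightarrow> 0"
  proof -
    have "(\<lambda>N. exp (- pi * t * (real N)\<^sup>2)) \<longlonglongrightarrow> 0"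
      using summable_LIMSEQ_zero[OF summable_power_gauss[of "pi * t" 0]] t by simp
    then show "(\<lambda>N. E (real N)) \<longlonglongrightarrow> 0" "(\<lambda>N. E (- real N)) \<longlonglongrightarrow> 0"
      by (rule Lim_null_comparison[rotated]; simp add: E_def norm_mult)+
  qed
  have "(\<lambda>N. LBINT y:{- real N..real N}. E y) \<longlonglongrightarrow> (LBINT y:(\<Union>N. {- real N..real N}). E y)"
  proof (rule set_integral_cont_up)
    show "set_integrable lborel (\<Union>N. {- real N..real N}) E"
      unfolding E_def by (rule set_integrable_subset[of _ UNIV])
        (use gaussian_integral(1)[OF t] in \<open>auto simp: set_integrable_def\<close>)
  qed (auto simp: incseq_def)
  moreover have "(\<Union>N. {- real N..real N}) = UNIV"
  proof -
    have "\<exists>N. y \<in> {- real N..real N}" for y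
    proof -
      obtain N where "\<bar>y\<bar> \<le> real N" using real_arch_simple by blast
      then show ?thesis by (intro exI[of _ N]) (auto simp: abs_le_iff)
    qed
    then show ?thesis by auto
  qed
  moreover have "(LBINT y:{- real N..real N}. E y) = integral {- real N..real N} E" for N
    by (intro set_borel_integral_eq_integral borel_integrable_atLeastAtMost' contE)
  ultimately have limE: "(\<lambda>N. integral {- real N..real N} E) \<longlonglongrightarrow> of_real (exp (- pi * of_int k ^ 2 / t) / sqrt t)"
    using gaussian_integral(2)[OF t, of "- k"] by (simp add: set_lebesgue_integral_def E_def)
  have "(\<lambda>N. - (1 / (2 * of_real pi * of_real t)) * (E (real N) - E (- real N))
        - \<i> * of_int k / of_real t * integral {- real N..real N} E)
     \<longlonglongrightarrow> - (1 / (2 * of_real pi * of_real t)) * (0 - 0)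
        - \<i> * of_int k / of_real t * of_real (exp (- pi * of_int k ^ 2 / t) / sqrt t)"
    by (intro tendsto_intros lim0 limE)
  then show ?thesis unfolding parts by simp
qed

text \<open>Poisson summation: the left side is a continuous periodic function of \<open>x\<close>, its Fourier coefficients are integrals of
  \<open>y exp (- \<pi> t y\<^sup>2) echar (- k) y\<close> over the whole line, and these are the coefficients of the right side.\<close>

lemma theta_inversion_real:
  fixes t x :: real
  assumes t: "t > 0"
  shows "(\<Sum>\<^sub>\<infinity>n::int. complex_of_real ((of_int n + x) * exp (- pi * t * (of_int n + x)\<^sup>2)))
    = (\<Sum>\<^sub>\<infinity>k::int. - \<i> * of_int k * of_real (exp (- pi * of_int k ^ 2 / t) / (t * sqrt t)) * echar k x)"
proof -
  define \<phi> where "\<phi> = (\<lambda>k y. complex_of_real (y * exp (- pi * t * y\<^sup>2)) * echar k y)"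
  define f where "f = (\<lambda>x. \<Sum>\<^sub>\<infinity>n::int. \<phi> 0 (of_int n + x))"
  define c where "c = (\<lambda>k::int. - \<i> * of_int k * complex_of_real (exp (- pi * of_int k ^ 2 / t) / (t * sqrt t)))"
  define S where "S = (\<lambda>x. \<Sum>\<^sub>\<infinity>k::int. c k * echar k x)"
  \<comment> \<open>a majorant for \<open>\<bar>x\<bar> \<le> R\<close>, from \<open>n\<^sup>2 / 2 \<le> (n + x)\<^sup>2 + x\<^sup>2\<close>\<close>
  define M where "M = (\<lambda>R n. (\<bar>real_of_int n\<bar> + R) * exp (pi * t * R\<^sup>2) * exp (- (pi * t / 2) * real_of_int n ^ 2))"
  have Msum: "M R summable_on UNIV" for R
  proof -
    have "(\<lambda>n. \<bar>real_of_int n\<bar> ^ 1 * exp (- (pi * t / 2) * real_of_int n ^ 2) * exp (pi * t * R\<^sup>2)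
       + \<bar>real_of_int n\<bar> ^ 0 * exp (- (pi * t / 2) * real_of_int n ^ 2) * (R * exp (pi * t * R\<^sup>2))) summable_on UNIV"
      using t by (intro summable_on_add summable_on_cmult_left summable_on_power_gauss) auto
    then show ?thesis unfolding M_def by (simp add: algebra_simps)
  qed
  have Mb: "norm (\<phi> 0 (of_int n + x) * echar k x) \<le> M R n" if "\<bar>x\<bar> \<le> R" for R n x k
  proof -
    have "real_of_int n ^ 2 / 2 \<le> (of_int n + x)\<^sup>2 + x\<^sup>2"
      using sum_power2_ge_zero[of "real_of_int n / 2 + x" "real_of_int n / 2 + x"]
        zero_le_power2[of "real_of_int n + 2 * x"] by (simp add: power2_eq_square algebra_simps)
    also have "x\<^sup>2 \<le> R\<^sup>2" using that by (simp add: abs_le_square_iff[symmetric])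
    finally have "pi * t * (real_of_int n ^ 2 / 2) \<le> pi * t * ((of_int n + x)\<^sup>2 + R\<^sup>2)"
      using t by (intro mult_left_mono) auto
    then have "exp (- pi * t * (of_int n + x)\<^sup>2) \<le> exp (pi * t * R\<^sup>2) * exp (- (pi * t / 2) * real_of_int n ^ 2)"
      by (simp add: exp_add[symmetric] algebra_simps)
    moreover have "\<bar>of_int n + x\<bar> \<le> \<bar>real_of_int n\<bar> + R" using that by linarith
    ultimately have "\<bar>of_int n + x\<bar> * exp (- pi * t * (of_int n + x)\<^sup>2)
       \<le> (\<bar>real_of_int n\<bar> + R) * (exp (pi * t * R\<^sup>2) * exp (- (pi * t / 2) * real_of_int n ^ 2))"
      using that by (intro mult_mono) auto
    then show ?thesis
      unfolding \<phi>_def M_def norm_mult norm_of_real norm_echar abs_mult by (simp add: mult_ac)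
  qed
  have cont\<phi>: "continuous_on A (\<phi> k)" for k A
    unfolding \<phi>_def by (intro continuous_intros)
  have contf: "continuous_on UNIV (\<lambda>x. \<phi> 0 (of_int n + x) * echar k x)" for n k
    by (intro continuous_intros continuous_on_compose2[OF cont\<phi>[of UNIV]]) auto
  have f: "continuous_on UNIV f" "\<And>k. ((\<lambda>n. integral {0..1} (\<lambda>x. \<phi> 0 (of_int n + x) * echar k x)) has_sum integral {0..1} (\<lambda>x. f x * echar k x)) UNIV"
  proof -
    show "continuous_on UNIV f"
      using series_continuous_integral(1)[OF contf[of _ 0] Mb[of _ _ _ 0] Msum] by (simp add: f_def)
    fix k
    have "(\<Sum>\<^sub>\<infinity>n::int. \<phi> 0 (of_int n + x) * echar k x) = f x * echar k x" for x
      unfolding f_def by (rule infsum_cmult_left')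
    with series_continuous_integral(2)[OF contf[of _ k] Mb[of _ _ _ k] Msum]
    show "((\<lambda>n. integral {0..1} (\<lambda>x. \<phi> 0 (of_int n + x) * echar k x)) has_sum integral {0..1} (\<lambda>x. f x * echar k x)) UNIV"
      by simp
  qed
  have perf: "f (x + 1) = f x" for x
  proof -
    have "f (x + 1) = (\<Sum>\<^sub>\<infinity>n::int. \<phi> 0 (of_int (n + 1) + x))"
      unfolding f_def by (rule infsum_cong) (simp add: add_ac)
    also have "\<dots> = f x"
      unfolding f_def by (rule infsum_reindex_bij_witness[of _ "\<lambda>n. n - 1" "\<lambda>n. n + 1"]) auto
    finally show ?thesis .
  qed
  have coeff: "integral {0..1} (\<lambda>x. f x * echar (- k) x) = c k" for k
  proof -
    have shift: "integral {0..1} (\<lambda>x. \<phi> 0 (of_int n + x) * echar (- k) x) = integral {of_int n..of_int n + 1} (\<phi> (- k))" for n :: int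
    proof -
      have "\<phi> 0 (of_int n + x) * echar (- k) x = \<phi> (- k) (x + of_int n)" for x
        by (simp add: \<phi>_def add_ac)
      then have "integral {0..1} (\<lambda>x. \<phi> 0 (of_int n + x) * echar (- k) x) = integral {0..1} (\<phi> (- k) \<circ> (\<lambda>x. x + of_int n))"
        by (simp add: o_def)
      also have "\<dots> = integral {of_int n..of_int n + 1} (\<phi> (- k))"
        using integral_shift[of 0 "real_of_int n" 1 "\<phi> (- k)"] cont\<phi> by (simp add: o_def add_ac)
      finally show ?thesis .
    qed
    \<comment> \<open>the integrals over unit intervals add up to an integral over the line\<close>
    have part: "(\<Sum>n\<in>{- int N..<int N}. integral {of_int n..of_int n + 1} (\<phi> (- k))) = integral {- real N..real N} (\<phi> (- k))" for N
    proof (induction N)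
      case (Suc N)
      have e: "real_of_int (- int (Suc N)) = - real N - 1" "- real N - 1 + 1 = - real N" "real_of_int (int N) = real N"
        by simp_all
      have "{- int (Suc N)..<int (Suc N)} = insert (- int (Suc N)) (insert (int N) {- int N..<int N})" by auto
      then have "(\<Sum>n\<in>{- int (Suc N)..<int (Suc N)}. integral {of_int n..of_int n + 1} (\<phi> (- k)))
          = integral {- real N - 1..- real N} (\<phi> (- k)) + (integral {- real N..real N} (\<phi> (- k)) + integral {real N..real N + 1} (\<phi> (- k)))"
        by (subst \<open>_ = insert _ _\<close>, subst sum.insert, simp, simp, subst sum.insert, simp, simp, simp only: e Suc) (simp only: add_ac)
      also have "integral {- real N..real N} (\<phi> (- k)) + integral {real N..real N + 1} (\<phi> (- k)) = integral {- real N..real N + 1} (\<phi> (- k))"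
        by (rule Henstock_Kurzweil_Integration.integral_combine) (auto intro!: integrable_continuous_real cont\<phi>)
      also have "integral {- real N - 1..- real N} (\<phi> (- k)) + integral {- real N..real N + 1} (\<phi> (- k)) = integral {- real N - 1..real N + 1} (\<phi> (- k))"
        by (rule Henstock_Kurzweil_Integration.integral_combine) (auto intro!: integrable_continuous_real cont\<phi>)
      also have "- real N - 1 = - real (Suc N)" by simp
      also have "real N + 1 = real (Suc N)" by simp
      finally show ?case .
    qed simp
    have "filterlim (\<lambda>N. {- int N..<int N}) (finite_subsets_at_top UNIV) sequentially"
      unfolding filterlim_finite_subsets_at_top
    proof safe
      fix X :: "int set" assume X: "finite X"
      then obtain B where B: "\<And>n. n \<in> X \<Longrightarrow> \<bar>n\<bar> \<le> B"
        by (metis finite_imageI imageI Max_ge)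
      show "\<forall>\<^sub>F N in sequentially. finite {- int N..<int N} \<and> X \<subseteq> {- int N..<int N} \<and> {- int N..<int N} \<subseteq> UNIV"
        using eventually_ge_at_top[of "nat (\<bar>B\<bar> + 1)"]
      proof eventually_elim
        case (elim N)
        then have "B < int N" by linarith
        with B show ?case by (auto simp: abs_le_iff) (smt (verit) B)+
      qed
    qed
    then have "(\<lambda>N. \<Sum>n\<in>{- int N..<int N}. integral {of_int n..of_int n + 1} (\<phi> (- k))) \<longlonglongrightarrow> integral {0..1} (\<lambda>x. f x * echar (- k) x)"
      using f(2)[of "- k"] unfolding has_sum_def shift by (rule filterlim_compose[rotated])
    moreover have "(\<lambda>N. integral {- real N..real N} (\<phi> (- k))) \<longlonglongrightarrow> c k"
      using gaussian_moment_limit[OF t, of k] by (simp add: \<phi>_def c_def)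
    ultimately show ?thesis unfolding part by (rule LIMSEQ_unique)
  qed
  have csum: "(\<lambda>k. norm (c k)) summable_on UNIV"
  proof -
    have "norm (c k) = \<bar>real_of_int k\<bar> ^ 1 * exp (- (pi / t) * real_of_int k ^ 2) * (1 / (t * sqrt t))" for k
      using t by (simp add: c_def norm_mult norm_divide)
    then show ?thesis
      using t by (simp only:) (intro summable_on_cmult_left summable_on_power_gauss, auto)
  qed
  have contS: "continuous_on UNIV (\<lambda>x. c n * echar n x * echar k x)" for n k
    by (intro continuous_intros)
  have S: "continuous_on UNIV S" "integral {0..1} (\<lambda>x. S x * echar (- m) x) = c m" for m
  proof -
    show "continuous_on UNIV S"
      using series_continuous_integral(1)[where f = "\<lambda>n x. c n * echar n x * echar 0 x" and M = "\<lambda>_ k. norm (c k)", OF contS] csum by (simp add: S_def norm_mult)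
    have "(\<Sum>\<^sub>\<infinity>n::int. c n * echar n x * echar (- m) x) = S x * echar (- m) x" for x
      unfolding S_def by (rule infsum_cmult_left')
    then have "((\<lambda>n. integral {0..1} (\<lambda>x. c n * echar n x * echar (- m) x)) has_sum integral {0..1} (\<lambda>x. S x * echar (- m) x)) UNIV"
      using series_continuous_integral(2)[where f = "\<lambda>n x. c n * echar n x * echar (- m) x" and M = "\<lambda>_ k. norm (c k)", OF contS] csum by (simp add: norm_mult)
    moreover have "integral {0..1} (\<lambda>x. c n * echar n x * echar (- m) x) = (if n = m then c m else 0)" for n
    proof -
      have "integral {0..1} (\<lambda>x. c n * echar n x * echar (- m) x) = integral {0..1} (\<lambda>x. c n * echar (n + - m) x)"
        by (simp only: echar_add mult.assoc)
      also have "\<dots> = c n * integral {0..1} (echar (n + - m))" by simp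
      also have "\<dots> = (if n = m then c m else 0)"
        using integral_unique[OF echar_has_integral[of "n + - m"]] by simp
      finally show ?thesis .
    qed
    ultimately have "((\<lambda>n. if n = m then c m else 0) has_sum integral {0..1} (\<lambda>x. S x * echar (- m) x)) UNIV"
      by simp
    moreover have "((\<lambda>n. if n = m then c m else 0) has_sum c m) UNIV"
      by (rule has_sum_finite_neutralI[of "{m}"]) auto
    ultimately show "integral {0..1} (\<lambda>x. S x * echar (- m) x) = c m"
      by (rule has_sum_unique)
  qed
  have perS: "S (x + 1) = S x" for x
    using echar_add_int[of _ x 1] by (simp add: S_def)
  have "f x - S x = 0"
  proof (rule fourier_uniqueness)
    show "continuous_on UNIV (\<lambda>x. f x - S x)" by (intro continuous_intros f S)
    show "f (x + 1) - S (x + 1) = f x - S x" for x by (simp add: perf perS)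
    show "integral {0..1} (\<lambda>x. (f x - S x) * echar k x) = 0" for k
    proof -
      have "(\<lambda>x. f x * echar k x) integrable_on {0..1}" "(\<lambda>x. S x * echar k x) integrable_on {0..1}"
        by (intro integrable_continuous_real continuous_intros continuous_on_subset[OF f(1)] continuous_on_subset[OF S(1)]; simp)+
      then show ?thesis
        using coeff[of "- k"] S(2)[of "- k"] by (simp add: left_diff_distrib integral_diff)
    qed
  qed
  then show ?thesis by (simp add: f_def S_def c_def \<phi>_def)
qed

section \<open>Inversion of theta series with periodic coefficients\<close>

text \<open>The factor \<open>of_int r\<close> makes these series of weight \<open>3/2\<close>.\<close>

definition twisted_theta :: "(int \<Rightarrow> complex) \<Rightarrow> complex \<Rightarrow> complex" where
  "twisted_theta \<xi> z = (\<Sum>\<^sub>\<infinity>r. of_int r * \<xi> r * exp (of_real pi * \<i> * z * of_int r ^ 2))"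

definition dft :: "nat \<Rightarrow> (int \<Rightarrow> complex) \<Rightarrow> int \<Rightarrow> complex" where
  "dft M \<xi> k = (\<Sum>\<rho>\<in>{0..<int M}. \<xi> \<rho> * echar k (of_int \<rho> / of_nat M))"

lemma norm_exp_pi_gauss:
  "norm (exp (of_real pi * \<i> * z * of_int r ^ 2)) = exp (- (pi * Im z) * real_of_int r ^ 2)"
  by (simp add: norm_exp_eq_Re power2_eq_square)

lemma norm_twisted_theta_term:
  assumes "norm (\<xi> r) \<le> B"
  shows "norm (of_int r * \<xi> r * exp (of_real pi * \<i> * z * of_int r ^ 2))
    \<le> B * (\<bar>real_of_int r\<bar> ^ 1 * exp (- (pi * Im z) * real_of_int r ^ 2))"
  unfolding norm_mult norm_exp_pi_gauss norm_of_int power_one_right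
  using mult_right_mono[OF assms, of "\<bar>real_of_int r\<bar> * exp (- (pi * Im z) * real_of_int r ^ 2)"]
  by (simp add: mult_ac)

lemma twisted_theta_has_sum:
  assumes \<xi>: "\<And>r. norm (\<xi> r) \<le> B" and z: "Im z > 0"
  shows "((\<lambda>r. of_int r * \<xi> r * exp (of_real pi * \<i> * z * of_int r ^ 2)) has_sum twisted_theta \<xi> z) UNIV"
proof -
  have "(\<lambda>r. norm (of_int r * \<xi> r * exp (of_real pi * \<i> * z * of_int r ^ 2))) summable_on UNIV"
  proof (rule summable_on_comparison_test)
    show "(\<lambda>r. B * (\<bar>real_of_int r\<bar> ^ 1 * exp (- (pi * Im z) * real_of_int r ^ 2))) summable_on UNIV"
      using z by (intro summable_on_cmult_right summable_on_power_gauss) auto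
  qed (use norm_twisted_theta_term[OF \<xi>] in auto)
  then show ?thesis
    unfolding twisted_theta_def by (rule has_sum_infsum[OF abs_summable_summable])
qed

text \<open>The term \<open>r = 0\<close> vanishes, and all others are at most \<open>exp (- \<pi> Im z)\<close> in size. Half of the exponent is spent
  on convergence.\<close>

lemma twisted_theta_decay:
  assumes \<xi>: "\<And>r. norm (\<xi> r) \<le> B" and y0: "y0 > 0"
  obtains K where "K \<ge> 0" "\<And>z. Im z \<ge> y0 \<Longrightarrow> norm (twisted_theta \<xi> z) \<le> K * exp (- (pi / 2) * Im z)"
proof -
  define m where "m = (\<lambda>r. B * (\<bar>real_of_int r\<bar> ^ 1 * exp (- (pi / 2 * y0) * real_of_int r ^ 2)))"
  have B0: "B \<ge> 0" using \<xi>[of 0] norm_ge_zero order_trans by blast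
  have sm: "m summable_on UNIV"
    unfolding m_def using y0 by (intro summable_on_cmult_right summable_on_power_gauss) auto
  have "norm (twisted_theta \<xi> z) \<le> infsum m UNIV * exp (- (pi / 2) * Im z)" if z: "Im z \<ge> y0" for z
  proof (rule norm_infsum_le)
    show "((\<lambda>r. of_int r * \<xi> r * exp (of_real pi * \<i> * z * of_int r ^ 2)) has_sum twisted_theta \<xi> z) UNIV"
      using z y0 by (intro twisted_theta_has_sum[OF \<xi>]) auto
    show "((\<lambda>r. m r * exp (- (pi / 2) * Im z)) has_sum (infsum m UNIV * exp (- (pi / 2) * Im z))) UNIV"
      by (intro has_sum_cmult_left has_sum_infsum sm)
    show "norm (of_int r * \<xi> r * exp (of_real pi * \<i> * z * of_int r ^ 2)) \<le> m r * exp (- (pi / 2) * Im z)" for r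
    proof (cases "r = 0")
      case False
      have ex: "exp (- (pi * Im z) * real_of_int r ^ 2) \<le> exp (- (pi / 2 * y0) * real_of_int r ^ 2) * exp (- (pi / 2) * Im z)"
      proof -
        have "1 \<le> \<bar>real_of_int r\<bar>" using False by linarith
        then have r: "1 \<le> real_of_int r ^ 2" by (simp flip: abs_le_square_iff[of 1, simplified])
        have "y0 * real_of_int r ^ 2 \<le> Im z * real_of_int r ^ 2"
          using z by (intro mult_right_mono) auto
        moreover have "Im z * 1 \<le> Im z * real_of_int r ^ 2"
          using z y0 r by (intro mult_left_mono) auto
        ultimately have "pi * (y0 * real_of_int r ^ 2 + Im z) \<le> pi * (2 * (Im z * real_of_int r ^ 2))"
          by (intro mult_left_mono) auto
        then show ?thesis by (simp add: exp_add[symmetric] algebra_simps)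
      qed
      have "norm (of_int r * \<xi> r * exp (of_real pi * \<i> * z * of_int r ^ 2))
         \<le> B * (\<bar>real_of_int r\<bar> ^ 1 * exp (- (pi * Im z) * real_of_int r ^ 2))"
        by (rule norm_twisted_theta_term[OF \<xi>])
      also have "\<dots> \<le> B * (\<bar>real_of_int r\<bar> ^ 1 * (exp (- (pi / 2 * y0) * real_of_int r ^ 2) * exp (- (pi / 2) * Im z)))"
        using B0 by (intro mult_left_mono ex) auto
      finally show ?thesis by (simp only: m_def mult.assoc)
    qed (simp add: m_def)
  qed
  moreover have "infsum m UNIV \<ge> 0" using B0 by (intro infsum_nonneg) (auto simp: m_def)
  ultimately show ?thesis using that by blast
qed

lemma twisted_theta_holomorphic:
  assumes \<xi>: "\<And>r. norm (\<xi> r) \<le> B"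
  shows "twisted_theta \<xi> holomorphic_on {z. Im z > 0}"
proof -
  have "\<exists>f'. (twisted_theta \<xi> has_field_derivative f') (at z)" if z: "Im z > 0" for z
  proof -
    define y where "y = Im z / 2"
    have y: "y > 0" using z by (simp add: y_def)
    have im: "Im w \<ge> y" if "w \<in> cball z y" for w
      using that abs_Im_le_cmod[of "z - w"] by (auto simp: y_def dist_norm)
    have ul: "uniform_limit (cball z y) (\<lambda>X w. \<Sum>r\<in>X. of_int r * \<xi> r * exp (of_real pi * \<i> * w * of_int r ^ 2))
       (twisted_theta \<xi>) (finite_subsets_at_top UNIV)"
      unfolding twisted_theta_def
    proof (rule Weierstrass_m_test_general)
      show "(\<lambda>r. B * (\<bar>real_of_int r\<bar> ^ 1 * exp (- (pi * y) * real_of_int r ^ 2))) summable_on UNIV"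
        using y by (intro summable_on_cmult_right summable_on_power_gauss) auto
      fix r w assume w: "w \<in> cball z y"
      have "norm (of_int r * \<xi> r * exp (of_real pi * \<i> * w * of_int r ^ 2))
         \<le> B * (\<bar>real_of_int r\<bar> ^ 1 * exp (- (pi * Im w) * real_of_int r ^ 2))"
        by (rule norm_twisted_theta_term[OF \<xi>])
      also have "exp (- (pi * Im w) * real_of_int r ^ 2) \<le> exp (- (pi * y) * real_of_int r ^ 2)"
        using im[OF w] by (auto intro!: mult_right_mono mult_left_mono)
      finally show "norm (of_int r * \<xi> r * exp (of_real pi * \<i> * w * of_int r ^ 2))
         \<le> B * (\<bar>real_of_int r\<bar> ^ 1 * exp (- (pi * y) * real_of_int r ^ 2))"
        using \<xi>[of 0] norm_ge_zero[of "\<xi> 0"] by (auto simp: mult_left_mono)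
    qed
    have "twisted_theta \<xi> holomorphic_on ball z y"
      by (rule holomorphic_uniform_limit[OF _ ul])
         (auto intro!: always_eventually holomorphic_intros continuous_intros)
    then show ?thesis
      using y by (auto simp: holomorphic_on_open intro: bspec[of _ _ z])
  qed
  then show ?thesis
    by (auto simp: holomorphic_on_open open_halfspace_Im_gt)
qed

lemma has_sum_sum_finite:
  fixes f :: "'a \<Rightarrow> 'b \<Rightarrow> complex"
  assumes "finite A" "\<And>a. a \<in> A \<Longrightarrow> ((f a) has_sum S a) X"
  shows "((\<lambda>x. \<Sum>a\<in>A. f a x) has_sum (\<Sum>a\<in>A. S a)) X"
  using assms by (induction A rule: finite_induct) (auto intro!: has_sum_add has_sum_0)

lemma periodic_mod:
  fixes \<xi> :: "int \<Rightarrow> complex"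
  assumes "\<And>r. \<xi> (r + int M) = \<xi> r"
  shows "\<xi> (r + int M * n) = \<xi> r"
proof (induction n rule: int_induct[of _ 0])
  case (step1 i)
  then show ?case using assms[of "r + int M * i"] by (simp add: algebra_simps)
next
  case (step2 i)
  then show ?case using assms[of "r + int M * (i - 1)"] by (simp add: algebra_simps)
qed simp

lemma periodic_bounded:
  fixes \<xi> :: "int \<Rightarrow> complex"
  assumes M: "M > 0" and per: "\<And>r. \<xi> (r + int M) = \<xi> r"
  shows "norm (\<xi> r) \<le> (\<Sum>\<rho>\<in>{0..<int M}. norm (\<xi> \<rho>))"
proof -
  have "\<xi> r = \<xi> (r mod int M + int M * (r div int M))" by simp
  also have "\<dots> = \<xi> (r mod int M)" by (rule periodic_mod[where \<xi> = \<xi>, OF per])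
  finally have "norm (\<xi> r) = norm (\<xi> (r mod int M))" by simp
  also have "\<dots> \<le> (\<Sum>\<rho>\<in>{0..<int M}. norm (\<xi> \<rho>))"
    using M by (intro member_le_sum) auto
  finally show ?thesis .
qed

lemma norm_dft_le: "norm (dft M \<xi> k) \<le> (\<Sum>\<rho>\<in>{0..<int M}. norm (\<xi> \<rho>))"
  unfolding dft_def by (rule order_trans[OF norm_sum]) (simp add: norm_mult)

text \<open>Writing \<open>r = \<rho> + M n\<close> splits the series into \<open>M\<close> series to which \<open>theta_inversion_real\<close> applies with
  \<open>x = \<rho> / M\<close>; the finite sum over \<open>\<rho>\<close> is the discrete Fourier transform.\<close>

lemma twisted_theta_inversion_imaginary:
  fixes \<xi> :: "int \<Rightarrow> complex" and t :: real
  assumes M: "M > 0" and per: "\<And>r. \<xi> (r + int M) = \<xi> r" and t: "t > 0"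
  shows "twisted_theta \<xi> (\<i> * of_real t)
    = - \<i> / of_real (of_nat M ^ 2 * (t * sqrt t)) * twisted_theta (dft M \<xi>) (\<i> / of_real (of_nat M ^ 2 * t))"
proof -
  define B where "B = (\<Sum>\<rho>\<in>{0..<int M}. norm (\<xi> \<rho>))"
  have B: "norm (\<xi> r) \<le> B" for r unfolding B_def by (rule periodic_bounded[where \<xi> = \<xi>, OF M per])
  have B': "norm (dft M \<xi> r) \<le> B" for r unfolding B_def by (rule norm_dft_le)
  define s where "s = t * real M ^ 2"
  have s: "s > 0" using t M by (simp add: s_def)
  define f where "f = (\<lambda>r. of_int r * \<xi> r * exp (of_real pi * \<i> * (\<i> * of_real t) * of_int r ^ 2))"
  have fsum: "(f has_sum twisted_theta \<xi> (\<i> * of_real t)) UNIV"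
    unfolding f_def using t by (intro twisted_theta_has_sum[OF B]) auto
  have bij: "bij_betw (\<lambda>(\<rho>, n). \<rho> + int M * n) ({0..<int M} \<times> UNIV) UNIV"
    by (rule bij_betwI[where g = "\<lambda>r. (r mod int M, r div int M)"]) (use M in auto)
  have fval: "f (\<rho> + int M * n) = \<xi> \<rho> * of_nat M * complex_of_real ((of_int n + of_int \<rho> / M) * exp (- pi * s * (of_int n + of_int \<rho> / M)\<^sup>2))" for \<rho> n
  proof -
    have a: "real_of_int (\<rho> + int M * n) = M * (of_int n + of_int \<rho> / M)"
      using M by (simp add: field_simps)
    have b: "pi * t * (real_of_int (\<rho> + int M * n))\<^sup>2 = pi * s * (of_int n + of_int \<rho> / M)\<^sup>2"
      unfolding a s_def by (simp add: power_mult_distrib)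
    have "f (\<rho> + int M * n) = complex_of_real (real_of_int (\<rho> + int M * n)) * \<xi> \<rho> * exp (of_real (- (pi * t * (real_of_int (\<rho> + int M * n))\<^sup>2)))"
      unfolding f_def periodic_mod[where \<xi> = \<xi>, OF per] by (simp add: mult_ac)
    also have "\<dots> = \<xi> \<rho> * of_nat M * complex_of_real ((of_int n + of_int \<rho> / M) * exp (- pi * s * (of_int n + of_int \<rho> / M)\<^sup>2))"
      unfolding b unfolding a exp_of_real by (simp add: mult_ac)
    finally show ?thesis .
  qed
  have "(\<lambda>(\<rho>, n). f (\<rho> + int M * n)) summable_on ({0..<int M} \<times> UNIV)"
    using summable_on_reindex_bij_betw[OF bij, of f] has_sum_imp_summable[OF fsum] by (simp add: case_prod_unfold)
  then have "(\<Sum>\<^sub>\<infinity>\<rho>\<in>{0..<int M}. \<Sum>\<^sub>\<infinity>n. f (\<rho> + int M * n)) = infsum (\<lambda>(\<rho>, n). f (\<rho> + int M * n)) ({0..<int M} \<times> UNIV)"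
    using infsum_Sigma_banach[of "\<lambda>(\<rho>, n). f (\<rho> + int M * n)" "{0..<int M}" "\<lambda>_. UNIV"] by simp
  also have "\<dots> = infsum f UNIV"
    using infsum_reindex_bij_betw[OF bij, of f] by (simp add: case_prod_unfold)
  also have "\<dots> = twisted_theta \<xi> (\<i> * of_real t)" using fsum by (rule infsumI)
  finally have 1: "twisted_theta \<xi> (\<i> * of_real t) = (\<Sum>\<rho>\<in>{0..<int M}. \<Sum>\<^sub>\<infinity>n. f (\<rho> + int M * n))"
    by simp
  define g where "g = (\<lambda>k::int. - \<i> * of_int k * complex_of_real (exp (- pi * of_int k ^ 2 / s) / (s * sqrt s)))"
  have 2: "(\<Sum>\<^sub>\<infinity>n. f (\<rho> + int M * n)) = \<xi> \<rho> * of_nat M * (\<Sum>\<^sub>\<infinity>k. g k * echar k (of_int \<rho> / M))" for \<rho>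
    unfolding fval infsum_cmult_right' theta_inversion_real[OF s] g_def ..
  have gsum: "((\<lambda>k. g k * echar k x) has_sum (\<Sum>\<^sub>\<infinity>k. g k * echar k x)) UNIV" for x
  proof -
    have "(\<lambda>k. norm (g k * echar k x)) summable_on UNIV"
    proof -
      have "norm (g k * echar k x) = \<bar>real_of_int k\<bar> ^ 1 * exp (- (pi / s) * real_of_int k ^ 2) * (1 / (s * sqrt s))" for k
        using s by (simp add: g_def norm_mult norm_divide)
      then show ?thesis
        using s by (simp only:) (intro summable_on_cmult_left summable_on_power_gauss, auto)
    qed
    then show ?thesis by (rule has_sum_infsum[OF abs_summable_summable])
  qed
  have "((\<lambda>k. \<Sum>\<rho>\<in>{0..<int M}. \<xi> \<rho> * of_nat M * (g k * echar k (of_int \<rho> / M))) has_sum twisted_theta \<xi> (\<i> * of_real t)) UNIV"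
    unfolding 1 2 by (intro has_sum_sum_finite has_sum_cmult_right gsum) auto
  moreover have "(\<Sum>\<rho>\<in>{0..<int M}. \<xi> \<rho> * of_nat M * (g k * echar k (of_int \<rho> / M)))
     = - \<i> / of_real (of_nat M ^ 2 * (t * sqrt t)) * (of_int k * dft M \<xi> k * exp (of_real pi * \<i> * (\<i> / of_real (of_nat M ^ 2 * t)) * of_int k ^ 2))" for k
  proof -
    have a: "(\<Sum>\<rho>\<in>{0..<int M}. \<xi> \<rho> * of_nat M * (g k * echar k (of_int \<rho> / M))) = of_nat M * g k * dft M \<xi> k"
      unfolding dft_def sum_distrib_left by (intro sum.cong) (auto simp: mult_ac)
    have b: "exp (of_real pi * \<i> * (\<i> / of_real (of_nat M ^ 2 * t)) * of_int k ^ 2) = complex_of_real (exp (- pi * of_int k ^ 2 / s))"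
    proof -
      have "of_real pi * \<i> * (\<i> / of_real (of_nat M ^ 2 * t)) * of_int k ^ 2 = complex_of_real (- pi * of_int k ^ 2 / s)"
        by (simp add: s_def mult_ac)
      then show ?thesis by (simp only: exp_of_real)
    qed
    have "sqrt s = real M * sqrt t" using M by (simp add: s_def real_sqrt_mult)
    then have c: "s * sqrt s = real M * (real M ^ 2 * (t * sqrt t))" by (simp add: s_def)
    have "X * (- \<i> * k' * (E / (X * Y))) * d = - \<i> / Y * (k' * d * E)" if "X \<noteq> 0" for X k' E Y d :: complex
      using that by simp
    then show ?thesis
      unfolding a unfolding b g_def c of_real_divide of_real_mult[of "real M" "real M ^ 2 * (t * sqrt t)"] of_real_of_nat_eq
      using M by (simp only: of_nat_eq_0_iff neq0_conv)
  qed
  ultimately have H: "((\<lambda>k. - \<i> / of_real (of_nat M ^ 2 * (t * sqrt t)) * (of_int k * dft M \<xi> k * exp (of_real pi * \<i> * (\<i> / of_real (of_nat M ^ 2 * t)) * of_int k ^ 2))) has_sum twisted_theta \<xi> (\<i> * of_real t)) UNIV"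
    by simp
  have im: "Im (\<i> / of_real (of_nat M ^ 2 * t)) > 0"
  proof -
    have "\<i> / complex_of_real (of_nat M ^ 2 * t) = Complex 0 (1 / (of_nat M ^ 2 * t))" by (simp add: complex_eq_iff)
    then show ?thesis using M t by simp
  qed
  show ?thesis
    by (rule has_sum_unique[OF H has_sum_cmult_right[OF twisted_theta_has_sum[where \<xi> = "dft M \<xi>", OF B' im]]])
qed

text \<open>Both sides are holomorphic in the upper half-plane and agree on the imaginary axis.\<close>

theorem twisted_theta_inversion:
  fixes \<xi> :: "int \<Rightarrow> complex"
  assumes M: "M > 0" and per: "\<And>r. \<xi> (r + int M) = \<xi> r" and z: "Im z > 0"
  shows "twisted_theta \<xi> z
    = - \<i> / of_nat M ^ 2 * (- \<i> * z) powr (-3/2) * twisted_theta (dft M \<xi>) (- 1 / (of_nat M ^ 2 * z))"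
proof -
  define D where "D = (\<lambda>z. twisted_theta \<xi> z - (- \<i> / of_nat M ^ 2 * (- \<i> * z) powr (-3/2) * twisted_theta (dft M \<xi>) (- 1 / (of_nat M ^ 2 * z))))"
  \<comment> \<open>points of the imaginary axis that accumulate at \<open>\<i>\<close>\<close>
  define U where "U = range (\<lambda>n. \<i> * of_real (1 + 1 / of_nat (Suc n)))"
  have imM: "Im (- 1 / (of_nat M ^ 2 * w)) > 0" if "Im w > 0" for w
  proof -
    have "- 1 / (of_nat M ^ 2 * w) = of_real (1 / of_nat M ^ 2) * (- inverse w)"
      by (simp add: divide_simps)
    moreover have "Im (inverse w) < 0"
    proof -
      have "w \<noteq> 0" using that by auto
      then have "(Re w)\<^sup>2 + (Im w)\<^sup>2 > 0" by (simp add: complex_eq_iff sum_power2_gt_zero_iff)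
      then show ?thesis using that by (simp add: divide_neg_pos)
    qed
    moreover have "Im (complex_of_real (1 / of_nat M ^ 2) * (- inverse w)) = (1 / real M ^ 2) * (- Im (inverse w))"
      by (simp only: times_complex.sel Re_complex_of_real Im_complex_of_real uminus_complex.sel mult_zero_left add_0_right)
    moreover have "(1 / real M ^ 2) * (- Im (inverse w)) > 0"
      by (rule mult_pos_pos) (use M \<open>Im (inverse w) < 0\<close> in \<open>simp_all del: inverse_complex.sel\<close>)
    ultimately show ?thesis by (simp only:)
  qed
  have "D z = 0"
  proof (rule analytic_continuation[of D "{z. Im z > 0}" U \<i>])
    have t1: "twisted_theta \<xi> holomorphic_on {z. Im z > 0}"
      by (rule twisted_theta_holomorphic[OF periodic_bounded[where \<xi> = \<xi>, OF M per]])
    have "(twisted_theta (dft M \<xi>) \<circ> (\<lambda>z. - 1 / (of_nat M ^ 2 * z))) holomorphic_on {z. Im z > 0}"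
    proof (rule holomorphic_on_compose_gen)
      show "(\<lambda>z. - 1 / (of_nat M ^ 2 * z)) holomorphic_on {z. Im z > 0}"
        using M by (intro holomorphic_intros) auto
      show "twisted_theta (dft M \<xi>) holomorphic_on {z. Im z > 0}"
        by (rule twisted_theta_holomorphic[OF norm_dft_le])
    qed (use imM in auto)
    moreover have "(\<lambda>z. (- \<i> * z) powr (-3/2)) holomorphic_on {z. Im z > 0}"
      by (intro holomorphic_intros) (auto simp: complex_nonpos_Reals_iff)
    ultimately show "D holomorphic_on {z. Im z > 0}"
      unfolding D_def o_def by (intro holomorphic_intros t1) (auto simp: complex_nonneg_Reals_iff)
    show "\<i> islimpt U"
      unfolding islimpt_sequential
    proof (intro exI conjI allI)
      show "\<i> * of_real (1 + 1 / of_nat (Suc n)) \<in> U - {\<i>}" for n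
        unfolding U_def by (auto simp: complex_eq_iff)
      have "(\<lambda>n. 1 / real (Suc n)) \<longlonglongrightarrow> 0" by (rule LIMSEQ_Suc[OF lim_1_over_n])
      then have "(\<lambda>n. \<i> * of_real (1 + 1 / of_nat (Suc n))) \<longlonglongrightarrow> \<i> * of_real (1 + 0)"
        by (intro tendsto_intros)
      then show "(\<lambda>n. \<i> * of_real (1 + 1 / of_nat (Suc n))) \<longlonglongrightarrow> \<i>" by simp
    qed
    show "D w = 0" if w: "w \<in> U" for w
    proof -
      obtain n where n: "w = \<i> * of_real (1 + 1 / of_nat (Suc n))"
        using w unfolding U_def by blast
      define t where "t = 1 + 1 / real (Suc n)"
      have t: "w = \<i> * of_real t" "t > 0" using n by (simp_all add: t_def add_pos_pos)
      have p: "(- \<i> * w) powr (-3/2) = 1 / of_real (t * sqrt t)"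
      proof -
        have "(- \<i> * w) powr (-3/2) = of_real (t powr (-3/2))"
          using t powr_Reals_eq[of "of_real t" "of_real (-3/2)"] by simp
        also have "t powr (-3/2) = 1 / (t * sqrt t)"
        proof -
          have "t powr (3/2) = t powr (1 + 1/2)" by simp
          also have "\<dots> = t * sqrt t" using t by (simp only: powr_add powr_half_sqrt powr_one)
          finally show ?thesis using powr_minus_divide[of t "3/2"] by simp
        qed
        finally show ?thesis by simp
      qed
      have q: "- 1 / (of_nat M ^ 2 * w) = \<i> / of_real (of_nat M ^ 2 * t)"
        using t M by (simp add: field_simps)
      show ?thesis
        unfolding D_def p q unfolding t(1) twisted_theta_inversion_imaginary[where \<xi> = \<xi>, OF M per t(2)]
        by simp
    qed
  qed (use z in \<open>auto simp: U_def open_halfspace_Im_gt add_pos_pos\<close>)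
  then show ?thesis unfolding D_def by (rule eq_iff_diff_eq_0[THEN iffD2])
qed

section \<open>The shadow and its Gauss sum\<close>

text \<open>This is \<open>Theta_psi (2 * v)\<close>, see \<open>Theta_psi_double\<close>: the substitution \<open>z = 2 * v\<close> that relates \<open>Theta\<close> to
  \<open>theta_psi\<close> is built in, so that the group acts on \<open>v\<close> by integral matrices.\<close>

definition shadow :: "complex \<Rightarrow> complex" where
  "shadow v = twisted_theta psi (v / 4)"

text \<open>The coefficients of \<open>z \<mapsto> shadow (x + z)\<close> as a theta series in \<open>z / 4\<close> (\<open>shadow_shift\<close>). They are periodic when
  \<open>x\<close> is rational.\<close>

definition shadow_twist :: "real \<Rightarrow> int \<Rightarrow> complex" where
  "shadow_twist x r = psi r * echar 1 (x * of_int r ^ 2 / 8)"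

lemma echar_eq_1: "echar k x = echar 1 (of_int k * x)"
  by (simp add: echar_def mult_ac)

lemma Theta_psi_double: "Theta_psi (2 * v) = shadow v"
  by (simp add: Theta_psi_def shadow_def twisted_theta_def mult_ac)

lemma shadow_shift: "shadow (of_real x + z) = twisted_theta (shadow_twist x) (z / 4)"
  unfolding shadow_def twisted_theta_def
proof (rule infsum_cong)
  fix r :: int
  have "exp (of_real pi * \<i> * ((of_real x + z) / 4) * of_int r ^ 2)
      = echar 1 (x * of_int r ^ 2 / 8) * exp (of_real pi * \<i> * (z / 4) * of_int r ^ 2)"
    by (simp add: echar_def exp_add[symmetric] algebra_simps add_divide_distrib)
  then show "of_int r * psi r * exp (of_real pi * \<i> * ((of_real x + z) / 4) * of_int r ^ 2)
      = of_int r * shadow_twist x r * exp (of_real pi * \<i> * (z / 4) * of_int r ^ 2)"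
    by (simp add: shadow_twist_def)
qed

lemma shadow_holomorphic: "shadow holomorphic_on {z. Im z > 0}"
proof -
  have "(twisted_theta psi \<circ> (\<lambda>v. v / 4)) holomorphic_on {z. Im z > 0}"
    by (rule holomorphic_on_compose_gen[OF _ twisted_theta_holomorphic[OF norm_psi_le]])
       (auto intro!: holomorphic_intros)
  then show ?thesis by (simp add: shadow_def[abs_def] o_def)
qed

lemma periodic_sum_shift:
  fixes f :: "int \<Rightarrow> complex"
  assumes per: "\<And>r. f (r + int M) = f r"
  shows "(\<Sum>\<rho>\<in>{0..<int M}. f (\<rho> + m)) = (\<Sum>\<rho>\<in>{0..<int M}. f \<rho>)"
proof (cases "M = 0")
  case False
  then have M: "M > 0" by simp
  show ?thesis
  proof (rule sum.reindex_bij_witness[where i = "\<lambda>\<rho>. (\<rho> - m) mod int M" and j = "\<lambda>\<rho>. (\<rho> + m) mod int M"])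
    fix \<rho> assume \<rho>: "\<rho> \<in> {0..<int M}"
    show "((\<rho> + m) mod int M - m) mod int M = \<rho>" "((\<rho> - m) mod int M + m) mod int M = \<rho>"
      using \<rho> by (simp_all add: mod_simps)
    show "(\<rho> + m) mod int M \<in> {0..<int M}" "(\<rho> - m) mod int M \<in> {0..<int M}"
      using M by auto
    have "f (\<rho> + m) = f ((\<rho> + m) mod int M + int M * ((\<rho> + m) div int M))" by simp
    also have "\<dots> = f ((\<rho> + m) mod int M)" by (rule periodic_mod[where \<xi> = f, OF per])
    finally show "f ((\<rho> + m) mod int M) = f (\<rho> + m)" by simp
  qed
qed simp

lemma sum_echar:
  assumes M: "M > 0"
  shows "(\<Sum>k\<in>{0..<int M}. echar k (of_int m / of_nat M)) = (if int M dvd m then of_nat M else 0)"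
proof (cases "int M dvd m")
  case True
  then obtain j where "m = int M * j" by auto
  then have "echar k (of_int m / of_nat M) = 1" for k
    using M echar_int[of k j] by simp
  with True show ?thesis by simp
next
  case False
  define w where "w = echar 1 (of_int m / of_nat M)"
  have pw: "echar (int k) (of_int m / of_nat M) = w ^ k" for k
    by (induction k) (simp_all add: w_def echar_add)
  have "w ^ M = 1"
    unfolding pw[symmetric] by (subst echar_eq_1) (use M echar_int[of 1 m] in simp)
  moreover have "w \<noteq> 1"
  proof
    assume "w = 1"
    then obtain n :: int where "2 * pi * (of_int m / of_nat M) = of_int (2 * n) * pi"
      unfolding w_def echar_def exp_eq_1 by auto
    then have "real_of_int m = of_int n * of_nat M" using M by (simp add: field_simps)
    then have "m = n * int M" by (metis of_int_eq_iff of_int_mult of_int_of_nat_eq)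
    then show False using False by simp
  qed
  ultimately have "(\<Sum>k<M. w ^ k) = 0" by (simp add: geometric_sum)
  also have "(\<Sum>k<M. w ^ k) = (\<Sum>k\<in>{0..<int M}. echar k (of_int m / of_nat M))"
    by (rule sum.reindex_bij_witness[of _ nat int]) (auto simp: pw[symmetric])
  finally show ?thesis using False by simp
qed

text \<open>Applied to a Gauss sum, this gives its absolute value without evaluating it.\<close>

lemma dft_parseval:
  assumes M: "M > 0"
  shows "(\<Sum>k\<in>{0..<int M}. (norm (dft M \<xi> k))\<^sup>2) = real M * (\<Sum>\<rho>\<in>{0..<int M}. (norm (\<xi> \<rho>))\<^sup>2)"
proof -
  let ?I = "{0..<int M}"
  have cn: "cnj (echar k x) = echar k (- x)" for k x
    by (simp add: echar_def exp_cnj)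
  have "complex_of_real (\<Sum>k\<in>?I. (norm (dft M \<xi> k))\<^sup>2) = (\<Sum>k\<in>?I. dft M \<xi> k * cnj (dft M \<xi> k))"
    by (simp only: of_real_sum complex_norm_square)
  also have "\<dots> = (\<Sum>k\<in>?I. \<Sum>\<rho>\<in>?I. \<Sum>\<sigma>\<in>?I. \<xi> \<rho> * cnj (\<xi> \<sigma>) * echar k (of_int (\<rho> - \<sigma>) / of_nat M))"
    unfolding dft_def cnj_sum sum_product
    by (intro sum.cong refl) (simp add: cn echar_add_right diff_divide_distrib flip: diff_conv_add_uminus,
        simp add: echar_add_right[of _ "_" "- _", simplified] mult_ac)
  also have "\<dots> = (\<Sum>\<rho>\<in>?I. \<Sum>\<sigma>\<in>?I. \<Sum>k\<in>?I. \<xi> \<rho> * cnj (\<xi> \<sigma>) * echar k (of_int (\<rho> - \<sigma>) / of_nat M))"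
    by (subst sum.swap, rule sum.cong[OF refl], rule sum.swap)
  also have "\<dots> = (\<Sum>\<rho>\<in>?I. \<Sum>\<sigma>\<in>?I. if \<rho> = \<sigma> then of_nat M * (\<xi> \<rho> * cnj (\<xi> \<sigma>)) else 0)"
  proof (intro sum.cong refl)
    fix \<rho> \<sigma> assume "\<rho> \<in> ?I" "\<sigma> \<in> ?I"
    then have "int M dvd (\<rho> - \<sigma>) \<longleftrightarrow> \<rho> = \<sigma>"
      using zdvd_imp_le[of "int M" "\<rho> - \<sigma>"] zdvd_imp_le[of "int M" "\<sigma> - \<rho>"]
      by (auto simp: dvd_diff_commute) (smt (verit) dvd_diff_commute)
    then show "(\<Sum>k\<in>?I. \<xi> \<rho> * cnj (\<xi> \<sigma>) * echar k (of_int (\<rho> - \<sigma>) / of_nat M))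
        = (if \<rho> = \<sigma> then of_nat M * (\<xi> \<rho> * cnj (\<xi> \<sigma>)) else 0)"
      unfolding sum_distrib_left[symmetric] sum_echar[OF M] by auto
  qed
  also have "\<dots> = (\<Sum>\<rho>\<in>?I. of_nat M * (\<xi> \<rho> * cnj (\<xi> \<rho>)))"
    by (intro sum.cong refl) simp
  also have "\<dots> = complex_of_real (real M * (\<Sum>\<rho>\<in>?I. (norm (\<xi> \<rho>))\<^sup>2))"
    by (simp only: of_real_mult of_real_sum complex_norm_square sum_distrib_left of_real_of_nat_eq)
  finally show ?thesis by (simp only: of_real_eq_iff)
qed

lemma psi_odd_square:
  assumes "psi k \<noteq> 0"
  shows "\<exists>m. k\<^sup>2 = 1 + 8 * m"
proof -
  from assms have "k mod 8 = 1 \<or> k mod 8 = 3 \<or> k mod 8 = 5 \<or> k mod 8 = 7"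
    by (auto simp: psi_def split: if_splits)
  then have "(k mod 8) * (k mod 8) mod 8 = 1" by auto
  then have "k * k mod 8 = 1" by (simp add: mod_mult_eq)
  then have "k\<^sup>2 = 1 + 8 * (k\<^sup>2 div 8)"
    unfolding power2_eq_square by (metis add.commute mult_div_mod_eq)
  then show ?thesis by blast
qed

text \<open>Completing the square, that is, the substitution \<open>\<rho> \<mapsto> \<rho> - d k\<close>, reduces the transform to \<open>\<Sum>\<rho>. F k \<rho>\<close>. A shift of
  \<open>\<rho>\<close> by \<open>c / 2\<close> multiplies the summand by \<open>e (a \<rho> / 8)\<close> and does not change the sum. Averaging over the eight
  multiples of this shift leaves only the \<open>\<rho>\<close> divisible by \<open>8\<close>, where \<open>psi (\<rho> - k) = - psi k\<close> comes out of the sum.\<close>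

lemma shadow_twist_dft:
  fixes a b c d :: int
  assumes det: "a * d - b * c = 1" and a: "[a = 1] (mod 16)" and d: "[d = 1] (mod 16)"
    and c: "[c = 0] (mod 32)" "c > 0"
  obtains K where "\<And>k. dft (nat (4 * c)) (shadow_twist (of_int a / of_int c)) k
      = K * (psi k * echar 1 (- of_int d * of_int k ^ 2 / (8 * of_int c)))"
proof -
  define M where "M = nat (4 * c)"
  have M: "M > 0" "int M = 4 * c" "real M = 4 * of_int c" using c by (auto simp: M_def)
  obtain c' where c': "c = 32 * c'" using c(1) by (auto simp: cong_0_iff)
  obtain d' where d': "d = 1 + 16 * d'" using d by (metis cong_iff_lin cong_sym mult.commute)
  have a8: "coprime a 8"
  proof -
    obtain a' where "a = 1 + 16 * a'" using a by (metis cong_iff_lin cong_sym mult.commute)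
    then have "odd a" by simp
    then have "coprime a (2 ^ 3)" by (simp only: coprime_power_right_iff) simp
    then show ?thesis by simp
  qed
  have c0: "real_of_int c \<noteq> 0" using c by simp
  define e where "e = echar 1"
  have e_add: "e (x + y) = e x * e y" for x y by (simp add: e_def echar_add_right)
  have e_int: "e (of_int n) = 1" for n by (simp add: e_def echar_int)
  have e_cong: "e x = e y" if "x = y + of_int n" for x y n using that by (simp add: e_add e_int)
  define F where "F = (\<lambda>k \<rho>. psi (\<rho> - k) * e (of_int a * of_int \<rho> ^ 2 / (8 * of_int c) - of_int (k * b * \<rho>) / 4))"
  define W where "W = (\<Sum>\<rho>\<in>{0..<int M}. if 8 dvd \<rho> then e (of_int a * of_int \<rho> ^ 2 / (8 * of_int c)) else 0)"
  have Fper: "F k (\<rho> + int M) = F k \<rho>" for k \<rho>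
  proof -
    have "psi (\<rho> + 4 * c - k) = psi (\<rho> - k)"
      by (rule psi_cong) (simp add: c' cong_iff_dvd_diff)
    moreover have "of_int a * of_int (\<rho> + 4 * c) ^ 2 / (8 * of_int c) - of_int (k * b * (\<rho> + 4 * c)) / 4
        = of_int a * of_int \<rho> ^ 2 / (8 * of_int c) - of_int (k * b * \<rho>) / 4 + real_of_int (a * \<rho> + 2 * a * c - k * b * c)"
      using c0 by (simp add: field_simps power2_eq_square)
    ultimately show ?thesis unfolding F_def M(2) by (simp only: e_cong)
  qed
  have Sum: "(\<Sum>\<rho>\<in>{0..<int M}. F k \<rho>) = - psi k * W" for k
  proof -
    \<comment> \<open>\<open>F k\<close> shifted \<open>j\<close> times by \<open>c / 2 = 16 * c'\<close>\<close>
    define G where "G = (\<lambda>j \<rho>. F k \<rho> * e (of_int (int j * a * \<rho>) / 8))"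
    have Gper: "G j (\<rho> + int M) = G j \<rho>" for j \<rho>
    proof -
      have "of_int (int j * a * (\<rho> + int M)) / 8 = of_int (int j * a * \<rho>) / 8 + real_of_int (16 * int j * a * c')"
        by (simp add: M(2) c' field_simps)
      then show ?thesis unfolding G_def Fper by (simp only: e_cong)
    qed
    have Gshift: "G j (\<rho> + 16 * c') = G (Suc j) \<rho>" for j \<rho>
    proof -
      have "psi (\<rho> + 16 * c' - k) = psi (\<rho> - k)"
        by (rule psi_cong) (simp add: cong_iff_dvd_diff)
      moreover have "e (of_int a * of_int (\<rho> + 16 * c') ^ 2 / (8 * of_int c) - of_int (k * b * (\<rho> + 16 * c')) / 4)
          * e (of_int (int j * a * (\<rho> + 16 * c')) / 8)
         = e (of_int a * of_int \<rho> ^ 2 / (8 * of_int c) - of_int (k * b * \<rho>) / 4) * e (of_int (int (Suc j) * a * \<rho>) / 8)"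
        unfolding e_add[symmetric]
        by (rule e_cong[of _ _ "a * c' - 4 * k * b * c' + 2 * int j * a * c'"])
           (use c0 in \<open>simp add: c' field_simps power2_eq_square\<close>)
      ultimately show ?thesis unfolding G_def F_def by (simp only: mult.assoc)
    qed
    have G0: "(\<Sum>\<rho>\<in>{0..<int M}. G j \<rho>) = (\<Sum>\<rho>\<in>{0..<int M}. F k \<rho>)" for j
    proof (induction j)
      case 0 then show ?case using e_int[of 0] by (simp add: G_def)
    next
      case (Suc j)
      have "(\<Sum>\<rho>\<in>{0..<int M}. G (Suc j) \<rho>) = (\<Sum>\<rho>\<in>{0..<int M}. G j \<rho>)"
        unfolding Gshift[symmetric] by (rule periodic_sum_shift[where f = "G j", OF Gper])
      with Suc show ?case by simp
    qed
    have "8 * (\<Sum>\<rho>\<in>{0..<int M}. F k \<rho>) = (\<Sum>j<8. \<Sum>\<rho>\<in>{0..<int M}. G j \<rho>)"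
      by (simp add: G0)
    also have "\<dots> = (\<Sum>\<rho>\<in>{0..<int M}. F k \<rho> * (\<Sum>j<8. e (of_int (int j * a * \<rho>) / 8)))"
      unfolding G_def by (subst sum.swap) (simp only: sum_distrib_left)
    also have "\<dots> = (\<Sum>\<rho>\<in>{0..<int M}. 8 * (- psi k * (if 8 dvd \<rho> then e (of_int a * of_int \<rho> ^ 2 / (8 * of_int c)) else 0)))"
    proof (intro sum.cong refl)
      fix \<rho>
      have eq: "echar (int j) (of_int (a * \<rho>) / of_nat 8) = e (of_int (int j * a * \<rho>) / 8)" for j
        by (subst echar_eq_1) (simp add: e_def mult_ac)
      have "(\<Sum>j<8. e (of_int (int j * a * \<rho>) / 8)) = (\<Sum>j\<in>{0..<int 8}. echar j (of_int (a * \<rho>) / of_nat 8))"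
        by (rule sum.reindex_bij_witness[of _ nat int]) (auto simp: eq simp del: of_int_mult of_int_of_nat_eq of_nat_numeral)
      also have "\<dots> = (if 8 dvd \<rho> then 8 else 0)"
        using a8 by (subst sum_echar) (auto simp: coprime_dvd_mult_right_iff coprime_commute)
      finally have s: "(\<Sum>j<8. e (of_int (int j * a * \<rho>) / 8)) = (if 8 dvd \<rho> then 8 else 0)" .
      show "F k \<rho> * (\<Sum>j<8. e (of_int (int j * a * \<rho>) / 8))
          = 8 * (- psi k * (if 8 dvd \<rho> then e (of_int a * of_int \<rho> ^ 2 / (8 * of_int c)) else 0))"
      proof (cases "8 dvd \<rho>")
        case True
        then obtain m where m: "\<rho> = 8 * m" by auto
        have "psi (\<rho> - k) = psi (- k)"
          by (rule psi_cong) (simp add: m cong_iff_dvd_diff)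
        moreover have "e (of_int a * of_int \<rho> ^ 2 / (8 * of_int c) - of_int (k * b * \<rho>) / 4) = e (of_int a * of_int \<rho> ^ 2 / (8 * of_int c))"
          by (rule e_cong[of _ _ "- 2 * k * b * m"]) (simp add: m)
        ultimately show ?thesis unfolding s F_def by (simp add: True psi_minus)
      qed (simp only: s if_False mult_zero_right)
    qed
    also have "\<dots> = 8 * (- psi k * W)"
      by (simp only: sum_distrib_left W_def)
    finally show ?thesis by simp
  qed
  have "dft M (shadow_twist (of_int a / of_int c)) k = - e (of_int (d * b) / 8) * W * (psi k * e (- of_int d * of_int k ^ 2 / (8 * of_int c)))" for k
  proof -
    define f where "f = (\<lambda>\<rho>. shadow_twist (of_int a / of_int c) \<rho> * echar k (of_int \<rho> / of_nat M))"
    have f: "f \<rho> = psi \<rho> * e (of_int a * of_int \<rho> ^ 2 / (8 * of_int c) + of_int (k * \<rho>) / (4 * of_int c))" for \<rho>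
      unfolding f_def shadow_twist_def echar_eq_1[of k] e_def[symmetric] e_add M(3) by (simp add: mult_ac)
    have fper: "f (\<rho> + int M) = f \<rho>" for \<rho>
    proof -
      have "psi (\<rho> + 4 * c) = psi \<rho>"
        by (rule psi_cong) (simp add: c' cong_iff_dvd_diff)
      moreover have "of_int a * of_int (\<rho> + 4 * c) ^ 2 / (8 * of_int c) + of_int (k * (\<rho> + 4 * c)) / (4 * of_int c)
          = of_int a * of_int \<rho> ^ 2 / (8 * of_int c) + of_int (k * \<rho>) / (4 * of_int c) + real_of_int (a * \<rho> + 2 * a * c + k)"
        using c0 by (simp add: field_simps power2_eq_square)
      ultimately show ?thesis unfolding f M(2) by (simp only: e_cong)
    qed
    \<comment> \<open>completing the square, with \<open>a * d = 1 + b * c\<close>\<close>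
    have fs: "f (\<rho> + (- (d * k))) = e (- of_int d * of_int k ^ 2 / (8 * of_int c)) * e (of_int (d * b * k\<^sup>2) / 8) * F k \<rho>" for \<rho>
    proof -
      have "psi (\<rho> + (- (d * k))) = psi (\<rho> - k)"
      proof (rule psi_cong)
        have "\<rho> + (- (d * k)) - (\<rho> - k) = 8 * (- 2 * d' * k)" by (simp add: d' algebra_simps)
        then show "[\<rho> + (- (d * k)) = \<rho> - k] (mod 8)" by (simp only: cong_iff_dvd_diff dvd_triv_left)
      qed
      moreover have "of_int a * of_int (\<rho> + (- (d * k))) ^ 2 / (8 * of_int c) + of_int (k * (\<rho> + (- (d * k)))) / (4 * of_int c)
         = - of_int d * of_int k ^ 2 / (8 * of_int c) + real_of_int (d * b * k\<^sup>2) / 8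
           + (of_int a * of_int \<rho> ^ 2 / (8 * of_int c) - of_int (k * b * \<rho>) / 4)"
      proof -
        have "a * (\<rho> - d * k)\<^sup>2 + 2 * (k * (\<rho> - d * k)) = - d * k\<^sup>2 + d * b * k\<^sup>2 * c + a * \<rho>\<^sup>2 - 2 * (k * b * \<rho>) * c"
        proof -
          have bc: "b * c = a * d - 1" using det by simp
          have "- d * k\<^sup>2 + d * b * k\<^sup>2 * c + a * \<rho>\<^sup>2 - 2 * (k * b * \<rho>) * c
             = - d * k\<^sup>2 + d * k\<^sup>2 * (b * c) + a * \<rho>\<^sup>2 - 2 * (k * \<rho>) * (b * c)" by (simp add: algebra_simps)
          also have "\<dots> = a * (\<rho> - d * k)\<^sup>2 + 2 * (k * (\<rho> - d * k))"
            unfolding bc by (simp add: algebra_simps power2_eq_square)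
          finally show ?thesis by simp
        qed
        then have R: "real_of_int (a * (\<rho> - d * k)\<^sup>2 + 2 * (k * (\<rho> - d * k)))
           = of_int (- d * k\<^sup>2 + d * b * k\<^sup>2 * c + a * \<rho>\<^sup>2 - 2 * (k * b * \<rho>) * c)" by (simp only:)
        have split: "A / (8 * C) + B / (4 * C) = P / (8 * C) + Q / 8 + (R / (8 * C) - S / 4)"
          if "A + 2 * B = P + Q * C + R - 2 * S * C" "C \<noteq> 0" for A B C P Q R S :: real
        proof -
          have "A / (8 * C) + B / (4 * C) = (A + 2 * B) / (8 * C)" using that(2) by (simp add: field_simps)
          also have "\<dots> = P / (8 * C) + Q / 8 + (R / (8 * C) - S / 4)"
            unfolding that(1) using that(2) by (simp add: add_divide_distrib diff_divide_distrib)
          finally show ?thesis .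
        qed
        show ?thesis
          by (rule split) (use R c0 in simp_all)
      qed
      ultimately show ?thesis unfolding f F_def by (simp only: e_add mult_ac)
    qed
    have "dft M (shadow_twist (of_int a / of_int c)) k = (\<Sum>\<rho>\<in>{0..<int M}. f (\<rho> + (- (d * k))))"
      unfolding dft_def f_def[symmetric] by (rule periodic_sum_shift[where f = f, OF fper, symmetric])
    also have "\<dots> = e (- of_int d * of_int k ^ 2 / (8 * of_int c)) * e (of_int (d * b * k\<^sup>2) / 8) * (- psi k * W)"
      unfolding fs sum_distrib_left[symmetric] Sum ..
    also have "\<dots> = - e (of_int (d * b) / 8) * W * (psi k * e (- of_int d * of_int k ^ 2 / (8 * of_int c)))"
    proof (cases "psi k = 0")
      case False
      \<comment> \<open>the factor depends on \<open>k\<close> only through \<open>k\<^sup>2\<close> modulo \<open>8\<close>, hence not at all for odd \<open>k\<close>\<close>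
      then obtain m where m: "k\<^sup>2 = 1 + 8 * m" using psi_odd_square by blast
      have "e (of_int (d * b * k\<^sup>2) / 8) = e (of_int (d * b) / 8)"
        by (rule e_cong[of _ _ "d * b * m"]) (simp add: m algebra_simps add_divide_distrib)
      then show ?thesis by simp
    qed simp
    finally show ?thesis .
  qed
  then show ?thesis using that unfolding M_def e_def by blast
qed

section \<open>Modularity of the shadow\<close>

lemma norm_psi_sq_sum_pos:
  assumes "M > 8"
  shows "(\<Sum>k\<in>{0..<int M}. (norm (psi k))\<^sup>2) > 0"
proof (rule sum_pos2[of _ 1])
  show "0 < (norm (psi 1))\<^sup>2" by (simp add: psi_def)
qed (use assms in auto)

lemma norm_echar_mult [simp]: "norm (x * echar k y) = norm x"
  by (simp add: norm_mult)

lemma shadow_twist_periodic: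
  fixes a c :: int
  assumes c: "[c = 0] (mod 32)" "c > 0"
  shows "shadow_twist (of_int a / of_int c) (r + int (nat (4 * c))) = shadow_twist (of_int a / of_int c) r"
proof -
  have M: "int (nat (4 * c)) = 4 * c" using c by simp
  have "psi (r + 4 * c) = psi r"
    using c by (intro psi_cong) (auto simp: cong_iff_dvd_diff cong_0_iff)
  moreover have "of_int a / of_int c * of_int (r + 4 * c) ^ 2 / 8 = of_int a / of_int c * of_int r ^ 2 / 8 + real_of_int (a * r + 2 * a * c)"
    using c by (simp add: field_simps power2_eq_square)
  ultimately show ?thesis
    unfolding shadow_twist_def M by (simp only: echar_add_int)
qed

lemma norm_shadow_twist: "norm (shadow_twist x r) = norm (psi r)"
  by (simp add: shadow_twist_def)

text \<open>With \<open>j = c w + d\<close>, the image of \<open>w\<close> is \<open>a / c - 1 / (c j)\<close>. The inversion formula of period \<open>4 c\<close> for the theta series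
  at \<open>a / c\<close> leads to the point \<open>w + d / c\<close>, and the Gauss sum removes the shift by \<open>d / c\<close>.\<close>

lemma shadow_modular_pos:
  fixes a b c d :: int
  assumes det: "a * d - b * c = 1" and a: "[a = 1] (mod 16)" and d: "[d = 1] (mod 16)"
    and c: "[c = 0] (mod 32)" "c > 0"
  obtains \<kappa> where "norm \<kappa> = 1" "\<And>w. Im w > 0 \<Longrightarrow>
      shadow ((of_int a * w + of_int b) / (of_int c * w + of_int d))
        = \<kappa> * (- \<i> * (of_int c * w + of_int d)) powr (3/2) * shadow w"
proof -
  define x where "x = real_of_int a / real_of_int c"
  define M where "M = nat (4 * c)"
  have c32: "c \<ge> 32" using c zdvd_imp_le[of 32 c] by (auto simp: cong_0_iff)
  have M: "M > 8" "int M = 4 * c" "of_nat M = 4 * complex_of_int c" "real M = 4 * of_int c"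
  proof -
    show iM: "int M = 4 * c" using c by (simp add: M_def)
    show "M > 8" using iM c32 by linarith
    show "of_nat M = 4 * complex_of_int c" using arg_cong[OF iM, of complex_of_int] by simp
    show "real M = 4 * of_int c" using arg_cong[OF iM, of real_of_int] by simp
  qed
  have c0: "complex_of_int c \<noteq> 0" using c by simp
  obtain K where K: "\<And>k. dft M (shadow_twist x) k = K * (psi k * echar 1 (- of_int d * of_int k ^ 2 / (8 * of_int c)))"
    using shadow_twist_dft[OF det a d c] unfolding M_def x_def by blast
  have nK: "(norm K)\<^sup>2 = real M"
  proof -
    have "(norm K)\<^sup>2 * (\<Sum>k\<in>{0..<int M}. (norm (psi k))\<^sup>2) = (\<Sum>k\<in>{0..<int M}. (norm (dft M (shadow_twist x) k))\<^sup>2)"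
      unfolding K by (simp add: norm_mult power_mult_distrib sum_distrib_left)
    also have "\<dots> = real M * (\<Sum>k\<in>{0..<int M}. (norm (psi k))\<^sup>2)"
      using M by (subst dft_parseval) (auto simp: norm_shadow_twist)
    finally show ?thesis using norm_psi_sq_sum_pos[OF M(1)] by simp
  qed
  define C where "C = real M"
  have C: "C > 0" "C = 4 * of_int c" using M by (auto simp: C_def)
  define \<kappa> where "\<kappa> = - \<i> / of_real (C ^ 2) * of_real (C powr (3/2)) * K"
  have "norm \<kappa> = 1"
  proof -
    have "norm K = C powr (1/2)"
      using nK C by (simp add: C_def powr_half_sqrt real_sqrt_unique)
    then have "norm \<kappa> = C powr (3/2) * C powr (1/2) / C ^ 2"
      using C by (simp add: \<kappa>_def norm_mult norm_divide norm_power)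
    also have "C powr (3/2) * C powr (1/2) = C powr (3/2 + 1/2)" by (rule powr_add[symmetric])
    also have "\<dots> = C ^ 2" using C by (simp add: powr_numeral)
    finally show ?thesis using C by simp
  qed
  moreover have "shadow ((of_int a * w + of_int b) / (of_int c * w + of_int d))
        = \<kappa> * (- \<i> * (of_int c * w + of_int d)) powr (3/2) * shadow w" if w: "Im w > 0" for w
  proof -
    define j where "j = of_int c * w + of_int d"
    define p where "p = - \<i> * j"
    have imj: "Im j > 0" using w c by (simp add: j_def)
    have j0: "j \<noteq> 0" using imj by auto
    have rep: "Re p > 0" using imj by (simp add: p_def)
    define z where "z = - 1 / (of_int c * j)"
    have cz: "(of_int a * w + of_int b) / j = of_real x + z"
    proof -
      have "of_int a * j - 1 = of_int c * (of_int a * w + of_int b)"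
      proof -
        have "complex_of_int (a * d - b * c) = 1" by (simp only: det of_int_1)
        then show ?thesis by (simp add: j_def algebra_simps)
      qed
      then have "(of_int a * j - 1) / (of_int c * j) = (of_int a * w + of_int b) / j"
        using c0 by simp
      then show ?thesis using c0 j0 by (simp add: x_def z_def diff_divide_distrib)
    qed
    have z4: "- \<i> * (z / 4) = inverse (of_real C * p)"
      using c0 j0 by (simp add: z_def C p_def field_simps)
    have zM: "- 1 / (of_nat M ^ 2 * (z / 4)) = of_real (real_of_int d / of_int c) / 4 + w / 4"
      using c0 j0 unfolding M z_def by (simp add: field_simps power2_eq_square) (simp add: j_def algebra_simps)
    have rC: "Re (of_real C * p) > 0" using rep C by simp
    have Imz: "Im (z / 4) > 0"
    proof -
      have "Re (inverse (of_real C * p)) > 0"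
        using rC by (metis inverse_complex.sel(1) divide_pos_pos less_irrefl mult_zero_left power2_eq_square sum_power2_gt_zero_iff)
      then have "Re (- \<i> * (z / 4)) > 0" unfolding z4 .
      then show ?thesis by simp
    qed
    have nr: "of_real C * p \<notin> \<real>\<^sub>\<le>\<^sub>0" using rC by (metis complex_nonpos_Reals_iff not_le)
    have pw: "(- \<i> * (z / 4)) powr (-3/2) = of_real (C powr (3/2)) * p powr (3/2)"
    proof -
      have "(- \<i> * (z / 4)) powr (-3/2) = exp (- (3/2) * Ln (inverse (of_real C * p)))"
        unfolding z4 powr_def using nr by auto
      also have "\<dots> = exp (3/2 * Ln (of_real C * p))"
        unfolding Ln_inverse[OF nr] by simp
      also have "Ln (of_real C * p) = of_real (ln C) + Ln p"
      proof -
        have "p \<noteq> 0" using rep by auto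
        then show ?thesis using C(1) Ln_times_of_real[of C p] Ln_of_real[of C] by simp
      qed
      also have "exp (3/2 * (of_real (ln C) + Ln p)) = of_real (C powr (3/2)) * p powr (3/2)"
        using C rep by (auto simp: powr_def distrib_left exp_add exp_of_real[symmetric])
      finally show ?thesis .
    qed
    have dft: "twisted_theta (dft M (shadow_twist x)) (of_real (real_of_int d / of_int c) / 4 + w / 4) = K * shadow w"
      unfolding twisted_theta_def shadow_def infsum_cmult_right'[symmetric]
    proof (rule infsum_cong)
      fix k :: int
      have "echar 1 (- of_int d * of_int k ^ 2 / (8 * of_int c)) * exp (of_real pi * \<i> * (of_real (real_of_int d / of_int c) / 4 + w / 4) * of_int k ^ 2)
          = exp (of_real pi * \<i> * (w / 4) * of_int k ^ 2)"
        using c0 by (simp add: echar_def exp_add[symmetric] field_simps)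
      then show "of_int k * dft M (shadow_twist x) k * exp (of_real pi * \<i> * (of_real (real_of_int d / of_int c) / 4 + w / 4) * of_int k ^ 2)
          = K * (of_int k * psi k * exp (of_real pi * \<i> * (w / 4) * of_int k ^ 2))"
        unfolding K by (simp add: mult_ac)
    qed
    have "shadow ((of_int a * w + of_int b) / j) = twisted_theta (shadow_twist x) (z / 4)"
      unfolding cz by (rule shadow_shift)
    also have "\<dots> = - \<i> / of_nat M ^ 2 * (- \<i> * (z / 4)) powr (-3/2) * twisted_theta (dft M (shadow_twist x)) (- 1 / (of_nat M ^ 2 * (z / 4)))"
      using M shadow_twist_periodic[OF c, of a] Imz
      by (intro twisted_theta_inversion) (auto simp: x_def M_def)
    also have "\<dots> = \<kappa> * p powr (3/2) * shadow w"
      unfolding pw zM dft by (simp add: \<kappa>_def C_def mult_ac)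
    finally show ?thesis unfolding p_def j_def .
  qed
  ultimately show ?thesis using that by blast
qed

lemma powr_inverse_right_half_plane:
  assumes "Re p > 0"
  shows "inverse p powr s = inverse (p powr s)"
proof -
  have "p \<notin> \<real>\<^sub>\<le>\<^sub>0" using assms by (auto simp: complex_nonpos_Reals_iff)
  then show ?thesis using assms by (auto simp: powr_def Ln_inverse exp_minus)
qed

text \<open>A negative \<open>c\<close> is treated through the inverse matrix. The sign in the factor keeps the base of the power in the right
  half-plane, where the principal branch is compatible with inverses.\<close>

theorem shadow_modular:
  fixes a b c d :: int
  assumes det: "a * d - b * c = 1" and a: "[a = 1] (mod 16)" and d: "[d = 1] (mod 16)"
    and c: "[c = 0] (mod 32)" "c \<noteq> 0"
  obtains \<kappa> where "norm \<kappa> = 1" "\<And>w. Im w > 0 \<Longrightarrow>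
      shadow ((of_int a * w + of_int b) / (of_int c * w + of_int d))
        = \<kappa> * (- \<i> * of_int (sgn c) * (of_int c * w + of_int d)) powr (3/2) * shadow w"
proof (cases "c > 0")
  case True
  then show ?thesis using shadow_modular_pos[OF det a d c(1)] that by auto
next
  case False
  then have c': "- c > 0" using c by simp
  have "[- c = 0] (mod 32)" using c(1) by (simp add: cong_0_iff)
  moreover have "d * a - (- b) * (- c) = 1" using det by (simp add: mult.commute)
  ultimately obtain \<kappa> where \<kappa>: "norm \<kappa> = 1" "\<And>w. Im w > 0 \<Longrightarrow>
      shadow ((of_int d * w + of_int (- b)) / (of_int (- c) * w + of_int a))
        = \<kappa> * (- \<i> * (of_int (- c) * w + of_int a)) powr (3/2) * shadow w"
    using shadow_modular_pos[of d a "- b" "- c"] d a c' by blast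
  have "shadow ((of_int a * w + of_int b) / (of_int c * w + of_int d))
        = inverse \<kappa> * (- \<i> * of_int (sgn c) * (of_int c * w + of_int d)) powr (3/2) * shadow w" if w: "Im w > 0" for w
  proof -
    define j where "j = of_int c * w + of_int d"
    define p where "p = \<i> * j"
    define v where "v = (of_int a * w + of_int b) / j"
    have imj: "Im j < 0" using w c' by (simp add: j_def mult_neg_pos)
    have j0: "j \<noteq> 0" using imj by auto
    have rep: "Re p > 0" using imj by (simp add: p_def)
    have det': "complex_of_int a * of_int d - of_int b * of_int c = 1"
      by (metis det of_int_1 of_int_diff of_int_mult)
    have Imv: "Im v > 0"
    proof -
      have "v * (j * cnj j) = (of_int a * w + of_int b) * cnj j" using j0 by (simp add: v_def)
      then have "Im (v * of_real ((norm j)\<^sup>2)) = Im ((of_int a * w + of_int b) * cnj j)"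
        by (simp only: complex_norm_square)
      then have "Im v * (norm j)\<^sup>2 = (of_int a * of_int d - of_int b * of_int c) * Im w"
        by (simp add: j_def algebra_simps)
      also have "real_of_int a * of_int d - of_int b * of_int c = 1"
        by (metis det of_int_1 of_int_diff of_int_mult)
      finally have "Im v * (norm j)\<^sup>2 > 0" using w by simp
      then show ?thesis by (simp add: zero_less_mult_iff)
    qed
    have jv: "of_int (- c) * v + of_int a = inverse j"
    proof -
      have "(of_int (- c) * v + of_int a) * j = of_int (- c) * (v * j) + of_int a * j" by (simp add: algebra_simps)
      also have "v * j = of_int a * w + of_int b" using j0 by (simp add: v_def)
      also have "of_int (- c) * (of_int a * w + of_int b) + of_int a * j = complex_of_int a * of_int d - of_int b * of_int c"
        by (simp add: j_def algebra_simps)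
      finally show ?thesis using det' j0 by (simp add: divide_simps eq_divide_eq)
    qed
    have wv: "(of_int d * v + of_int (- b)) / (of_int (- c) * v + of_int a) = w"
    proof -
      have "(of_int d * v + of_int (- b)) * j = of_int d * (v * j) - of_int b * j" by (simp add: algebra_simps)
      also have "v * j = of_int a * w + of_int b" using j0 by (simp add: v_def)
      also have "of_int d * (of_int a * w + of_int b) - of_int b * j = (complex_of_int a * of_int d - of_int b * of_int c) * w"
        by (simp add: j_def algebra_simps)
      finally show ?thesis unfolding jv using det' by (simp add: divide_inverse)
    qed
    have "shadow w = \<kappa> * (- \<i> * inverse j) powr (3/2) * shadow v"
      using \<kappa>(2)[OF Imv] unfolding wv unfolding jv .
    also have "- \<i> * inverse j = inverse p" by (simp add: p_def)
    also have "inverse p powr (3/2) = inverse (p powr (3/2))"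
      by (rule powr_inverse_right_half_plane[OF rep])
    finally have eq: "shadow w = \<kappa> * inverse (p powr (3/2)) * shadow v" .
    have "p powr (3/2) \<noteq> 0" "\<kappa> \<noteq> 0" using rep \<kappa>(1) by auto
    then have "shadow v = inverse \<kappa> * p powr (3/2) * shadow w"
      unfolding eq by (simp add: field_simps)
    moreover have "sgn c = -1" using c' by simp
    ultimately show ?thesis by (simp add: p_def v_def j_def)
  qed
  moreover have "norm (inverse \<kappa>) = 1" using \<kappa>(1) by (simp add: norm_inverse)
  ultimately show ?thesis using that by blast
qed

section \<open>Decay of the shadow at the cusps\<close>

text \<open>Exponential smallness in \<open>1 / v\<close> beats every power of \<open>v\<close>.\<close>

lemma exp_minus_inverse_le:
  fixes c v :: real
  assumes "c > 0" "v > 0" "n > 0"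
  shows "exp (- (c / v)) \<le> (real n / c) ^ n * v ^ n"
proof -
  have "(c / v / real n) ^ n \<le> (1 + (c / v) / real n) ^ n"
    using assms by (intro power_mono) auto
  also have "\<dots> \<le> exp (c / v)"
    using assms by (intro exp_ge_one_plus_x_over_n_power_n) (auto intro: order_trans[of _ 0])
  finally have "inverse (exp (c / v)) \<le> inverse ((c / v / real n) ^ n)"
    using assms by (intro le_imp_inverse_le) auto
  also have "inverse ((c / v / real n) ^ n) = (real n / c) ^ n * v ^ n"
    using assms by (simp add: power_divide field_simps)
  finally show ?thesis by (simp add: exp_minus)
qed

lemma shadow_twist_periodic_rat:
  assumes q: "q > 0"
  shows "shadow_twist (of_int p / of_nat q) (r + int (8 * q)) = shadow_twist (of_int p / of_nat q) r"
proof -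
  have "psi (r + int (8 * q)) = psi r"
    by (intro psi_cong) (auto simp: cong_iff_dvd_diff)
  moreover have "of_int p / of_nat q * of_int (r + int (8 * q)) ^ 2 / 8
      = of_int p / of_nat q * of_int r ^ 2 / 8 + real_of_int (2 * p * r + 8 * p * int q)"
    using q by (simp add: field_simps power2_eq_square)
  ultimately show ?thesis unfolding shadow_twist_def by (simp only: echar_add_int)
qed

text \<open>Inversion sends \<open>z\<close> to \<open>- 1 / (M\<^sup>2 z / 4)\<close>, whose imaginary part is of the order of \<open>1 / Im z\<close> in the cone
  \<open>\<bar>Re z\<bar> \<le> Im z\<close>. There the transformed series is exponentially small, since it has no constant term.\<close>

lemma shadow_cusp_decay:
  assumes x: "x \<in> \<rat>"
  obtains K where "\<And>z. 0 < Im z \<Longrightarrow> Im z \<le> 1 \<Longrightarrow> \<bar>Re z\<bar> \<le> Im z \<Longrightarrow> norm (shadow (of_real x + z)) \<le> K * Im z ^ N"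
proof -
  from x obtain p :: int and q' :: int where pq: "q' > 0" "x = of_int p / of_int q'"
    by (metis Rats_cases')
  define q where "q = nat q'"
  have q: "q > 0" "x = of_int p / of_nat q" using pq by (auto simp: q_def)
  define M where "M = 8 * q"
  have M: "M > 0" using q by (simp add: M_def)
  define y0 where "y0 = 2 / real M ^ 2"
  have y0: "y0 > 0" using M by (simp add: y0_def)
  define B where "B = (\<Sum>\<rho>\<in>{0..<int M}. norm (shadow_twist x \<rho>))"
  have bd: "norm (dft M (shadow_twist x) k) \<le> B" for k
    unfolding B_def by (rule norm_dft_le)
  obtain K where K: "K \<ge> 0" "\<And>z. Im z \<ge> y0 \<Longrightarrow> norm (twisted_theta (dft M (shadow_twist x)) z) \<le> K * exp (- (pi / 2) * Im z)"
    using twisted_theta_decay[where \<xi> = "dft M (shadow_twist x)", OF bd y0] by blast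
  define K' where "K' = 16 * K * (real (N + 2) / (pi / 2 * y0)) ^ (N + 2)"
  have "norm (shadow (of_real x + z)) \<le> K' * Im z ^ N" if z: "0 < Im z" "Im z \<le> 1" "\<bar>Re z\<bar> \<le> Im z" for z
  proof -
    define v where "v = Im z"
    have v: "0 < v" "v \<le> 1" using z by (auto simp: v_def)
    define u where "u = - 1 / (of_nat M ^ 2 * (z / 4))"
    have z0: "z \<noteq> 0" using z by auto
    have sq: "(norm z)\<^sup>2 \<le> 2 * v\<^sup>2"
      using z by (simp add: cmod_power2 v_def abs_le_square_iff[symmetric])
    have Imu: "Im u \<ge> y0 / v"
    proof -
      have "u = of_real (4 / real M ^ 2) * (- (1 / z))" using z0 M by (simp add: u_def field_simps)
      also have "1 / z = cnj z / of_real ((norm z)\<^sup>2)"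
        using z0 by (simp only: complex_norm_square) (simp add: divide_simps)
      finally have "u = of_real (4 / (real M ^ 2 * (norm z)\<^sup>2)) * (- cnj z)"
        by (simp add: divide_simps)
      then have "Im u = 4 / (real M ^ 2 * (norm z)\<^sup>2) * v" by (simp add: v_def)
      also have "\<dots> \<ge> 4 / (real M ^ 2 * (2 * v\<^sup>2)) * v"
        using v M sq z0 by (intro mult_right_mono divide_left_mono mult_left_mono mult_pos_pos) auto
      also have "4 / (real M ^ 2 * (2 * v\<^sup>2)) * v = y0 / v"
        using v M by (simp add: y0_def field_simps power2_eq_square)
      finally show ?thesis .
    qed
    have y0v: "y0 / v \<ge> y0" using v y0 by (simp add: field_simps)
    have "norm (twisted_theta (dft M (shadow_twist x)) u) \<le> K * exp (- (pi / 2) * Im u)"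
      using Imu y0v by (intro K) auto
    also have "\<dots> \<le> K * exp (- ((pi / 2 * y0) / v))"
    proof -
      have "pi / 2 * (y0 / v) \<le> pi / 2 * Im u" using Imu by (intro mult_left_mono) auto
      then show ?thesis using K(1) by (intro mult_left_mono) auto
    qed
    also have "\<dots> \<le> K * ((real (N + 2) / (pi / 2 * y0)) ^ (N + 2) * v ^ (N + 2))"
      using v y0 K(1) by (intro mult_left_mono exp_minus_inverse_le) auto
    finally have t: "norm (twisted_theta (dft M (shadow_twist x)) u) \<le> K * ((real (N + 2) / (pi / 2 * y0)) ^ (N + 2) * v ^ (N + 2))" .
    have p: "norm ((- \<i> * (z / 4)) powr (-3/2)) \<le> 16 / v\<^sup>2"
    proof -
      have "norm ((- \<i> * (z / 4)) powr (-3/2)) = norm (z / 4) powr (-3/2)"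
        by (subst norm_powr_real_powr') (auto simp: norm_mult)
      also have "\<dots> \<le> (v / 4) powr (-3/2)"
        using v abs_Im_le_cmod[of z] by (intro powr_mono2') (auto simp: v_def norm_divide)
      also have "\<dots> \<le> (v / 4) powr (-2)"
        using v by (intro powr_mono') auto
      also have "\<dots> = 16 / v\<^sup>2"
        using v by (simp add: powr_minus_divide powr_numeral power_divide)
      finally show ?thesis .
    qed
    have M2: "1 / real M ^ 2 \<le> 1" using M by simp
    have "norm (shadow (of_real x + z)) = norm (- \<i> / of_nat M ^ 2 * (- \<i> * (z / 4)) powr (-3/2) * twisted_theta (dft M (shadow_twist x)) u)"
      unfolding shadow_shift u_def
      by (subst twisted_theta_inversion[OF M]) (use z q shadow_twist_periodic_rat in \<open>auto simp: M_def\<close>)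
    also have "\<dots> = 1 / real M ^ 2 * norm ((- \<i> * (z / 4)) powr (-3/2)) * norm (twisted_theta (dft M (shadow_twist x)) u)"
      by (simp only: norm_mult norm_divide norm_power norm_minus_cancel norm_ii norm_of_nat)
    also have "\<dots> \<le> 1 * (16 / v\<^sup>2) * (K * ((real (N + 2) / (pi / 2 * y0)) ^ (N + 2) * v ^ (N + 2)))"
      using v M2 by (intro mult_mono p t mult_nonneg_nonneg) auto
    also have "1 * (16 / v\<^sup>2) * (K * (L * v ^ (N + 2))) = 16 * K * L * v ^ N" for L
      using v by (simp add: power_add power2_eq_square)
    finally show ?thesis unfolding K'_def v_def .
  qed
  then show ?thesis using that by blast
qed

lemma shadow_infinity_decay:
  obtains K where "\<And>w. Im w \<ge> 1 \<Longrightarrow> norm (shadow w) * Im w ^ N \<le> K"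
proof -
  obtain K where K: "K \<ge> 0" "\<And>z. Im z \<ge> 1/4 \<Longrightarrow> norm (twisted_theta psi z) \<le> K * exp (- (pi / 2) * Im z)"
    using twisted_theta_decay[where \<xi> = psi and ?y0.0 = "1/4", OF norm_psi_le] by (metis zero_less_divide_1_iff zero_less_numeral)
  define K' where "K' = K * (real (N + 1) / (pi / 8)) ^ (N + 1)"
  have "norm (shadow w) * Im w ^ N \<le> K'" if w: "Im w \<ge> 1" for w
  proof -
    define v where "v = Im w"
    have v: "v \<ge> 1" using w by (simp add: v_def)
    have "norm (shadow w) \<le> K * exp (- (pi / 2) * Im (w / 4))"
      unfolding shadow_def using w by (intro K) auto
    also have "exp (- (pi / 2) * Im (w / 4)) = exp (- ((pi / 8) / (1 / v)))" by (simp add: v_def)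
    also have "\<dots> \<le> (real (N + 1) / (pi / 8)) ^ (N + 1) * (1 / v) ^ (N + 1)"
      using v by (intro exp_minus_inverse_le) auto
    finally have "norm (shadow w) * v ^ N \<le> K * ((real (N + 1) / (pi / 8)) ^ (N + 1) * (1 / v) ^ (N + 1)) * v ^ N"
      using K(1) v by (intro mult_right_mono) (auto intro!: mult_left_mono)
    also have "\<dots> = K' * (1 / v)"
      using v by (simp add: K'_def power_divide)
    also have "\<dots> \<le> K' * 1" using v K(1) by (intro mult_left_mono) (auto simp: K'_def)
    finally show ?thesis by (simp add: v_def)
  qed
  then show ?thesis using that by blast
qed

text \<open>Both ends of a vertical line are cusps, hence the symmetric condition at \<open>0\<close> and \<open>\<infinity>\<close>. The shadow is \<open>rapid\<close> on
  vertical lines above rational points, the half powers that it is integrated against are \<open>moderate\<close>, and products of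
  the two are integrable.\<close>

definition rapid :: "(real \<Rightarrow> complex) \<Rightarrow> bool" where
  "rapid g \<longleftrightarrow> continuous_on {0<..} g \<and> (\<forall>N. \<exists>K. \<forall>y>0. norm (g y) * (y ^ N + 1 / y ^ N) \<le> K)"

definition moderate :: "(real \<Rightarrow> complex) \<Rightarrow> bool" where
  "moderate k \<longleftrightarrow> continuous_on {0<..} k \<and> (\<exists>C m. \<forall>y>0. norm (k y) \<le> C * (y ^ m + 1 / y ^ m))"

lemma shadow_rapid:
  assumes x: "x \<in> \<rat>"
  shows "rapid (\<lambda>y. shadow (Complex x y))"
  unfolding rapid_def
proof (intro conjI allI)
  have "continuous_on {z. Im z > 0} shadow"
    by (rule holomorphic_on_imp_continuous_on[OF shadow_holomorphic])
  then show "continuous_on {0<..} (\<lambda>y. shadow (Complex x y))"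
    by (rule continuous_on_compose2) (auto intro!: continuous_intros simp: Complex_eq)
  fix N
  obtain K1 where K1: "\<And>z. 0 < Im z \<Longrightarrow> Im z \<le> 1 \<Longrightarrow> \<bar>Re z\<bar> \<le> Im z \<Longrightarrow> norm (shadow (of_real x + z)) \<le> K1 * Im z ^ N"
    using shadow_cusp_decay[OF x, of N] by blast
  obtain K2 where K2: "\<And>w. Im w \<ge> 1 \<Longrightarrow> norm (shadow w) * Im w ^ N \<le> K2"
    using shadow_infinity_decay[of N] by blast
  have "norm (shadow (Complex x y)) * (y ^ N + 1 / y ^ N) \<le> 2 * max K1 K2" if y: "y > 0" for y
  proof (cases "y \<le> 1")
    case True
    have "Complex x y = of_real x + Complex 0 y" by (simp add: complex_eq_iff)
    then have "norm (shadow (Complex x y)) \<le> K1 * y ^ N" using K1[of "Complex 0 y"] y True by simp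
    moreover have "y ^ N + 1 / y ^ N \<le> 2 / y ^ N"
    proof -
      have "y ^ N \<le> 1" using y True by (simp add: power_le_one)
      moreover have "y ^ N > 0" using y by simp
      ultimately have "y ^ N \<le> 1 / y ^ N" by (metis le_divide_eq_1_pos order_trans)
      then show ?thesis by simp
    qed
    ultimately have "norm (shadow (Complex x y)) * (y ^ N + 1 / y ^ N) \<le> (K1 * y ^ N) * (2 / y ^ N)"
      using y by (intro mult_mono) (auto intro: order_trans[OF norm_ge_zero])
    then show ?thesis using y by simp
  next
    case False
    have "norm (shadow (Complex x y)) * y ^ N \<le> K2" using K2[of "Complex x y"] False by simp
    moreover have "y ^ N + 1 / y ^ N \<le> 2 * y ^ N"
    proof -
      have "1 \<le> y ^ N" using False by (simp add: one_le_power)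
      then have "1 / y ^ N \<le> y ^ N" by (smt (verit) divide_le_eq_1)
      then show ?thesis by simp
    qed
    then have "norm (shadow (Complex x y)) * (y ^ N + 1 / y ^ N) \<le> norm (shadow (Complex x y)) * (2 * y ^ N)"
      by (intro mult_left_mono) auto
    ultimately show ?thesis by simp
  qed
  then show "\<exists>K. \<forall>y>0. norm (shadow (Complex x y)) * (y ^ N + 1 / y ^ N) \<le> K" by blast
qed

lemma power_add_inverse_mono:
  fixes y :: real
  assumes "y > 0" "m \<le> n"
  shows "y ^ m + 1 / y ^ m \<le> 2 * (y ^ n + 1 / y ^ n)"
proof -
  have a: "u ^ m \<le> u ^ n + 1 / u ^ n" if "u > 0" for u :: real
  proof (cases "u \<le> 1")
    case True
    then have "u ^ m \<le> 1" "u ^ n \<le> 1" using that by (auto intro: power_le_one)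
    then have "1 \<le> 1 / u ^ n" using that by simp
    then show ?thesis using \<open>u ^ m \<le> 1\<close> that by (smt (verit) zero_less_power)
  next
    case False
    then have "u ^ m \<le> u ^ n" using assms(2) by (intro power_increasing) auto
    then show ?thesis using that by (smt (verit) divide_nonneg_pos zero_less_power)
  qed
  show ?thesis using a[of y] a[of "1 / y"] assms(1) by (simp add: power_divide)
qed

lemma rapid_mult:
  assumes g: "rapid g" and k: "moderate k"
  shows "rapid (\<lambda>y. g y * k y)"
  unfolding rapid_def
proof (intro conjI allI)
  show "continuous_on {0<..} (\<lambda>y. g y * k y)"
    using g k by (auto simp: rapid_def moderate_def intro!: continuous_intros)
  fix N
  obtain C m where C: "\<And>y. y > 0 \<Longrightarrow> norm (k y) \<le> C * (y ^ m + 1 / y ^ m)"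
    using k by (auto simp: moderate_def)
  obtain K where K: "\<And>y. y > 0 \<Longrightarrow> norm (g y) * (y ^ (m + N) + 1 / y ^ (m + N)) \<le> K"
    using g by (meson rapid_def)
  have "C \<ge> 0" using order_trans[OF norm_ge_zero C[of 1]] by simp
  have "norm (g y * k y) * (y ^ N + 1 / y ^ N) \<le> 3 * C * K" if y: "y > 0" for y
  proof -
    define d where "d = (if m \<le> N then N - m else m - N)"
    have "(y ^ m + 1 / y ^ m) * (y ^ N + 1 / y ^ N) = (y ^ (m + N) + 1 / y ^ (m + N)) + (y ^ d + 1 / y ^ d)"
    proof (cases "m \<le> N")
      case True
      then obtain e where "N = m + e" using le_Suc_ex by blast
      then show ?thesis using y by (simp add: d_def power_add field_simps)
    next
      case False
      then obtain e where "m = N + e" using le_Suc_ex[of N m] by auto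
      then show ?thesis using y False by (simp add: d_def power_add field_simps)
    qed
    also have "y ^ d + 1 / y ^ d \<le> 2 * (y ^ (m + N) + 1 / y ^ (m + N))"
      using y by (intro power_add_inverse_mono) (auto simp: d_def)
    finally have m: "(y ^ m + 1 / y ^ m) * (y ^ N + 1 / y ^ N) \<le> 3 * (y ^ (m + N) + 1 / y ^ (m + N))" by simp
    have "norm (g y * k y) * (y ^ N + 1 / y ^ N) = norm (g y) * (norm (k y) * (y ^ N + 1 / y ^ N))"
      by (simp add: norm_mult)
    also have "\<dots> \<le> norm (g y) * (C * (y ^ m + 1 / y ^ m) * (y ^ N + 1 / y ^ N))"
      using y by (intro mult_left_mono mult_right_mono C) auto
    also have "\<dots> \<le> norm (g y) * (C * (3 * (y ^ (m + N) + 1 / y ^ (m + N))))"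
      unfolding mult.assoc using \<open>C \<ge> 0\<close> by (intro mult_left_mono m) auto
    also have "\<dots> = 3 * C * (norm (g y) * (y ^ (m + N) + 1 / y ^ (m + N)))" by simp
    also have "\<dots> \<le> 3 * C * K" using \<open>C \<ge> 0\<close> y by (intro mult_left_mono K) auto
    finally show ?thesis .
  qed
  then show "\<exists>K. \<forall>y>0. norm (g y * k y) * (y ^ N + 1 / y ^ N) \<le> K" by blast
qed

lemma set_borel_measurable_continuous_half:
  fixes g :: "real \<Rightarrow> complex"
  assumes "continuous_on {0<..} g"
  shows "set_borel_measurable lborel {0<..} g"
  unfolding set_borel_measurable_def
  using borel_measurable_continuous_on_indicator[OF _ assms] by simp

lemma integrable_inverse_square_half:
  "set_integrable lborel {0<..} (\<lambda>y::real. 1 / (1 + y\<^sup>2))"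
proof -
  have "set_integrable lborel (einterval (-\<infinity>) \<infinity>) (\<lambda>x. inverse (1 + x\<^sup>2))"
    using integrable_inverse_1_plus_square by simp
  then have "set_integrable lborel {0<..} (\<lambda>x::real. inverse (1 + x\<^sup>2))"
    by (rule set_integrable_subset) auto
  then show ?thesis by (simp add: inverse_eq_divide)
qed

lemma rapid_integrable:
  assumes g: "rapid g"
  shows "set_integrable lborel {0<..} g"
proof -
  obtain K where K: "\<And>y. y > 0 \<Longrightarrow> norm (g y) * (y ^ 2 + 1 / y ^ 2) \<le> K"
    using g by (meson rapid_def)
  have K0: "K \<ge> 0" using order_trans[OF _ K[of 1]] by simp
  have b: "norm (g y) \<le> 2 * K * (1 / (1 + y\<^sup>2))" if y: "y > 0" for y
  proof -
    have "1 + y\<^sup>2 \<le> 2 * (y ^ 2 + 1 / y ^ 2)"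
    proof -
      have lin: "1 + A \<le> 2 * (A + B)" if "1 \<le> A + B" "0 \<le> B" for A B :: real
        using that by argo
      show ?thesis
        by (rule lin) (use power_add_inverse_mono[of y 0 2] y in simp_all)
    qed
    then have "norm (g y) * (1 + y\<^sup>2) \<le> norm (g y) * (2 * (y ^ 2 + 1 / y ^ 2))"
      by (intro mult_left_mono) auto
    also have "\<dots> \<le> 2 * K" using K[OF y] by argo
    finally show ?thesis by (simp add: pos_le_divide_eq add_pos_nonneg)
  qed
  show ?thesis
  proof (rule set_integrable_bound)
    show "set_integrable lborel {0<..} (\<lambda>y::real. 2 * K * (1 / (1 + y\<^sup>2)))"
      by (intro set_integrable_mult_right integrable_inverse_square_half)
    show "set_borel_measurable lborel {0<..} g"
      using g by (intro set_borel_measurable_continuous_half) (auto simp: rapid_def)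
    show "AE y in lborel. y \<in> {0<..} \<longrightarrow> norm (g y) \<le> norm (2 * K * (1 / (1 + y\<^sup>2)))"
      using b K0 by (intro AE_I2) auto
  qed
qed

section \<open>\<open>Theta\<close> as an integral of its shadow\<close>

text \<open>The coefficients of \<open>(1 - s) powr (- 1/2)\<close>; the sign makes them positive.\<close>

definition binc :: "nat \<Rightarrow> real" where
  "binc n = (-1) ^ n * ((-1/2) gchoose n)"

lemma binc_Suc: "binc (Suc n) = binc n * ((real n + 1/2) / (real n + 1))"
proof -
  have "((-1/2::real) gchoose Suc n) = (-1/2 - real n) * ((-1/2) gchoose n) / real (Suc n)"
    using gbinomial_absorb_comp[of "-1/2::real" n] gbinomial_absorption[of n "-1/2::real"]
    by (simp add: field_simps)
  then have "binc (Suc n) = (-1) ^ Suc n * ((-1/2 - real n) * ((-1/2) gchoose n) / real (Suc n))"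
    by (simp only: binc_def)
  also have "\<dots> = binc n * ((real n + 1/2) / (real n + 1))"
    by (simp add: binc_def field_simps)
  finally show ?thesis .
qed

lemma binc_0 [simp]: "binc 0 = 1"
  by (simp add: binc_def)

lemma binc_pos: "binc n > 0"
  by (induction n) (auto simp: binc_Suc)

lemma binc_bounds: "0 \<le> binc n \<and> binc n \<le> 1"
proof (induction n)
  case (Suc n)
  have "0 \<le> (real n + 1/2) / (real n + 1)" "(real n + 1/2) / (real n + 1) \<le> 1" by simp_all
  with Suc show ?case
    unfolding binc_Suc by (intro conjI mult_nonneg_nonneg mult_le_one) simp_all
qed simp

lemma binc_sums_real:
  assumes "\<bar>s\<bar> < 1"
  shows "(\<lambda>n. binc n * s ^ n) sums (1 - s) powr (-1/2)"
proof -
  have "(\<lambda>n. ((-1/2) gchoose n) * (- s) ^ n) sums (1 + (- s)) powr (-1/2)"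
    using assms by (intro gen_binomial_real) auto
  moreover have "((-1/2) gchoose n) * (- s) ^ n = binc n * s ^ n" for n
    by (simp add: binc_def power_minus[of s] mult_ac)
  ultimately show ?thesis by simp
qed

lemma binc_remainder:
  assumes s: "0 \<le> s" "s \<le> 1/2"
  shows "\<bar>(1 - s) powr (-1/2) - (\<Sum>n<N. binc n * s ^ n)\<bar> \<le> 2 * s ^ N"
proof -
  have 1: "(\<lambda>n. binc n * s ^ n) sums (1 - s) powr (-1/2)"
    using s by (intro binc_sums_real) auto
  have 2: "(\<lambda>n. binc (n + N) * s ^ (n + N)) sums ((1 - s) powr (-1/2) - (\<Sum>n<N. binc n * s ^ n))"
    using sums_split_initial_segment[OF 1] .
  have 3: "(\<lambda>n. s ^ N * s ^ n) sums (s ^ N * (1 / (1 - s)))"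
    using s by (intro sums_mult geometric_sums) auto
  have le: "binc (n + N) * s ^ (n + N) \<le> s ^ N * s ^ n" for n
    using s binc_bounds[of "n + N"] mult_right_mono[of "binc (n + N)" 1 "s ^ (n + N)"] by (simp add: power_add mult_ac)
  have "(1 - s) powr (-1/2) - (\<Sum>n<N. binc n * s ^ n) \<le> s ^ N * (1 / (1 - s))"
    by (rule sums_le[OF le 2 3])
  also have "\<dots> \<le> s ^ N * 2" using s by (intro mult_left_mono) (auto simp: field_simps)
  finally have "(1 - s) powr (-1/2) - (\<Sum>n<N. binc n * s ^ n) \<le> 2 * s ^ N" by simp
  moreover have "0 \<le> (1 - s) powr (-1/2) - (\<Sum>n<N. binc n * s ^ n)"
  proof (rule sums_le[OF _ sums_zero 2])
    show "0 \<le> binc (n + N) * s ^ (n + N)" for n using s binc_bounds[of "n + N"] by simp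
  qed
  ultimately show ?thesis by simp
qed

text \<open>The error of the expansion of \<open>(y - t) powr (- 1/2)\<close> in powers of \<open>t / y\<close>, where the half power is continued by
  \<open>0\<close> to \<open>y \<le> t\<close>.\<close>

definition half_power_error :: "nat \<Rightarrow> real \<Rightarrow> real \<Rightarrow> real" where
  "half_power_error N t y = indicator {t<..} y * (y - t) powr (-1/2) - (\<Sum>n<N. binc n * y powr (-1/2) * (t / y) ^ n)"

text \<open>For \<open>y \<ge> 2 t\<close> the expansion converges geometrically. For \<open>y < 2 t\<close> every term of the polynomial is at most of the
  order of \<open>y powr (- 1/2) * (t / y) ^ N\<close>, and only the integrable singularity at \<open>y = t\<close> has to be kept.\<close>

lemma half_power_error_bound:
  assumes t: "t > 0" and y: "y > 0"
  shows "\<bar>half_power_error N t y\<bar> \<le> (2 + real N * 2 ^ N) * (y powr (-1/2) * (t / y) ^ N)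
     + indicator {t<..<2*t} y * (y - t) powr (-1/2)"
proof -
  define Y where "Y = y powr (-1/2)"
  have Y: "Y \<ge> 0" by (simp add: Y_def)
  have sumb: "\<bar>\<Sum>n<N. binc n * Y * (t / y) ^ n\<bar> \<le> real N * 2 ^ N * (Y * (t / y) ^ N)" if "y < 2 * t"
  proof -
    have "\<bar>\<Sum>n<N. binc n * Y * (t / y) ^ n\<bar> \<le> (\<Sum>n<N. \<bar>binc n * Y * (t / y) ^ n\<bar>)" by (rule sum_abs)
    also have "\<dots> \<le> (\<Sum>n<N. 2 ^ N * (Y * (t / y) ^ N))"
    proof (rule sum_mono)
      fix n assume n: "n \<in> {..<N}"
      have "\<bar>binc n * Y * (t / y) ^ n\<bar> = binc n * Y * (t / y) ^ n"
        using binc_bounds[of n] Y t y by simp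
      also have "\<dots> \<le> 1 * Y * (2 ^ N * (t / y) ^ N)"
      proof (intro mult_mono)
        have "(2 * (t / y)) ^ n \<le> (2 * (t / y)) ^ N"
          using that n y by (intro power_increasing) (auto simp: field_simps)
        moreover have "1 * (t / y) ^ n \<le> 2 ^ n * (t / y) ^ n" using t y by (intro mult_right_mono) auto
        ultimately show "(t / y) ^ n \<le> 2 ^ N * (t / y) ^ N" unfolding power_mult_distrib by linarith
      qed (use binc_bounds[of n] Y t y in auto)
      finally show "\<bar>binc n * Y * (t / y) ^ n\<bar> \<le> 2 ^ N * (Y * (t / y) ^ N)" by (simp add: mult_ac)
    qed
    finally show ?thesis by simp
  qed
  have nn: "0 \<le> Y * (t / y) ^ N" using Y t y by simp
  show ?thesis
  proof (cases "y < 2 * t")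
    case True
    have "\<bar>half_power_error N t y\<bar> \<le> indicator {t<..} y * (y - t) powr (-1/2) + \<bar>\<Sum>n<N. binc n * Y * (t / y) ^ n\<bar>"
      unfolding half_power_error_def Y_def[symmetric]
      using abs_triangle_ineq4[of "indicator {t<..} y * (y - t) powr (-1/2)" "\<Sum>n<N. binc n * Y * (t / y) ^ n"] by simp
    also have "indicator {t<..} y = (indicator {t<..<2*t} y :: real)" using True by (auto simp: indicator_def)
    finally show ?thesis using sumb[OF True] nn unfolding Y_def[symmetric] by (simp add: distrib_right)
  next
    case False
    define s where "s = t / y"
    have s: "0 \<le> s" "s \<le> 1/2" using False t y by (auto simp: s_def field_simps)
    have "y - t = y * (1 - s)" using y by (simp add: s_def right_diff_distrib)
    then have "(y - t) powr (-1/2) = (y * (1 - s)) powr (-1/2)" by (simp only:)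
    also have "\<dots> = Y * (1 - s) powr (-1/2)" using y s by (simp add: powr_mult Y_def)
    finally have "half_power_error N t y = Y * ((1 - s) powr (-1/2) - (\<Sum>n<N. binc n * s ^ n))"
      unfolding half_power_error_def Y_def[symmetric] s_def[symmetric] using False t
      by (simp add: right_diff_distrib sum_distrib_left mult_ac)
    then have "\<bar>half_power_error N t y\<bar> = Y * \<bar>(1 - s) powr (-1/2) - (\<Sum>n<N. binc n * s ^ n)\<bar>"
      using Y by (simp add: abs_mult)
    also have "\<dots> \<le> Y * (2 * s ^ N)" using Y s by (intro mult_left_mono binc_remainder) auto
    finally have "\<bar>half_power_error N t y\<bar> \<le> 2 * (Y * (t / y) ^ N)" by (simp add: s_def)
    also have "\<dots> \<le> (2 + real N * 2 ^ N) * (Y * (t / y) ^ N)"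
      using nn by (intro mult_right_mono) auto
    finally show ?thesis using False unfolding Y_def[symmetric] by simp
  qed
qed

text \<open>A Gamma integral at \<open>1/2\<close>.\<close>

lemma exp_powr_half_integral:
  fixes l t :: real
  assumes l: "l > 0"
  shows "has_bochner_integral lborel (\<lambda>y. indicator {t<..} y * (exp (- l * y) * (y - t) powr (-1/2))) (exp (- l * t) * sqrt (pi / l))"
proof -
  define f where "f = (\<lambda>u::real. indicator {0..} u * u powr (1/2 - 1) / exp u)"
  have nn: "(\<integral>\<^sup>+u. ennreal (f u) \<partial>lborel) = ennreal (Gamma (1/2))"
    using Gamma_conv_nn_integral_real[of "1/2"] by (simp add: f_def)
  have "has_bochner_integral lborel f (Gamma (1/2))"
    by (rule has_bochner_integral_nn_integral[OF _ _ _ nn]) (auto simp: f_def Gamma_one_half_real)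
  then have "has_bochner_integral lborel f (sqrt pi)" by (simp add: Gamma_one_half_real)
  then have 1: "has_bochner_integral lborel (\<lambda>y. f (- l * t + l * y)) (sqrt pi /\<^sub>R \<bar>l\<bar>)"
    using l lborel_has_bochner_integral_real_affine_iff[of l f "sqrt pi" "- l * t"] by simp
  have 2: "f (- l * t + l * y) * (l powr (1/2) * exp (- l * t)) = indicator {t<..} y * (exp (- l * y) * (y - t) powr (-1/2))" for y
  proof -
    consider "y < t" | "y = t" | "y > t" by linarith
    then show ?thesis
    proof cases
      case 1
      then have "- l * t + l * y < 0" using l by (simp add: algebra_simps mult_strict_left_mono)
      with 1 show ?thesis by (simp add: f_def)
    next
      case 2
      then show ?thesis by (simp add: f_def)
    next
      case 3
      have e: "- l * t + l * y = l * (y - t)" by (simp add: algebra_simps)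
      have "(l * (y - t)) powr (1/2 - 1) = l powr (-1/2) * (y - t) powr (-1/2)"
        using l 3 by (simp add: powr_mult)
      moreover have "l powr (-1/2) * l powr (1/2) = 1"
        using l by (simp add: powr_minus)
      moreover have "exp (- l * t) / exp (l * (y - t)) = exp (- l * y)"
        by (simp add: exp_diff[symmetric] algebra_simps)
      ultimately show ?thesis
        unfolding e f_def using l 3 by (simp add: field_simps)
    qed
  qed
  have v: "sqrt pi /\<^sub>R \<bar>l\<bar> * (l powr (1/2) * exp (- l * t)) = exp (- l * t) * sqrt (pi / l)"
    using l by (simp add: powr_half_sqrt real_sqrt_divide divide_simps)
  show ?thesis
    using has_bochner_integral_mult_left[OF 1, of "l powr (1/2) * exp (- l * t)"] unfolding 2 v by simp
qed

lemma even_has_sum_sums: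
  fixes f :: "int \<Rightarrow> complex"
  assumes f: "(f has_sum S) UNIV" and even: "\<And>n. f (- n) = f n" and 0: "f 0 = 0"
  shows "(\<lambda>n::nat. 2 * f (int n)) sums S"
proof -
  have s: "f summable_on UNIV" using f by (rule has_sum_imp_summable)
  obtain S1 where S1: "(f has_sum S1) (range int)"
    using summable_on_subset_banach[OF s, of "range int"] by (auto simp: summable_on_def)
  then have 1: "((\<lambda>n. f (int n)) has_sum S1) UNIV"
    by (subst (asm) has_sum_reindex) (auto simp: o_def)
  then have sums1: "(\<lambda>n. f (int n)) sums S1" by (rule has_sum_imp_sums)
  obtain S2 where S2: "(f has_sum S2) (range (\<lambda>n. - int (Suc n)))"
    using summable_on_subset_banach[OF s, of "range (\<lambda>n. - int (Suc n))"] by (auto simp: summable_on_def)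
  then have "((\<lambda>n. f (- int (Suc n))) has_sum S2) UNIV"
    by (subst (asm) has_sum_reindex) (auto simp: o_def inj_on_def)
  then have "(\<lambda>n. f (int (Suc n))) sums S2"
    unfolding even by (rule has_sum_imp_sums)
  then have "(\<lambda>n. f (int n)) sums S2"
    using sums_Suc_imp[of "\<lambda>n. f (int n)" S2] by (simp add: 0)
  with sums1 have "S1 = S2" by (rule sums_unique2)
  have "(f has_sum (S1 + S2)) (range int \<union> range (\<lambda>n. - int (Suc n)))"
    by (intro has_sum_Un_disjoint S1 S2) auto
  also have "range int \<union> range (\<lambda>n. - int (Suc n)) = UNIV"
  proof (rule UNIV_eq_I[symmetric])
    show "n \<in> range int \<union> range (\<lambda>n. - int (Suc n))" for n
      by (cases n rule: int_cases) auto
  qed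
  finally have "S1 + S2 = S" using f has_sum_unique by blast
  then have "S = 2 * S1" using \<open>S1 = S2\<close> by simp
  then show ?thesis using sums_mult[OF sums1, of 2] by simp
qed

lemma shadow_sums:
  assumes y: "y > 0"
  shows "(\<lambda>r::nat. 2 * of_nat r * psi (int r) * echar 1 (x * real r ^ 2 / 8) * of_real (exp (- (pi * real r ^ 2 / 4) * y))) sums shadow (Complex x y)"
proof -
  define f where "f = (\<lambda>r::int. of_int r * psi r * exp (of_real pi * \<i> * (Complex x y / 4) * of_int r ^ 2))"
  have "(f has_sum shadow (Complex x y)) UNIV"
    unfolding f_def shadow_def using y by (intro twisted_theta_has_sum[OF norm_psi_le]) auto
  then have "(\<lambda>n::nat. 2 * f (int n)) sums shadow (Complex x y)"
    by (rule even_has_sum_sums) (simp_all add: f_def psi_minus)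
  moreover have "2 * f (int r) = 2 * of_nat r * psi (int r) * echar 1 (x * real r ^ 2 / 8) * of_real (exp (- (pi * real r ^ 2 / 4) * y))" for r
  proof -
    have "exp (of_real pi * \<i> * (Complex x y / 4) * of_int (int r) ^ 2) = echar 1 (x * real r ^ 2 / 8) * of_real (exp (- (pi * real r ^ 2 / 4) * y))"
      unfolding echar_def exp_of_real[symmetric] exp_add[symmetric] Complex_eq
      by (rule arg_cong[where f = exp]) (simp add: field_simps)
    then show ?thesis by (simp add: f_def)
  qed
  ultimately show ?thesis by simp
qed

lemma Theta_sums:
  assumes t: "t > 0"
  shows "(\<lambda>r::nat. psi (int r) * echar 1 (x * real r ^ 2 / 8) * of_real (exp (- (pi * real r ^ 2 / 4) * t))) sums Theta (Complex x t)"
proof -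
  have "(\<lambda>r::nat. psi (int r) * exp (2 * of_real pi * \<i> * (2 * Complex x t) * of_nat r ^ 2 / 16)) sums Theta (Complex x t)"
    using Theta_eq_theta_psi[of "Complex x t"] theta_psi_sums[of "2 * Complex x t"] t by simp
  moreover have "exp (2 * of_real pi * \<i> * (2 * Complex x t) * of_nat r ^ 2 / 16) = echar 1 (x * real r ^ 2 / 8) * of_real (exp (- (pi * real r ^ 2 / 4) * t))" for r
    unfolding echar_def exp_of_real[symmetric] exp_add[symmetric] Complex_eq
    by (rule arg_cong[where f = exp]) (simp add: field_simps)
  ultimately show ?thesis by (simp add: mult_ac)
qed

text \<open>The half-integral turns a term of the shadow into the corresponding term of \<open>Theta\<close>: by \<open>exp_powr_half_integral\<close>
  with \<open>l = \<pi> r\<^sup>2 / 4\<close> it divides by \<open>r / 2\<close>, and the shadow has the factor \<open>2 r\<close>, the \<open>2\<close> coming from both signs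
  of \<open>r\<close>; hence the \<open>1/4\<close>.\<close>

lemma Theta_integral:
  assumes t: "t > 0"
  shows "set_integrable lborel {t<..} (\<lambda>y. shadow (Complex x y) * of_real ((y - t) powr (-1/2)))"
    and "Theta (Complex x t) = 1/4 * (LBINT y:{t<..}. shadow (Complex x y) * of_real ((y - t) powr (-1/2)))"
proof -
  define a where "a = (\<lambda>r::nat. 2 * of_nat r * psi (int r) * echar 1 (x * real r ^ 2 / 8))"
  define l where "l = (\<lambda>r::nat. pi * real r ^ 2 / 4)"
  define h where "h = (\<lambda>r y. indicator {t<..} y * (exp (- l r * y) * (y - t) powr (-1/2)))"
  define f where "f = (\<lambda>r y. a r * complex_of_real (h r y))"
  have na: "norm (a r) \<le> 2 * real r" for r
    using norm_psi_le[of "int r"] by (auto simp: a_def norm_mult intro: mult_left_le)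
  have int: "has_bochner_integral lborel (f r) (4 * (psi (int r) * echar 1 (x * real r ^ 2 / 8) * of_real (exp (- (pi * real r ^ 2 / 4) * t))))" for r
  proof (cases "r = 0")
    case True
    then show ?thesis by (simp add: f_def a_def psi_def has_bochner_integral_zero)
  next
    case False
    then have "l r > 0" by (simp add: l_def)
    have "has_bochner_integral lborel (f r) (a r * of_real (exp (- l r * t) * sqrt (pi / l r)))"
      unfolding f_def h_def
      by (intro has_bochner_integral_mult_right has_bochner_integral_of_real exp_powr_half_integral \<open>l r > 0\<close>)
    moreover have "sqrt (pi / l r) = 2 / real r"
    proof -
      have "pi / l r = (2 / real r)\<^sup>2" using False by (simp add: l_def power_divide field_simps)
      then show ?thesis by simp
    qed
    moreover have "a r * of_real (exp (- l r * t) * (2 / real r)) = 4 * (psi (int r) * echar 1 (x * real r ^ 2 / 8) * of_real (exp (- (pi * real r ^ 2 / 4) * t)))"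
      using False by (simp add: a_def l_def)
    ultimately show ?thesis by simp
  qed
  have integrable: "integrable lborel (f r)" for r using int[of r] by (simp add: has_bochner_integral_iff)
  have norm_int: "(LINT y|lborel. norm (f r y)) \<le> 4 * (real r ^ 0 * exp (- (pi * t / 4) * real r ^ 2))" for r
  proof (cases "r = 0")
    case True
    then show ?thesis by (simp add: f_def a_def)
  next
    case False
    then have lr: "l r > 0" by (simp add: l_def)
    have "norm (f r y) = norm (a r) * h r y" for y
      by (simp add: f_def h_def norm_mult)
    then have "(LINT y|lborel. norm (f r y)) = norm (a r) * (exp (- l r * t) * sqrt (pi / l r))"
      using exp_powr_half_integral[OF lr, of t] by (simp add: h_def has_bochner_integral_integral_eq)
    also have "sqrt (pi / l r) = 2 / real r"
    proof -
      have "pi / l r = (2 / real r)\<^sup>2" using False by (simp add: l_def power_divide field_simps)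
      then show ?thesis by simp
    qed
    also have "norm (a r) * (exp (- l r * t) * (2 / real r)) \<le> 2 * real r * (exp (- l r * t) * (2 / real r))"
      by (intro mult_right_mono na) auto
    also have "\<dots> = 4 * (real r ^ 0 * exp (- (pi * t / 4) * real r ^ 2))"
      using False by (simp add: l_def mult_ac)
    finally show ?thesis .
  qed
  have sum_int: "summable (\<lambda>r. LINT y|lborel. norm (f r y))"
  proof (rule summable_comparison_test'[of _ 0])
    show "summable (\<lambda>r::nat. 4 * (real r ^ 0 * exp (- (pi * t / 4) * real r ^ 2)))"
      using t by (intro summable_mult summable_power_gauss) auto
  qed (use norm_int in auto)
  have sum_pt: "summable (\<lambda>r. norm (f r y))" for y
  proof (cases "y > t")
    case True
    show ?thesis
    proof (rule summable_comparison_test'[of _ 0])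
      show "summable (\<lambda>r::nat. 2 * (y - t) powr (-1/2) * (real r ^ 1 * exp (- (pi * y / 4) * real r ^ 2)))"
        using t True by (intro summable_mult summable_power_gauss) auto
      show "norm (norm (f r y)) \<le> 2 * (y - t) powr (-1/2) * (real r ^ 1 * exp (- (pi * y / 4) * real r ^ 2))" for r
        using mult_right_mono[OF na[of r], of "exp (- (pi * y / 4) * real r ^ 2) * (y - t) powr (-1/2)"] True
        by (simp add: f_def h_def norm_mult l_def mult_ac)
    qed
  next
    case False
    then have "f r y = 0" for r by (simp add: f_def h_def)
    then show ?thesis by simp
  qed
  have F: "(\<Sum>r. f r y) = indicator {t<..} y *\<^sub>R (shadow (Complex x y) * of_real ((y - t) powr (-1/2)))" for y
  proof (cases "y > t")
    case True
    have "(\<lambda>r. a r * of_real (exp (- l r * y)) * of_real ((y - t) powr (-1/2))) sums (shadow (Complex x y) * of_real ((y - t) powr (-1/2)))"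
      unfolding a_def l_def using True t by (intro sums_mult2 shadow_sums) auto
    moreover have "f r y = a r * of_real (exp (- l r * y)) * of_real ((y - t) powr (-1/2))" for r
      using True by (simp add: f_def h_def)
    ultimately show ?thesis using True by (simp add: sums_iff)
  next
    case False
    then have "f r y = 0" for r by (simp add: f_def h_def)
    then show ?thesis using False by simp
  qed
  have AE: "AE y in lborel. summable (\<lambda>r. norm (f r y))" using sum_pt by auto
  show "set_integrable lborel {t<..} (\<lambda>y. shadow (Complex x y) * of_real ((y - t) powr (-1/2)))"
    unfolding set_integrable_def F[symmetric] by (rule integrable_suminf[OF integrable AE sum_int])
  have "(\<lambda>r. integral\<^sup>L lborel (f r)) sums (LINT y|lborel. (\<Sum>r. f r y))"
    by (rule sums_integral[OF integrable AE sum_int])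
  moreover have "(\<lambda>r. integral\<^sup>L lborel (f r)) sums (4 * Theta (Complex x t))"
    unfolding has_bochner_integral_integral_eq[OF int] by (rule sums_mult[OF Theta_sums[OF t]])
  ultimately have "4 * Theta (Complex x t) = (LINT y|lborel. (\<Sum>r. f r y))"
    using sums_unique2 by blast
  then show "Theta (Complex x t) = 1/4 * (LBINT y:{t<..}. shadow (Complex x y) * of_real ((y - t) powr (-1/2)))"
    unfolding F set_lebesgue_integral_def by (simp add: field_simps)
qed

section \<open>Radial expansions of \<open>Theta\<close>\<close>

text \<open>The coefficient of \<open>X ^ n\<close> in \<open>(u - X) powr (- 1/2)\<close>.\<close>

definition ker :: "nat \<Rightarrow> complex \<Rightarrow> complex" where
  "ker n u = of_real (binc n) * u powr (-1/2) * (1 / u) ^ n"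

text \<open>The constant \<open>1 / (2 * csqrt (8 * \<i>))\<close> of \<open>r_psi\<close>, times the factor \<open>sqrt 2\<close> that results from the rescaling
  \<open>w \<mapsto> 2 * w\<close> (\<open>r_psi_scaled\<close>).\<close>

definition C0 :: complex where
  "C0 = 1 / (4 * csqrt \<i>)"

text \<open>Up to the factor \<open>C0\<close>, the integral of \<open>shadow w * ker n (w - x)\<close> over the vertical line from \<open>x\<close> to \<open>i\<infinity>\<close>.\<close>

definition theta_coeff :: "real \<Rightarrow> nat \<Rightarrow> complex" where
  "theta_coeff x n = C0 * (LBINT y:{0<..}. shadow (Complex x y) * ker n (\<i> * of_real y) * \<i>)"

lemma norm_ker:
  assumes "u \<noteq> 0"
  shows "norm (ker n u) = binc n * (norm u powr (-1/2) * (1 / norm u) ^ n)"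
proof -
  have "norm (u powr (-1/2)) = norm u powr (-1/2)"
    by (subst norm_powr_real_powr') auto
  then show ?thesis using binc_bounds[of n] by (simp add: ker_def norm_mult norm_power norm_divide)
qed

lemma norm_ker_le:
  assumes "y > 0" "norm u \<ge> y"
  shows "norm (ker n u) \<le> y ^ (n + 1) + 1 / y ^ (n + 1)"
proof -
  have u: "u \<noteq> 0" using assms by auto
  have "norm (ker n u) \<le> 1 * (y powr (-1/2) * (1 / y) ^ n)"
    unfolding norm_ker[OF u] using assms binc_bounds[of n]
    by (intro mult_mono powr_mono2' power_mono frac_le mult_nonneg_nonneg) auto
  also have "y powr (-1/2) \<le> max 1 (1 / y)"
  proof (cases "y \<ge> 1")
    case True
    then have "y powr (-1/2) \<le> 1" using powr_mono[of "-1/2" 0 y] by simp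
    then show ?thesis by simp
  next
    case False
    then have "y powr (-1/2) \<le> y powr (-1)" using assms by (intro powr_mono') auto
    also have "\<dots> = 1 / y" using assms by (simp add: powr_minus_divide)
    finally show ?thesis by simp
  qed
  finally have 1: "norm (ker n u) \<le> max 1 (1 / y) * (1 / y) ^ n"
    using assms by (auto intro: mult_right_mono)
  also have "\<dots> \<le> y ^ (n + 1) + 1 / y ^ (n + 1)"
  proof (cases "y \<ge> 1")
    case True
    then have "(1 / y) ^ n \<le> 1" "y ^ (n + 1) \<ge> 1"
      using assms by (auto intro: power_le_one) (metis one_le_power power_Suc)
    moreover have "max 1 (1 / y) = 1" using True by simp
    moreover have "1 / y ^ (n + 1) \<ge> 0" using assms by simp
    ultimately show ?thesis by (simp only: mult_1)
  next
    case False
    then have "max 1 (1 / y) = 1 / y" using assms by simp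
    then have "max 1 (1 / y) * (1 / y) ^ n = 1 / y ^ (n + 1)" by (simp add: power_divide)
    then show ?thesis using assms by simp
  qed
  finally show ?thesis .
qed

lemma continuous_on_ker:
  assumes "continuous_on A f" "\<And>y. y \<in> A \<Longrightarrow> Im (f y) > 0"
  shows "continuous_on A (\<lambda>y. ker n (f y))"
proof -
  have "f y \<notin> \<real>\<^sub>\<le>\<^sub>0" "f y \<noteq> 0" if "y \<in> A" for y
    using assms(2)[OF that] by (auto simp: complex_nonpos_Reals_iff)
  then show ?thesis
    unfolding ker_def by (intro continuous_intros continuous_on_powr_complex assms(1)) (auto dest: assms(2))
qed

lemma moderate_ker:
  assumes "continuous_on {0<..} f" "\<And>y. y > 0 \<Longrightarrow> Im (f y) \<ge> y"
  shows "moderate (\<lambda>y. ker n (f y))"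
  unfolding moderate_def
proof
  show "continuous_on {0<..} (\<lambda>y. ker n (f y))"
    using assms(2) by (intro continuous_on_ker assms(1)) (auto intro: less_le_trans)
  have "norm (ker n (f y)) \<le> 1 * (y ^ (n + 1) + 1 / y ^ (n + 1))" if "y > 0" for y
    using norm_ker_le[OF that, of "f y" n] assms(2)[OF that] abs_Im_le_cmod[of "f y"] by simp
  then show "\<exists>C m. \<forall>y>0. norm (ker n (f y)) \<le> C * (y ^ m + 1 / y ^ m)" by blast
qed

lemma moderate_const_mult:
  assumes "moderate k"
  shows "moderate (\<lambda>y. k y * c)"
proof -
  obtain C m where "\<And>y. y > 0 \<Longrightarrow> norm (k y) \<le> C * (y ^ m + 1 / y ^ m)"
    using assms by (auto simp: moderate_def)
  then have "norm (k y * c) \<le> (norm c * C) * (y ^ m + 1 / y ^ m)" if "y > 0" for y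
    using mult_right_mono[of "norm (k y)" "C * (y ^ m + 1 / y ^ m)" "norm c"] that by (simp add: norm_mult mult_ac)
  then show ?thesis using assms by (auto simp: moderate_def intro!: continuous_intros)
qed

lemma shadow_ker_integrable:
  assumes x: "x \<in> \<rat>" and f: "continuous_on {0<..} f" "\<And>y. y > 0 \<Longrightarrow> Im (f y) \<ge> y"
  shows "set_integrable lborel {0<..} (\<lambda>y. shadow (Complex x y) * ker n (f y) * c)"
  unfolding mult.assoc
  by (intro rapid_integrable rapid_mult shadow_rapid x moderate_const_mult moderate_ker f)

text \<open>On the vertical line above \<open>x\<close> the constant \<open>C0\<close> and the powers of \<open>\<i>\<close> combine to the real factor \<open>1/4\<close> of
  \<open>Theta_integral\<close>.\<close>

lemma ker_imaginary:
  assumes y: "y > 0"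
  shows "C0 * (ker n (\<i> * of_real y) * \<i>) * (\<i> * of_real t) ^ n = of_real (1/4 * (binc n * y powr (-1/2) * (t / y) ^ n))"
proof -
  have pw: "(\<i> * of_real y) powr (-1/2) = of_real (y powr (-1/2)) * \<i> powr (-1/2)"
  proof -
    have "(of_real y * \<i>) powr (-1/2) = of_real y powr (-1/2) * \<i> powr (-1/2)"
      using y by (intro powr_times_real_left) auto
    also have "complex_of_real y powr (-1/2) = of_real (y powr (-1/2))"
      using y powr_of_real[of y "-1/2"] by simp
    finally show ?thesis by (simp add: mult.commute)
  qed
  have tq: "(1 / (\<i> * of_real y)) ^ n * (\<i> * of_real t) ^ n = of_real ((t / y) ^ n)"
    unfolding power_mult_distrib[symmetric] of_real_power by simp
  define s where "s = csqrt \<i>"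
  have s: "s \<noteq> 0" "s * s = \<i>"
    unfolding s_def by (metis csqrt_eq_0 complex_i_not_zero) (metis power2_csqrt power2_eq_square)
  have sp: "\<i> powr (-1/2) = 1 / s"
    unfolding s_def by (simp add: csqrt_conv_powr powr_minus_divide del: csqrt_ii)
  have "C0 * (ker n (\<i> * of_real y) * \<i>) * (\<i> * of_real t) ^ n
     = C0 * (of_real (binc n) * (\<i> * of_real y) powr (-1/2) * \<i>) * ((1 / (\<i> * of_real y)) ^ n * (\<i> * of_real t) ^ n)"
    by (simp only: ker_def mult_ac)
  also have "\<dots> = (1 / (4 * s)) * (of_real (binc n) * (of_real (y powr (-1/2)) * (1 / s)) * \<i>) * of_real ((t / y) ^ n)"
    unfolding pw tq sp C0_def s_def[symmetric] ..
  also have "\<dots> = of_real (binc n) * of_real (y powr (-1/2)) * of_real ((t / y) ^ n) / 4 * (\<i> / (s * s))"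
    by (simp add: mult_ac)
  also have "\<i> / (s * s) = 1" unfolding s(2) by simp
  finally show ?thesis by simp
qed

lemma set_integral_finite_sum:
  fixes f :: "nat \<Rightarrow> real \<Rightarrow> complex"
  assumes "\<And>n. set_integrable lborel A (f n)"
  shows "set_integrable lborel A (\<lambda>y. \<Sum>n<N. f n y)"
    and "(LBINT y:A. (\<Sum>n<N. f n y)) = (\<Sum>n<N. LBINT y:A. f n y)"
proof -
  have i: "integrable lborel (\<lambda>y. indicator A y *\<^sub>R f n y)" for n
    using assms[of n] by (simp only: set_integrable_def)
  show "set_integrable lborel A (\<lambda>y. \<Sum>n<N. f n y)"
    unfolding set_integrable_def scaleR_sum_right by (intro Bochner_Integration.integrable_sum i)
  show "(LBINT y:A. (\<Sum>n<N. f n y)) = (\<Sum>n<N. LBINT y:A. f n y)"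
    unfolding set_lebesgue_integral_def scaleR_sum_right by (intro Bochner_Integration.integral_sum i)
qed

lemma theta_coeff_power:
  assumes x: "x \<in> \<rat>"
  shows "set_integrable lborel {0<..} (\<lambda>y. shadow (Complex x y) * of_real (binc n * y powr (-1/2) * (t / y) ^ n))" (is ?I)
    and "theta_coeff x n * (\<i> * of_real t) ^ n = 1/4 * (LBINT y:{0<..}. shadow (Complex x y) * of_real (binc n * y powr (-1/2) * (t / y) ^ n))" (is ?E)
proof -
  define K where "K = C0 * (\<i> * of_real t) ^ n"
  have eq: "shadow (Complex x y) * ker n (\<i> * of_real y) * (\<i> * (4 * K)) = shadow (Complex x y) * of_real (binc n * y powr (-1/2) * (t / y) ^ n)"
    if "y \<in> {0<..}" for y
    using ker_imaginary[of y n t] that by (simp add: K_def mult_ac)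
  have i: "set_integrable lborel {0<..} (\<lambda>y. shadow (Complex x y) * ker n (\<i> * of_real y) * c)" for c
    by (intro shadow_ker_integrable x continuous_intros) auto
  have "set_integrable lborel {0<..} (\<lambda>y. shadow (Complex x y) * ker n (\<i> * of_real y) * (\<i> * (4 * K))) = ?I"
    by (rule set_integrable_cong[OF refl refl eq])
  with i[of "\<i> * (4 * K)"] show ?I by simp
  have "theta_coeff x n * (\<i> * of_real t) ^ n = 1/4 * ((LBINT y:{0<..}. shadow (Complex x y) * ker n (\<i> * of_real y) * \<i>) * (4 * K))"
    by (simp add: theta_coeff_def K_def mult_ac)
  also have "(LBINT y:{0<..}. shadow (Complex x y) * ker n (\<i> * of_real y) * \<i>) * (4 * K)
     = (LBINT y:{0<..}. shadow (Complex x y) * ker n (\<i> * of_real y) * \<i> * (4 * K))"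
    by (rule set_integral_mult_left[symmetric])
  also have "\<dots> = (LBINT y:{0<..}. shadow (Complex x y) * of_real (binc n * y powr (-1/2) * (t / y) ^ n))"
    by (rule set_lebesgue_integral_cong) (auto simp: eq[unfolded mult.assoc] mult.assoc)
  finally show ?E .
qed

text \<open>The difference is the integral of the shadow against \<open>half_power_error\<close>. On \<open>t < y < 2 t\<close> the rapid decay of the shadow
  supplies the factor \<open>t ^ N\<close>; elsewhere it is explicit in the error bound.\<close>

lemma Theta_expansion_error:
  assumes x: "x \<in> \<rat>"
  obtains B where "\<And>t. 0 < t \<Longrightarrow> t \<le> 1 \<Longrightarrow>
    norm (Theta (Complex x t) - (\<Sum>n<N. theta_coeff x n * (\<i> * of_real t) ^ n)) \<le> B * t ^ N"
proof -
  define g where "g = (\<lambda>y. shadow (Complex x y))"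
  have gr: "rapid g" unfolding g_def by (rule shadow_rapid[OF x])
  obtain G where G: "\<And>y. y > 0 \<Longrightarrow> norm (g y) * (y ^ N + 1 / y ^ N) \<le> G"
    using gr by (meson rapid_def)
  have G': "norm (g y) \<le> G * y ^ N" if "y > 0" for y
  proof -
    have "norm (g y) * (1 / y ^ N) \<le> norm (g y) * (y ^ N + 1 / y ^ N)"
      using that by (intro mult_left_mono) auto
    then have "norm (g y) * (1 / y ^ N) \<le> G" using G[OF that] by simp
    then show ?thesis using that by (simp add: field_simps)
  qed
  have G0: "G \<ge> 0" using order_trans[OF norm_ge_zero G'[of 1]] by simp
  define Kd where "Kd = 2 + real N * 2 ^ N"
  define I1 where "I1 = (LBINT y:{0<..}. norm (g y * of_real (y powr (-1/2) * (1 / y) ^ N)))"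
  have int1: "set_integrable lborel {0<..} (\<lambda>y. norm (g y * of_real (y powr (-1/2) * (1 / y) ^ N)))"
  proof -
    have "moderate (\<lambda>y. complex_of_real (y powr (-1/2) * (1 / y) ^ N))"
      unfolding moderate_def
    proof
      show "continuous_on {0<..} (\<lambda>y. complex_of_real (y powr (-1/2) * (1 / y) ^ N))"
        by (intro continuous_intros) auto
      have "norm (complex_of_real (y powr (-1/2) * (1 / y) ^ N)) \<le> 1 / binc N * (y ^ (N + 1) + 1 / y ^ (N + 1))" if y: "y > 0" for y
      proof -
        have "binc N > 0" by (rule binc_pos)
        moreover have "norm (ker N (\<i> * of_real y)) \<le> y ^ (N + 1) + 1 / y ^ (N + 1)"
          using y by (intro norm_ker_le) (auto simp: norm_mult)
        moreover have "norm (ker N (\<i> * of_real y)) = binc N * norm (complex_of_real (y powr (-1/2) * (1 / y) ^ N))"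
          using y by (subst norm_ker) (auto simp: norm_mult norm_power norm_divide)
        ultimately show ?thesis by (simp add: field_simps)
      qed
      then show "\<exists>C m. \<forall>y>0. norm (complex_of_real (y powr (-1/2) * (1 / y) ^ N)) \<le> C * (y ^ m + 1 / y ^ m)" by blast
    qed
    then show ?thesis by (intro set_integrable_norm rapid_integrable rapid_mult gr)
  qed
  define E where "E = exp 2 * sqrt pi"
  define B where "B = 1/4 * (Kd * I1 + G * 2 ^ N * E)"
  have "norm (Theta (Complex x t) - (\<Sum>n<N. theta_coeff x n * (\<i> * of_real t) ^ n)) \<le> B * t ^ N"
    if t: "0 < t" "t \<le> 1" for t
  proof -
    define F where "F = (\<lambda>y. g y * of_real (indicator {t<..} y * (y - t) powr (-1/2)))"
    define H where "H = (\<lambda>n y. g y * of_real (binc n * y powr (-1/2) * (t / y) ^ n))"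
    have indF: "indicator {0<..} y *\<^sub>R F y = indicator {t<..} y *\<^sub>R (shadow (Complex x y) * of_real ((y - t) powr (-1/2)))" for y
      using t by (auto simp: F_def g_def indicator_def)
    have F: "set_integrable lborel {0<..} F" "Theta (Complex x t) = 1/4 * (LBINT y:{0<..}. F y)"
      using Theta_integral[OF t(1), of x] unfolding set_integrable_def set_lebesgue_integral_def indF by auto
    have H: "set_integrable lborel {0<..} (H n)" "theta_coeff x n * (\<i> * of_real t) ^ n = 1/4 * (LBINT y:{0<..}. H n y)" for n
      using theta_coeff_power[OF x, of n t] by (simp_all add: H_def g_def)
    have Hs: "set_integrable lborel {0<..} (\<lambda>y. \<Sum>n<N. H n y)"
      by (rule set_integral_finite_sum(1)[OF H(1)])
    have "(\<Sum>n<N. theta_coeff x n * (\<i> * of_real t) ^ n) = 1/4 * (\<Sum>n<N. LBINT y:{0<..}. H n y)"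
      by (simp add: H(2) sum_distrib_left)
    also have "(\<Sum>n<N. LBINT y:{0<..}. H n y) = (LBINT y:{0<..}. (\<Sum>n<N. H n y))"
      by (rule set_integral_finite_sum(2)[OF H(1), symmetric])
    finally have "Theta (Complex x t) - (\<Sum>n<N. theta_coeff x n * (\<i> * of_real t) ^ n)
       = 1/4 * ((LBINT y:{0<..}. F y) - (LBINT y:{0<..}. (\<Sum>n<N. H n y)))"
      by (simp add: F(2))
    also have "(LBINT y:{0<..}. F y) - (LBINT y:{0<..}. (\<Sum>n<N. H n y)) = (LBINT y:{0<..}. F y - (\<Sum>n<N. H n y))"
      by (rule set_integral_diff(2)[symmetric]) (rule F(1) Hs)+
    finally have X: "Theta (Complex x t) - (\<Sum>n<N. theta_coeff x n * (\<i> * of_real t) ^ n)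
       = 1/4 * (LBINT y:{0<..}. F y - (\<Sum>n<N. H n y))" .
    have "norm (Theta (Complex x t) - (\<Sum>n<N. theta_coeff x n * (\<i> * of_real t) ^ n))
       = 1/4 * norm (LBINT y:{0<..}. F y - (\<Sum>n<N. H n y))"
      unfolding X norm_mult by simp
    also have "\<dots> \<le> 1/4 * (LBINT y:{0<..}. norm (F y - (\<Sum>n<N. H n y)))"
      using F(1) Hs by (intro mult_left_mono set_integral_norm_bound set_integral_diff) auto
    also have "(LBINT y:{0<..}. norm (F y - (\<Sum>n<N. H n y)))
       \<le> (LBINT y:{0<..}. t ^ N * Kd * norm (g y * of_real (y powr (-1/2) * (1 / y) ^ N))
            + G * 2 ^ N * t ^ N * exp 2 * (indicator {t<..} y * (exp (- 1 * y) * (y - t) powr (-1/2))))"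
    proof (rule set_integral_mono)
      show "set_integrable lborel {0<..} (\<lambda>y. norm (F y - (\<Sum>n<N. H n y)))"
        using F(1) Hs by (intro set_integrable_norm set_integral_diff) auto
      have "set_integrable lborel {0<..} (\<lambda>y. indicator {t<..} y * (exp (- 1 * y) * (y - t) powr (-1/2)))"
        by (rule set_integrable_subset[of _ UNIV])
           (use exp_powr_half_integral[of 1 t] in \<open>auto simp: set_integrable_def has_bochner_integral_iff\<close>)
      then show "set_integrable lborel {0<..} (\<lambda>y. t ^ N * Kd * norm (g y * of_real (y powr (-1/2) * (1 / y) ^ N))
            + G * 2 ^ N * t ^ N * exp 2 * (indicator {t<..} y * (exp (- 1 * y) * (y - t) powr (-1/2))))"
        by (intro set_integral_add set_integrable_mult_right int1)
    next
      fix y :: real assume "y \<in> {0<..}"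
      then have y: "y > 0" by simp
      have "F y - (\<Sum>n<N. H n y) = g y * of_real (half_power_error N t y)"
        by (simp add: F_def H_def half_power_error_def right_diff_distrib sum_distrib_left)
      then have "norm (F y - (\<Sum>n<N. H n y)) = norm (g y) * \<bar>half_power_error N t y\<bar>" by (simp add: norm_mult)
      also have "\<dots> \<le> norm (g y) * (Kd * (y powr (-1/2) * (t / y) ^ N) + indicator {t<..<2*t} y * (y - t) powr (-1/2))"
        unfolding Kd_def using t y by (intro mult_left_mono half_power_error_bound) auto
      also have "\<dots> = t ^ N * Kd * norm (g y * of_real (y powr (-1/2) * (1 / y) ^ N))
          + norm (g y) * (indicator {t<..<2*t} y * (y - t) powr (-1/2))"
        using y by (simp add: distrib_left norm_mult power_divide norm_power norm_divide)
      also have "norm (g y) * (indicator {t<..<2*t} y * (y - t) powr (-1/2))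
         \<le> G * 2 ^ N * t ^ N * exp 2 * (indicator {t<..} y * (exp (- 1 * y) * (y - t) powr (-1/2)))"
      proof (cases "t < y \<and> y < 2 * t")
        case True
        have "norm (g y) \<le> G * y ^ N" by (rule G'[OF y])
        also have "\<dots> \<le> G * (2 * t) ^ N" using True y G0 by (intro mult_left_mono power_mono) auto
        finally have a: "norm (g y) \<le> G * 2 ^ N * t ^ N" by (simp add: power_mult_distrib)
        \<comment> \<open>here \<open>y < 2 * t \<le> 2\<close>, so an exponential may be inserted to make a Gamma integral\<close>
        have b: "1 \<le> exp 2 * exp (- 1 * y)"
          using True t by (simp add: exp_add[symmetric])
        have "norm (g y) * 1 \<le> G * 2 ^ N * t ^ N * (exp 2 * exp (- 1 * y))"
          using a b by (intro mult_mono) (use G0 t in auto)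
        then have "norm (g y) * 1 * (y - t) powr (-1/2) \<le> G * 2 ^ N * t ^ N * (exp 2 * exp (- 1 * y)) * (y - t) powr (-1/2)"
          by (intro mult_right_mono) auto
        then show ?thesis using True by (simp add: mult_ac)
      next
        case False
        then have "indicator {t<..<2*t} y = (0::real)" by auto
        then show ?thesis using G0 t by simp
      qed
      finally show "norm (F y - (\<Sum>n<N. H n y)) \<le> t ^ N * Kd * norm (g y * of_real (y powr (-1/2) * (1 / y) ^ N))
            + G * 2 ^ N * t ^ N * exp 2 * (indicator {t<..} y * (exp (- 1 * y) * (y - t) powr (-1/2)))" by simp
    qed
    also have "\<dots> = t ^ N * Kd * I1 + G * 2 ^ N * t ^ N * exp 2 * (LBINT y:{0<..}. indicator {t<..} y * (exp (- 1 * y) * (y - t) powr (-1/2)))"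
    proof -
      have s: "set_integrable lborel {0<..} (\<lambda>y. indicator {t<..} y * (exp (- 1 * y) * (y - t) powr (-1/2)))"
        by (rule set_integrable_subset[of _ UNIV])
           (use exp_powr_half_integral[of 1 t] in \<open>auto simp: set_integrable_def has_bochner_integral_iff\<close>)
      have a: "set_integrable lborel {0<..} (\<lambda>y. t ^ N * Kd * norm (g y * of_real (y powr (-1/2) * (1 / y) ^ N)))"
        by (intro set_integrable_mult_right int1)
      have b: "set_integrable lborel {0<..} (\<lambda>y. G * 2 ^ N * t ^ N * exp 2 * (indicator {t<..} y * (exp (- 1 * y) * (y - t) powr (-1/2))))"
        by (intro set_integrable_mult_right s)
      show ?thesis
        unfolding I1_def set_integral_add(2)[OF a b] set_integral_mult_right ..
    qed
    also have "(LBINT y:{0<..}. indicator {t<..} y * (exp (- 1 * y) * (y - t) powr (-1/2))) \<le> sqrt pi"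
    proof -
      have "(LBINT y:{0<..}. indicator {t<..} y * (exp (- 1 * y) * (y - t) powr (-1/2)))
         = (LINT y|lborel. indicator {t<..} y * (exp (- 1 * y) * (y - t) powr (-1/2)))"
        unfolding set_lebesgue_integral_def by (rule Bochner_Integration.integral_cong) (use t in \<open>auto simp: indicator_def\<close>)
      also have "\<dots> = exp (- t) * sqrt pi"
        using exp_powr_half_integral[of 1 t] by (simp add: has_bochner_integral_integral_eq)
      also have "\<dots> \<le> 1 * sqrt pi" using t by (intro mult_right_mono) auto
      finally show ?thesis by simp
    qed
    finally have "norm (Theta (Complex x t) - (\<Sum>n<N. theta_coeff x n * (\<i> * of_real t) ^ n))
      \<le> 1/4 * (t ^ N * Kd * I1 + G * 2 ^ N * t ^ N * exp 2 * sqrt pi)"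
      using G0 t by (simp add: mult_left_mono)
    also have "\<dots> = B * t ^ N" by (simp add: B_def E_def algebra_simps)
    finally show ?thesis .
  qed
  then show ?thesis using that by blast
qed

theorem Theta_radial_expansion:
  assumes x: "x \<in> \<rat>"
  shows "radial_expansion Theta x (Abs_fps (theta_coeff x))"
  unfolding radial_expansion_def
proof
  fix N
  obtain B where B: "\<And>t. 0 < t \<Longrightarrow> t \<le> 1 \<Longrightarrow>
    norm (Theta (Complex x t) - (\<Sum>n<N. theta_coeff x n * (\<i> * of_real t) ^ n)) \<le> B * t ^ N"
    using Theta_expansion_error[OF x, of N] by blast
  have "eventually (\<lambda>t::real. t \<in> {0<..<1}) (at_right 0)"
    by (rule eventually_at_right_real) simp
  then show "(\<lambda>t::real. Theta (Complex x t) - (\<Sum>n<N. fps_nth (Abs_fps (theta_coeff x)) n * (\<i> * of_real t) ^ n))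
      \<in> O[at_right 0](\<lambda>t. of_real (t ^ N))"
    by (intro bigoI[of _ B]) (auto elim!: eventually_mono simp: norm_power intro!: B[simplified])
qed

theorem radial_value_Theta:
  assumes x: "x \<in> \<rat>"
  shows "((\<lambda>t. Theta (Complex x t)) \<longlongrightarrow> theta_coeff x 0) (at_right 0)"
    and "radial_value Theta x = theta_coeff x 0"
proof -
  obtain B where B: "\<And>t. 0 < t \<Longrightarrow> t \<le> 1 \<Longrightarrow>
    norm (Theta (Complex x t) - (\<Sum>n<1. theta_coeff x n * (\<i> * of_real t) ^ n)) \<le> B * t ^ 1"
    using Theta_expansion_error[OF x, of 1] by blast
  have ev: "eventually (\<lambda>t::real. t \<in> {0<..<1}) (at_right 0)"
    by (rule eventually_at_right_real) simp
  have "((\<lambda>t. Theta (Complex x t) - theta_coeff x 0) \<longlongrightarrow> 0) (at_right 0)"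
  proof (rule Lim_null_comparison)
    show "eventually (\<lambda>t. norm (Theta (Complex x t) - theta_coeff x 0) \<le> B * t) (at_right 0)"
      using ev by eventually_elim (use B in auto)
    have "((\<lambda>t. B * t) \<longlongrightarrow> B * 0) (at_right 0)" by (intro tendsto_intros)
    then show "((\<lambda>t. B * t) \<longlongrightarrow> 0) (at_right 0)" by simp
  qed
  then show lim: "((\<lambda>t. Theta (Complex x t)) \<longlongrightarrow> theta_coeff x 0) (at_right 0)"
    by (rule LIM_zero_cancel)
  then show "radial_value Theta x = theta_coeff x 0"
    unfolding radial_value_def by (intro tendsto_Lim) auto
qed

section \<open>Cauchy's theorem in an ideal triangle\<close>

lemma FTC_half_line:
  fixes F f :: "real \<Rightarrow> complex"
  assumes der: "\<And>y. y > 0 \<Longrightarrow> (F has_vector_derivative f y) (at y)"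
    and cont: "continuous_on {0<..} f" and int: "set_integrable lborel {0<..} f"
    and A: "(F \<longlongrightarrow> A) (at_right 0)" and B: "(F \<longlongrightarrow> B) at_top"
  shows "(LBINT y:{0<..}. f y) = B - A"
proof -
  have "(LBINT y=ereal 0..\<infinity>. f y) = B - A"
  proof (rule interval_integral_FTC_integrable)
    show "(F has_vector_derivative f y) (at y)" if "ereal 0 < ereal y" "ereal y < \<infinity>" for y
      using der that by simp
    show "isCont f y" if "ereal 0 < ereal y" "ereal y < \<infinity>" for y
      using cont that by (simp add: continuous_on_eq_continuous_at)
    show "set_integrable lborel (einterval (ereal 0) \<infinity>) f"
      using int by simp
    show "((F \<circ> real_of_ereal) \<longlongrightarrow> A) (at_right (ereal 0))"
      using A by (simp only: ereal_tendsto_simps)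
    show "((F \<circ> real_of_ereal) \<longlongrightarrow> B) (at_left \<infinity>)"
      using B by (simp only: ereal_tendsto_simps)
  qed simp
  then show ?thesis by (simp only: interval_integral_to_infinity_eq)
qed

text \<open>At a rational \<open>\<xi>\<close> the shadow decays in these regions, and the sides of the ideal triangle end in them.\<close>

definition cusp_cone :: "real \<Rightarrow> real \<Rightarrow> complex set" where
  "cusp_cone \<xi> r = {w. 0 < Im w \<and> Im w < r \<and> \<bar>Re w - \<xi>\<bar> \<le> Im w}"

lemma cone_convex: "convex (cusp_cone \<xi> r)"
proof -
  have "cusp_cone \<xi> r = {w. Im w > 0} \<inter> {w. Im w < r} \<inter> {w. Re w - Im w \<le> \<xi>} \<inter> {w. - Re w - Im w \<le> - \<xi>}"
    by (auto simp: cusp_cone_def abs_le_iff)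
  also have "{w. Re w - Im w \<le> \<xi>} = {w. inner (Complex 1 (-1)) w \<le> \<xi>}"
    by (simp add: inner_complex_def)
  also have "{w. - Re w - Im w \<le> - \<xi>} = {w. inner (Complex (-1) (-1)) w \<le> - \<xi>}"
    by (simp add: inner_complex_def)
  finally show ?thesis
    by (simp only:) (intro convex_Int convex_halfspace_le convex_halfspace_Im_gt convex_halfspace_Im_lt)
qed

text \<open>A function with bounded derivative on a convex set is Lipschitz, hence extends continuously to the closure. This
  replaces a contour with truncated corners: a primitive has boundary values at the vertices.\<close>

lemma cone_limit:
  assumes r: "r > 0"
    and der: "\<And>w. w \<in> cusp_cone \<xi> r \<Longrightarrow> (P has_field_derivative h w) (at w)"
    and bound: "\<And>w. w \<in> cusp_cone \<xi> r \<Longrightarrow> norm (h w) \<le> K"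
  obtains L where "(P \<longlongrightarrow> L) (at (of_real \<xi>) within cusp_cone \<xi> r)"
proof -
  have lip: "norm (P x - P y) \<le> K * norm (x - y)" if "x \<in> cusp_cone \<xi> r" "y \<in> cusp_cone \<xi> r" for x y
    by (rule field_differentiable_bound[OF cone_convex _ bound that])
       (auto intro: has_field_derivative_at_within der)
  have "uniformly_continuous_on (cusp_cone \<xi> r) P"
    unfolding uniformly_continuous_on_def dist_norm
  proof (intro allI impI)
    fix e :: real assume e: "e > 0"
    have "norm (P y - P x) < e" if "x \<in> cusp_cone \<xi> r" "y \<in> cusp_cone \<xi> r" "norm (y - x) < e / (\<bar>K\<bar> + 1)" for x y
    proof -
      have "norm (P y - P x) \<le> K * norm (y - x)" by (rule lip[OF that(2,1)])
      also have "\<dots> \<le> (\<bar>K\<bar> + 1) * norm (y - x)" by (intro mult_right_mono) auto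
      also have "\<dots> < e" using that(3) by (simp add: pos_less_divide_eq mult.commute add_nonneg_pos)
      finally show ?thesis .
    qed
    then show "\<exists>d>0. \<forall>x\<in>cusp_cone \<xi> r. \<forall>y\<in>cusp_cone \<xi> r. norm (y - x) < d \<longrightarrow> norm (P y - P x) < e"
      using e by (intro exI[of _ "e / (\<bar>K\<bar> + 1)"]) auto
  qed
  moreover have "of_real \<xi> \<in> closure (cusp_cone \<xi> r)"
    unfolding closure_sequential
  proof (intro exI conjI allI)
    show "Complex \<xi> (r / (2 + real n)) \<in> cusp_cone \<xi> r" for n
    proof -
      have "r / (2 + real n) < r / 1" using r by (intro divide_strict_left_mono) auto
      then show ?thesis using r by (simp add: cusp_cone_def add_pos_nonneg)
    qed
    have "(\<lambda>n. r / (2 + real n)) \<longlonglongrightarrow> 0"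
      by (intro real_tendsto_divide_at_top[OF tendsto_const] filterlim_tendsto_add_at_top[OF tendsto_const] filterlim_real_sequentially)
    then have "(\<lambda>n. Complex \<xi> (r / (2 + real n))) \<longlonglongrightarrow> Complex \<xi> 0"
      by (intro tendsto_Complex tendsto_const)
    then show "(\<lambda>n. Complex \<xi> (r / (2 + real n))) \<longlonglongrightarrow> of_real \<xi>"
      by (simp add: complex_of_real_def)
  qed
  ultimately show ?thesis
    using uniformly_continuous_on_extension_at_closure that by blast
qed

lemma cone_limit_compose:
  assumes L: "(P \<longlongrightarrow> L) (at (of_real \<xi>) within cusp_cone \<xi> r)"
    and lim: "(\<gamma> \<longlongrightarrow> of_real \<xi>) F" and ev: "eventually (\<lambda>y. \<gamma> y \<in> cusp_cone \<xi> r) F"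
  shows "((\<lambda>y. P (\<gamma> y)) \<longlongrightarrow> L) F"
proof -
  have "filterlim \<gamma> (at (of_real \<xi>) within cusp_cone \<xi> r) F"
    unfolding filterlim_at
  proof
    show "eventually (\<lambda>y. \<gamma> y \<in> cusp_cone \<xi> r \<and> \<gamma> y \<noteq> of_real \<xi>) F"
      using ev by eventually_elim (auto simp: cusp_cone_def)
  qed (rule lim)
  then show ?thesis using L by (rule filterlim_compose[rotated])
qed

lemma ker_Im_ge:
  assumes "Im u \<ge> y" "y > 0"
  shows "norm (ker n u) \<le> y ^ (n + 1) + 1 / y ^ (n + 1)"
  using assms abs_Im_le_cmod[of u] by (intro norm_ker_le) auto

lemma ker_holomorphic:
  "(\<lambda>w. ker n (w - of_real \<alpha>)) holomorphic_on {w. Im w > 0}"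
proof -
  have "z - of_real \<alpha> \<notin> \<real>\<^sub>\<le>\<^sub>0" "z - of_real \<alpha> \<noteq> 0" if "Im z > 0" for z
    using that by (auto simp: complex_nonpos_Reals_iff complex_eq_iff)
  then show ?thesis
    unfolding ker_def by (intro holomorphic_intros) auto
qed

lemma integrand_cone_bound:
  assumes \<xi>: "\<xi> \<in> \<rat>"
  obtains K where "\<And>w. w \<in> cusp_cone \<xi> 1 \<Longrightarrow> norm (shadow w * ker n (w - of_real \<alpha>)) \<le> K"
proof -
  obtain K where K: "\<And>z. 0 < Im z \<Longrightarrow> Im z \<le> 1 \<Longrightarrow> \<bar>Re z\<bar> \<le> Im z \<Longrightarrow> norm (shadow (of_real \<xi> + z)) \<le> K * Im z ^ (n + 1)"
    using shadow_cusp_decay[OF \<xi>, of "n + 1"] by blast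
  have "norm (shadow w * ker n (w - of_real \<alpha>)) \<le> 2 * K" if w: "w \<in> cusp_cone \<xi> 1" for w
  proof -
    define v where "v = Im w"
    have v: "0 < v" "v < 1" using w by (auto simp: cusp_cone_def v_def)
    have 1: "norm (shadow w) \<le> K * v ^ (n + 1)"
      using K[of "w - of_real \<xi>"] w by (auto simp: cusp_cone_def v_def)
    have 2: "norm (ker n (w - of_real \<alpha>)) \<le> v ^ (n + 1) + 1 / v ^ (n + 1)"
      using v by (intro ker_Im_ge) (auto simp: v_def)
    have v1: "v ^ (n + 1) \<le> 1" "v ^ (n + 1) > 0" using v by (auto intro!: power_le_one mult_le_one)
    then have "1 \<le> 1 / v ^ (n + 1)" by (simp only: le_divide_eq_1_pos)
    with v1(1) have "v ^ (n + 1) \<le> 1 / v ^ (n + 1)" by (rule order_trans)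
    moreover have "2 / v ^ (n + 1) = 1 / v ^ (n + 1) + 1 / v ^ (n + 1)" by simp
    ultimately have 3: "v ^ (n + 1) + 1 / v ^ (n + 1) \<le> 2 / v ^ (n + 1)" by linarith
    have "norm (shadow w * ker n (w - of_real \<alpha>)) \<le> (K * v ^ (n + 1)) * (2 / v ^ (n + 1))"
      unfolding norm_mult using 1 order_trans[OF 2 3] by (intro mult_mono) (auto intro: order_trans[OF norm_ge_zero])
    also have "\<dots> = 2 * K" using v1(2) v(1) by simp
    finally show ?thesis .
  qed
  then show ?thesis using that by blast
qed

lemma integrand_infinity_bound:
  obtains K where "\<And>w. Im w \<ge> 1 \<Longrightarrow> norm (shadow w * ker n (w - of_real \<alpha>)) * Im w ^ 2 \<le> K"
proof -
  obtain K where K: "\<And>w. Im w \<ge> 1 \<Longrightarrow> norm (shadow w) * Im w ^ (n + 3) \<le> K"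
    using shadow_infinity_decay[of "n + 3"] by blast
  have "norm (shadow w * ker n (w - of_real \<alpha>)) * Im w ^ 2 \<le> 2 * K" if w: "Im w \<ge> 1" for w
  proof -
    define v where "v = Im w"
    have v: "1 \<le> v" using w by (auto simp: v_def)
    have 2: "norm (ker n (w - of_real \<alpha>)) \<le> v ^ (n + 1) + 1 / v ^ (n + 1)"
      using v by (intro ker_Im_ge) (auto simp: v_def)
    have v1: "1 \<le> v ^ (n + 1)" using v by (rule one_le_power)
    then have "1 / v ^ (n + 1) \<le> 1" by simp
    then have 3: "v ^ (n + 1) + 1 / v ^ (n + 1) \<le> 2 * v ^ (n + 1)" using v1 by linarith
    have "norm (shadow w * ker n (w - of_real \<alpha>)) * v ^ 2 \<le> norm (shadow w) * (2 * v ^ (n + 1)) * v ^ 2"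
      unfolding norm_mult using order_trans[OF 2 3] v by (intro mult_right_mono mult_left_mono) auto
    also have "\<dots> = 2 * (norm (shadow w) * v ^ (n + 3))" by (simp add: power_add numeral_3_eq_3 power2_eq_square)
    also have "\<dots> \<le> 2 * K" using K[OF w] by (simp add: v_def)
    finally show ?thesis by (simp add: v_def)
  qed
  then show ?thesis using that by blast
qed

text \<open>The upper half-plane is convex, so Cauchy's theorem yields a global primitive.\<close>

lemma integrand_primitive:
  obtains P where "\<And>w. Im w > 0 \<Longrightarrow> (P has_field_derivative shadow w * ker n (w - of_real \<alpha>)) (at w)"
proof -
  have hol: "(\<lambda>w. shadow w * ker n (w - of_real \<alpha>)) holomorphic_on {w. Im w > 0}"
    by (intro holomorphic_on_mult shadow_holomorphic ker_holomorphic)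
  have conv: "convex {w. Im w > 0}" and op: "open {w. Im w > 0}"
    by (rule convex_halfspace_Im_gt, rule open_halfspace_Im_gt)
  obtain P where P: "\<And>w. w \<in> {w. Im w > 0} \<Longrightarrow> (P has_field_derivative shadow w * ker n (w - of_real \<alpha>)) (at w within {w. Im w > 0})"
    using holomorphic_convex_primitive'[OF conv op hol] by metis
  have "(P has_field_derivative shadow w * ker n (w - of_real \<alpha>)) (at w)" if "Im w > 0" for w
  proof -
    have "w \<in> {w. Im w > 0}" using that by simp
    from P[OF this] show ?thesis unfolding at_within_open[OF \<open>w \<in> _\<close> op] .
  qed
  then show ?thesis by (rule that)
qed

text \<open>The curve \<open>w\<close> is the half circle from \<open>\<alpha>\<close> to \<open>\<beta>\<close>. Each of the three integrals is the difference of the boundary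
  values of one primitive at two vertices, so the claim is that these differences add up. The boundary value at \<open>i\<infinity>\<close> is
  obtained in the coordinate \<open>u = - 1 / w\<close>.\<close>

lemma ideal_triangle:
  fixes \<alpha> \<beta> s j :: real
  assumes \<alpha>: "\<alpha> \<in> \<rat>" and \<beta>: "\<beta> \<in> \<rat>" and s: "s \<noteq> 0" and j: "j \<noteq> 0" and \<beta>eq: "\<beta> = \<alpha> - j\<^sup>2 / s"
  defines "w \<equiv> \<lambda>y. of_real \<alpha> + \<i> * of_real (j\<^sup>2 * y) / (1 - \<i> * of_real (s * y))"
  assumes int: "set_integrable lborel {0<..} (\<lambda>y. shadow (w y) * ker n (w y - of_real \<alpha>) * (\<i> * of_real (j\<^sup>2) / (1 - \<i> * of_real (s * y))\<^sup>2))"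
  shows "(LBINT y:{0<..}. shadow (Complex \<alpha> y) * ker n (\<i> * of_real y) * \<i>)
    = (LBINT y:{0<..}. shadow (w y) * ker n (w y - of_real \<alpha>) * (\<i> * of_real (j\<^sup>2) / (1 - \<i> * of_real (s * y))\<^sup>2))
      + (LBINT y:{0<..}. shadow (Complex \<beta> y) * ker n (Complex \<beta> y - of_real \<alpha>) * \<i>)"
proof -
  define h where "h = (\<lambda>w. shadow w * ker n (w - of_real \<alpha>))"
  obtain P where P: "\<And>w. Im w > 0 \<Longrightarrow> (P has_field_derivative h w) (at w)"
    using integrand_primitive[of n \<alpha>] unfolding h_def by blast
  have conth: "continuous_on {w. Im w > 0} h"
    unfolding h_def
    by (intro holomorphic_on_imp_continuous_on holomorphic_on_mult shadow_holomorphic ker_holomorphic)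
  have vertex: "\<exists>L. (P \<longlongrightarrow> L) (at (of_real \<xi>) within cusp_cone \<xi> 1)" if \<xi>: "\<xi> \<in> \<rat>" for \<xi>
  proof -
    obtain K where K: "\<And>w. w \<in> cusp_cone \<xi> 1 \<Longrightarrow> norm (h w) \<le> K"
      using integrand_cone_bound[OF \<xi>, of n \<alpha>] unfolding h_def by blast
    have d: "(P has_field_derivative h w) (at w)" if "w \<in> cusp_cone \<xi> 1" for w
      using that by (intro P) (auto simp: cusp_cone_def)
    show ?thesis
      using cone_limit[OF zero_less_one d K] by blast
  qed
  obtain La where La: "(P \<longlongrightarrow> La) (at (of_real \<alpha>) within cusp_cone \<alpha> 1)" using vertex[OF \<alpha>] by blast
  obtain Lb where Lb: "(P \<longlongrightarrow> Lb) (at (of_real \<beta>) within cusp_cone \<beta> 1)" using vertex[OF \<beta>] by blast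
  \<comment> \<open>the radius \<open>1/2\<close> ensures \<open>Im (- 1 / u) \<ge> 1\<close>\<close>
  obtain Li where Li: "((\<lambda>u. P (- 1 / u)) \<longlongrightarrow> Li) (at (of_real 0) within cusp_cone 0 (1/2))"
  proof -
    obtain K where K: "\<And>w. Im w \<ge> 1 \<Longrightarrow> norm (h w) * Im w ^ 2 \<le> K"
      using integrand_infinity_bound[of n \<alpha>] unfolding h_def by blast
    have *: "Im (- 1 / u) \<ge> 1" "norm (- 1 / u) \<le> 2 * Im (- 1 / u)" "u \<noteq> 0" if u: "u \<in> cusp_cone 0 (1/2)" for u
    proof -
      define v where "v = Im u"
      have v: "0 < v" "v < 1/2" "\<bar>Re u\<bar> \<le> v" using u by (auto simp: cusp_cone_def v_def)
      show u0: "u \<noteq> 0" using v by (auto simp: v_def)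
      have sq: "(norm u)\<^sup>2 \<le> 2 * v\<^sup>2" "(norm u)\<^sup>2 > 0"
        using v u0 by (simp_all add: cmod_power2 v_def abs_le_square_iff[symmetric] sum_power2_gt_zero_iff complex_eq_iff)
      have im: "Im (- 1 / u) = v / (norm u)\<^sup>2"
        by (simp add: Im_divide cmod_power2 v_def)
      have "1 / (2 * v) = v / (2 * v\<^sup>2)" using v by (simp add: power2_eq_square)
      also have "\<dots> \<le> v / (norm u)\<^sup>2" using sq v by (intro divide_left_mono) auto
      finally have ge: "1 / (2 * v) \<le> Im (- 1 / u)" by (simp only: im)
      have "1 \<le> 1 / (2 * v)" using v by simp
      with ge show "Im (- 1 / u) \<ge> 1" by linarith
      have "norm (- 1 / u) = 1 / norm u" by (simp add: norm_divide)
      also have "\<dots> \<le> 1 / v" using v abs_Im_le_cmod[of u] u0 by (intro divide_left_mono mult_pos_pos) (auto simp: v_def)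
      also have "1 / v = 2 * (1 / (2 * v))" by simp
      finally show "norm (- 1 / u) \<le> 2 * Im (- 1 / u)" using ge by linarith
    qed
    have der: "((\<lambda>u. P (- 1 / u)) has_field_derivative h (- 1 / u) * (1 / u\<^sup>2)) (at u)" if u: "u \<in> cusp_cone 0 (1/2)" for u
    proof -
      have d: "((\<lambda>u. - 1 / u) has_field_derivative (1 / u\<^sup>2)) (at u)"
        using *(3)[OF u] by (auto intro!: derivative_eq_intros simp: power2_eq_square)
      have "Im (- 1 / u) > 0" using *(1)[OF u] by linarith
      from DERIV_chain2[OF P[OF this] d] show ?thesis .
    qed
    have bd: "norm (h (- 1 / u) * (1 / u\<^sup>2)) \<le> 4 * K" if u: "u \<in> cusp_cone 0 (1/2)" for u
    proof -
      have "norm (1 / u\<^sup>2) = norm (- 1 / u) ^ 2" by (simp add: norm_divide norm_power power_divide)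
      also have "\<dots> \<le> (2 * Im (- 1 / u)) ^ 2" using *(2)[OF u] by (intro power_mono) auto
      finally have "norm (h (- 1 / u) * (1 / u\<^sup>2)) \<le> norm (h (- 1 / u)) * (2 * Im (- 1 / u)) ^ 2"
        unfolding norm_mult by (intro mult_left_mono) auto
      also have "\<dots> = 4 * (norm (h (- 1 / u)) * Im (- 1 / u) ^ 2)" by (simp only: power_mult_distrib) simp
      also have "\<dots> \<le> 4 * K" by (intro mult_left_mono K *(1)[OF u]) auto
      finally show ?thesis .
    qed
    have "0 < (1/2::real)" by simp
    from cone_limit[OF this der bd] show ?thesis using that by blast
  qed
  have line: "(LBINT y:{0<..}. h (Complex \<xi> y) * \<i>) = Li - L"
    if \<xi>: "\<xi> \<in> \<rat>" and L: "(P \<longlongrightarrow> L) (at (of_real \<xi>) within cusp_cone \<xi> 1)" for \<xi> L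
  proof (rule FTC_half_line)
    show "((\<lambda>y. P (Complex \<xi> y)) has_vector_derivative h (Complex \<xi> y) * \<i>) (at y)" if "y > 0" for y
    proof -
      have "(Complex \<xi> has_vector_derivative \<i>) (at y)"
        unfolding Complex_eq[abs_def] by (auto intro!: derivative_eq_intros)
      moreover have "(P has_field_derivative h (Complex \<xi> y)) (at (Complex \<xi> y))" using that by (intro P) auto
      ultimately show ?thesis
        using field_vector_diff_chain_at[of "Complex \<xi>" \<i> y P "h (Complex \<xi> y)"] by (simp add: o_def mult.commute)
    qed
    show "continuous_on {0<..} (\<lambda>y. h (Complex \<xi> y) * \<i>)"
      by (intro continuous_intros continuous_on_compose2[OF conth]) (auto simp: Complex_eq intro!: continuous_intros)
    show "set_integrable lborel {0<..} (\<lambda>y. h (Complex \<xi> y) * \<i>)"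
      unfolding h_def by (rule shadow_ker_integrable[OF \<xi>]) (auto simp: Complex_eq intro!: continuous_intros)
    show "((\<lambda>y. P (Complex \<xi> y)) \<longlongrightarrow> L) (at_right 0)"
    proof (rule cone_limit_compose[OF L])
      have "((\<lambda>y. Complex \<xi> y) \<longlongrightarrow> Complex \<xi> 0) (at_right 0)" by (intro tendsto_Complex tendsto_intros)
      then show "((\<lambda>y. Complex \<xi> y) \<longlongrightarrow> of_real \<xi>) (at_right 0)" by (simp add: complex_of_real_def)
      have "eventually (\<lambda>y::real. y \<in> {0<..<1}) (at_right 0)" by (rule eventually_at_right_real) simp
      then show "eventually (\<lambda>y. Complex \<xi> y \<in> cusp_cone \<xi> 1) (at_right 0)"
        by eventually_elim (auto simp: cusp_cone_def)
    qed
    have "((\<lambda>y. P (- 1 / (- 1 / Complex \<xi> y))) \<longlongrightarrow> Li) at_top"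
    proof (rule cone_limit_compose[OF Li])
      have top: "filterlim (\<lambda>y. norm (Complex \<xi> y)) at_top at_top"
      proof (rule filterlim_at_top_mono[OF filterlim_ident])
        show "eventually (\<lambda>y. y \<le> norm (Complex \<xi> y)) at_top"
          using abs_Im_le_cmod[of "Complex \<xi> _"] by (auto intro!: always_eventually simp: abs_le_iff)
      qed
      have "((\<lambda>y. norm (- 1 / Complex \<xi> y)) \<longlongrightarrow> 0) at_top"
        unfolding norm_divide norm_minus_cancel norm_one by (intro real_tendsto_divide_at_top[OF tendsto_const] top)
      then show "((\<lambda>y. - 1 / Complex \<xi> y) \<longlongrightarrow> of_real 0) at_top"
        unfolding of_real_0 by (simp only: tendsto_norm_zero_iff)
      show "eventually (\<lambda>y. - 1 / Complex \<xi> y \<in> cusp_cone 0 (1/2)) at_top"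
        using eventually_gt_at_top[of "max 2 \<bar>\<xi>\<bar>"]
      proof eventually_elim
        case (elim y)
        then have y: "y > 2" "y \<ge> \<bar>\<xi>\<bar>" by auto
        define N where "N = \<xi>\<^sup>2 + y\<^sup>2"
        have N: "N \<ge> y\<^sup>2" "N > 0" using y by (auto simp: N_def add_nonneg_pos)
        have re: "Re (- 1 / Complex \<xi> y) = - \<xi> / N" and im: "Im (- 1 / Complex \<xi> y) = y / N"
          by (simp_all add: Re_divide Im_divide N_def)
        have "y * 2 < y * y" using y by (intro mult_strict_left_mono) auto
        then have "2 * y < N" using N by (simp add: power2_eq_square)
        then have "y / N < 1 / 2" using N by (simp add: field_simps)
        then show ?case using y N unfolding cusp_cone_def mem_Collect_eq re im by (auto simp: abs_divide divide_right_mono)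
      qed
    qed
    then show "((\<lambda>y. P (Complex \<xi> y)) \<longlongrightarrow> Li) at_top" by simp
  qed
  define q where "q = (\<lambda>y. 1 - \<i> * of_real (s * y))"
  have q0: "q y \<noteq> 0" for y by (auto simp: q_def complex_eq_iff)
  have wRI: "Re (w y) = \<alpha> - s * y * (j\<^sup>2 * y / (1 + (s * y)\<^sup>2))" "Im (w y) = j\<^sup>2 * y / (1 + (s * y)\<^sup>2)" for y
    by (simp_all add: w_def Re_divide Im_divide power2_eq_square)
  have Imw: "Im (w y) > 0" if "y > 0" for y
    using that j unfolding wRI by (simp add: divide_pos_pos add_pos_nonneg)
  have w\<beta>: "Re (w y) - \<beta> = j\<^sup>2 / s / (1 + (s * y)\<^sup>2)" for y
  proof -
    have "1 + (s * y)\<^sup>2 > 0" by (simp add: add_pos_nonneg)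
    then have "j\<^sup>2 / s - s * y * (j\<^sup>2 * y / (1 + (s * y)\<^sup>2)) = (j\<^sup>2 / s * (1 + (s * y)\<^sup>2) - s * y * (j\<^sup>2 * y)) / (1 + (s * y)\<^sup>2)"
      by (simp add: diff_divide_distrib)
    also have "j\<^sup>2 / s * (1 + (s * y)\<^sup>2) - s * y * (j\<^sup>2 * y) = j\<^sup>2 / s"
      using s by (simp add: field_simps power2_eq_square)
    finally show ?thesis unfolding wRI \<beta>eq by simp
  qed
  have arc: "(LBINT y:{0<..}. h (w y) * (\<i> * of_real (j\<^sup>2) / (q y)\<^sup>2)) = Lb - La"
  proof (rule FTC_half_line)
    show "((\<lambda>y. P (w y)) has_vector_derivative h (w y) * (\<i> * of_real (j\<^sup>2) / (q y)\<^sup>2)) (at y)" if "y > 0" for y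
    proof -
      have "((\<lambda>z. of_real \<alpha> + \<i> * (of_real (j\<^sup>2) * z) / (1 - \<i> * (of_real s * z))) has_field_derivative (\<i> * of_real (j\<^sup>2) / (q y)\<^sup>2)) (at (of_real y))"
        using q0[of y]
        by (auto intro!: derivative_eq_intros simp: q_def power2_eq_square) (simp add: algebra_simps)
      then have "((\<lambda>y. of_real \<alpha> + \<i> * (of_real (j\<^sup>2) * of_real y) / (1 - \<i> * (of_real s * of_real y))) has_vector_derivative (\<i> * of_real (j\<^sup>2) / (q y)\<^sup>2)) (at y)"
        by (rule has_vector_derivative_real_field)
      then have "(w has_vector_derivative (\<i> * of_real (j\<^sup>2) / (q y)\<^sup>2)) (at y)"
        by (simp add: w_def)
      moreover have "(P has_field_derivative h (w y)) (at (w y))" using Imw[OF that] by (rule P)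
      ultimately have "(P \<circ> w has_vector_derivative (\<i> * of_real (j\<^sup>2) / (q y)\<^sup>2) * h (w y)) (at y)"
        by (rule field_vector_diff_chain_at)
      then show ?thesis unfolding o_def by (subst mult.commute)
    qed
    have contw: "continuous_on A w" for A
      unfolding w_def using q0 by (intro continuous_intros) (auto simp: q_def)
    show "continuous_on {0<..} (\<lambda>y. h (w y) * (\<i> * of_real (j\<^sup>2) / (q y)\<^sup>2))"
      using q0 Imw by (intro continuous_intros continuous_on_compose2[OF conth contw]) (auto simp: q_def intro!: continuous_intros)
    show "set_integrable lborel {0<..} (\<lambda>y. h (w y) * (\<i> * of_real (j\<^sup>2) / (q y)\<^sup>2))"
      using int by (simp only: h_def q_def)
    show "((\<lambda>y. P (w y)) \<longlongrightarrow> La) (at_right 0)"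
    proof (rule cone_limit_compose[OF La])
      have "(w \<longlongrightarrow> w 0) (at 0)" using contw[of UNIV] by (simp add: continuous_on_def)
      then have "(w \<longlongrightarrow> of_real \<alpha>) (at 0)" by (simp add: w_def)
      then show "(w \<longlongrightarrow> of_real \<alpha>) (at_right 0)" by (rule filterlim_mono) (auto simp: at_le)
      have "eventually (\<lambda>y::real. y \<in> {0<..<min (1 / \<bar>s\<bar>) (1 / j\<^sup>2)}) (at_right 0)"
        using s j by (intro eventually_at_right_real) auto
      then show "eventually (\<lambda>y. w y \<in> cusp_cone \<alpha> 1) (at_right 0)"
      proof eventually_elim
        case (elim y)
        then have y: "y > 0" "\<bar>s\<bar> * y < 1" "j\<^sup>2 * y < 1" using s j by (auto simp: field_simps)
        have "j\<^sup>2 * y / (1 + (s * y)\<^sup>2) \<le> j\<^sup>2 * y / 1"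
          using y by (intro divide_left_mono) (auto simp: add_pos_nonneg)
        then have "Im (w y) < 1" using y unfolding wRI by simp
        moreover have "\<bar>Re (w y) - \<alpha>\<bar> = (\<bar>s\<bar> * y) * Im (w y)"
          using y Imw[OF y(1)] unfolding wRI(1) wRI(2)[symmetric] by (simp add: abs_mult)
        moreover have "(\<bar>s\<bar> * y) * Im (w y) \<le> 1 * Im (w y)" using y Imw[OF y(1)] by (intro mult_right_mono) auto
        ultimately show ?case using Imw[OF y(1)] by (simp add: cusp_cone_def)
      qed
    qed
    show "((\<lambda>y. P (w y)) \<longlongrightarrow> Lb) at_top"
    proof (rule cone_limit_compose[OF Lb])
      have im0: "((\<lambda>y. Im (w y)) \<longlongrightarrow> 0) at_top"
      proof (rule Lim_null_comparison)
        show "eventually (\<lambda>y. norm (Im (w y)) \<le> j\<^sup>2 / s\<^sup>2 / y) at_top"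
          using eventually_gt_at_top[of 0]
        proof eventually_elim
          case (elim y)
          have "j\<^sup>2 * y / (1 + (s * y)\<^sup>2) \<le> j\<^sup>2 * y / (s * y)\<^sup>2"
            using elim s by (intro divide_left_mono) (auto simp: add_pos_nonneg)
          also have "\<dots> = j\<^sup>2 / s\<^sup>2 / y" using elim s by (simp add: field_simps power2_eq_square)
          finally show ?case using Imw[OF elim] unfolding wRI(2)[symmetric] by simp
        qed
        show "((\<lambda>y. j\<^sup>2 / s\<^sup>2 / y) \<longlongrightarrow> 0) at_top"
          by (intro real_tendsto_divide_at_top[OF tendsto_const] filterlim_ident)
      qed
      have ev: "eventually (\<lambda>y. \<bar>Re (w y) - \<beta>\<bar> \<le> Im (w y) \<and> Im (w y) > 0) at_top"
        using eventually_ge_at_top[of "1 / \<bar>s\<bar>"]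
      proof eventually_elim
        case (elim y)
        have y: "y > 0" "1 \<le> \<bar>s\<bar> * y"
          using elim s by (auto simp: field_simps intro: less_le_trans[of 0 "1 / \<bar>s\<bar>"])
        have "j\<^sup>2 * 1 \<le> j\<^sup>2 * (\<bar>s\<bar> * y)" using y by (intro mult_left_mono) auto
        then have le: "j\<^sup>2 / \<bar>s\<bar> \<le> j\<^sup>2 * y" using s by (simp add: pos_divide_le_eq mult_ac)
        have "\<bar>Re (w y) - \<beta>\<bar> = j\<^sup>2 / \<bar>s\<bar> / (1 + (s * y)\<^sup>2)"
          unfolding w\<beta> abs_divide by (simp add: abs_of_nonneg add_nonneg_nonneg)
        also have "\<dots> \<le> Im (w y)"
          unfolding wRI(2) by (intro divide_right_mono le add_nonneg_nonneg) auto
        finally have "\<bar>Re (w y) - \<beta>\<bar> \<le> Im (w y)" .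
        then show ?case using Imw[OF y(1)] by simp
      qed
      have "((\<lambda>y. Re (w y) - \<beta>) \<longlongrightarrow> 0) at_top"
        by (rule Lim_null_comparison[OF _ im0]) (use ev in eventually_elim, auto)
      then have "((\<lambda>y. Re (w y)) \<longlongrightarrow> \<beta>) at_top" by (rule LIM_zero_cancel)
      then have "((\<lambda>y. Complex (Re (w y)) (Im (w y))) \<longlongrightarrow> Complex \<beta> 0) at_top"
        using im0 by (rule tendsto_Complex)
      then show "(w \<longlongrightarrow> of_real \<beta>) at_top" by (simp add: complex_of_real_def)
      have "eventually (\<lambda>y. Im (w y) < 1) at_top" using im0 by (rule order_tendstoD) simp
      then show "eventually (\<lambda>y. w y \<in> cusp_cone \<beta> 1) at_top"
        using ev by eventually_elim (auto simp: cusp_cone_def)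
    qed
  qed
  have "Complex \<alpha> y - of_real \<alpha> = \<i> * of_real y" for y by (simp add: complex_eq_iff)
  then have "(LBINT y:{0<..}. shadow (Complex \<alpha> y) * ker n (\<i> * of_real y) * \<i>) = Li - La"
    using line[OF \<alpha> La] by (simp add: h_def)
  then show ?thesis
    using line[OF \<beta> Lb] arc by (simp add: h_def q_def)
qed

section \<open>Transformation of the expansion coefficients\<close>

lemma gchoose_binc:
  assumes "k \<le> n"
  shows "((-1/2 - real k) gchoose (n - k)) = (-1) ^ (n - k) * (binc n / binc k) * real (n choose k)"
proof -
  have "((-1/2::real) gchoose n) * (real n gchoose k) = ((-1/2) gchoose k) * ((-1/2 - real k) gchoose (n - k))"
    by (rule gbinomial_trinomial_revision[OF assms])
  moreover have "((-1/2::real) gchoose m) = (-1) ^ m * binc m" for m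
    by (simp add: binc_def mult.assoc[symmetric] power_mult_distrib[symmetric])
  moreover have "(-1::real) ^ n = (-1) ^ k * (-1) ^ (n - k)"
    using assms by (simp flip: power_add)
  moreover have "real n gchoose k = real (n choose k)" by (simp add: binomial_gbinomial)
  ultimately have "(-1) ^ k * ((-1) ^ (n - k) * binc n * real (n choose k)) = (-1) ^ k * (binc k * ((-1/2 - real k) gchoose (n - k)))"
    by (simp only: mult_ac)
  then have "(-1) ^ (n - k) * binc n * real (n choose k) = binc k * ((-1/2 - real k) gchoose (n - k))"
    by simp
  then show ?thesis using binc_pos[of k] by (simp add: field_simps)
qed

text \<open>The arguments of \<open>z\<close> and \<open>q\<close> differ by less than \<open>\<pi>\<close>, so no branch is crossed.\<close>

lemma powr_divide_half_plane:
  assumes z: "Re z \<ge> 0" "z \<noteq> 0" and q: "Re q > 0"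
  shows "(z / q) powr a = z powr a / q powr a"
proof -
  have q0: "q \<noteq> 0" using q by auto
  have "\<bar>Im (Ln z)\<bar> \<le> pi / 2" using z Re_Ln_pos_le by blast
  moreover have "\<bar>Im (Ln q)\<bar> < pi / 2" using q q0 Re_Ln_pos_lt by blast
  ultimately have im: "- pi < Im (Ln z - Ln q)" "Im (Ln z - Ln q) \<le> pi"
    unfolding minus_complex.sel by (auto simp: abs_le_iff abs_less_iff)
  have "exp (Ln z - Ln q) = z / q" using z q0 by (simp add: exp_diff)
  then have "Ln (z / q) = Ln z - Ln q" using im by (rule Ln_unique)
  then show ?thesis using z q0 by (simp add: powr_def right_diff_distrib exp_diff)
qed

lemma mat2_nth [simp]:
  "mat2 a b c d $ 1 $ 1 = a" "mat2 a b c d $ 1 $ 2 = b" "mat2 a b c d $ 2 $ 1 = c" "mat2 a b c d $ 2 $ 2 = d"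
  by (simp_all add: mat2_def)

lemma unit_powr_sign:
  assumes "\<epsilon> = 1 \<or> \<epsilon> = (-1::real)"
  shows "(\<i> * of_real \<epsilon>) powr (-3/2) = \<i> * of_real \<epsilon> * inverse ((- \<i> * of_real \<epsilon>) powr (3/2))"
proof -
  define E where "E = (\<lambda>x::real. exp (of_real pi * \<i> * of_real x))"
  have add: "E x * E y = E (x + y)" for x y by (simp add: E_def exp_add[symmetric] algebra_simps)
  have per: "E (x + 2) = E x" for x
    unfolding E_def by (simp add: distrib_left exp_add mult_ac)
  have inv: "inverse (E x) = E (- x)" for x by (simp add: E_def exp_minus)
  have i: "\<i> = E (1/2)" "- \<i> = E (-1/2)"
    by (simp_all add: E_def exp_eq_polar complex_eq_iff Re_exp Im_exp)
  have p: "\<i> powr of_real a = E (a / 2)" "(- \<i>) powr of_real a = E (- (a / 2))" for a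
    by (simp_all add: powr_def E_def mult_ac)
  have "\<i> powr (-3/2) = \<i> * inverse ((- \<i>) powr (3/2))"
    using p(1)[of "-3/2"] p(2)[of "3/2"] add[of "1/2" "3/4"] per[of "-3/4"] inv[of "-3/4"] i by simp
  moreover have "(- \<i>) powr (-3/2) = (- \<i>) * inverse (\<i> powr (3/2))"
    using p(2)[of "-3/2"] p(1)[of "3/2"] add[of "-1/2" "-3/4"] per[of "-5/4"] inv[of "3/4"] i(2) by simp
  ultimately show ?thesis using assms by auto
qed

text \<open>The power \<open>- 3/2\<close>, from the weight of the shadow, times the Jacobian \<open>\<bar>j\<bar>\<close>, is the automorphy factor of weight \<open>1/2\<close> up to a
  constant that depends only on the sign of \<open>c\<close>. For \<open>j < 0\<close> this is true because the branch chosen in \<open>autfac\<close>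
  depends on the sign of \<open>c\<close> as well.\<close>

lemma autfac_constant:
  fixes a b c d x :: real
  assumes c: "c \<noteq> 0" and j: "j = c * x + d" "j \<noteq> 0"
  shows "(- \<i> * of_real (sgn c) * of_real j) powr (-3/2) * of_real \<bar>j\<bar>
     = inverse ((- \<i> * of_real (sgn c)) powr (3/2)) * autfac (1/2) (mat2 a b c d) x"
proof -
  define \<epsilon> where "\<epsilon> = sgn c"
  have \<epsilon>: "\<epsilon> = 1 \<or> \<epsilon> = -1" using c by (auto simp: \<epsilon>_def sgn_if)
  have e0: "\<i> * complex_of_real \<epsilon> \<noteq> 0" using \<epsilon> by auto
  have pw: "\<bar>j\<bar> powr (-3/2) * \<bar>j\<bar> = \<bar>j\<bar> powr (-1/2)"
    using j(2) powr_add[of "\<bar>j\<bar>" "-3/2" 1] by simp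
  have rp: "complex_of_real r powr (-3/2) = of_real (r powr (-3/2))" "complex_of_real r powr (-1/2) = of_real (r powr (-1/2))" if "r \<ge> 0" for r
    using powr_of_real[of r "-3/2"] powr_of_real[of r "-1/2"] that by simp_all
  show ?thesis
  proof (cases "j > 0")
    case True
    have "(- \<i> * of_real \<epsilon> * of_real j) powr (-3/2) = (of_real j * (- \<i> * of_real \<epsilon>)) powr (-3/2)"
      by (simp only: mult_ac)
    also have "\<dots> = of_real j powr (-3/2) * (- \<i> * of_real \<epsilon>) powr (-3/2)"
      using True by (intro powr_times_real_left) auto
    also have "of_real j powr (-3/2) = complex_of_real (\<bar>j\<bar> powr (-3/2))" using True rp(1)[of j] by simp
    also have "(- \<i> * of_real \<epsilon>) powr (-3/2) = inverse ((- \<i> * of_real \<epsilon>) powr (3/2))"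
      using powr_minus[of "- \<i> * of_real \<epsilon>" "3/2"] by simp
    finally have 1: "(- \<i> * of_real \<epsilon> * of_real j) powr (-3/2) = of_real (\<bar>j\<bar> powr (-3/2)) * inverse ((- \<i> * of_real \<epsilon>) powr (3/2))" .
    have "autfac (1/2) (mat2 a b c d) x = complex_of_real (\<bar>j\<bar> powr (-1/2))"
      using True rp(2)[of j] by (simp add: autfac_def Let_def j(1)[symmetric])
    then show ?thesis
      unfolding \<epsilon>_def[symmetric] 1 pw[symmetric] by (simp add: mult_ac)
  next
    case False
    then have jn: "j < 0" using j(2) by simp
    have "(- \<i> * of_real \<epsilon> * of_real j) powr (-3/2) = (of_real \<bar>j\<bar> * (\<i> * of_real \<epsilon>)) powr (-3/2)"
      using jn by (simp add: mult_ac)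
    also have "\<dots> = of_real \<bar>j\<bar> powr (-3/2) * (\<i> * of_real \<epsilon>) powr (-3/2)"
      by (intro powr_times_real_left) auto
    also have "of_real \<bar>j\<bar> powr (-3/2) = complex_of_real (\<bar>j\<bar> powr (-3/2))" using rp(1)[of "\<bar>j\<bar>"] by simp
    finally have 1: "(- \<i> * of_real \<epsilon> * of_real j) powr (-3/2)
        = of_real (\<bar>j\<bar> powr (-3/2)) * (\<i> * of_real \<epsilon> * inverse ((- \<i> * of_real \<epsilon>) powr (3/2)))"
      unfolding unit_powr_sign[OF \<epsilon>] .
    have "Ln (complex_of_real j) = of_real (ln \<bar>j\<bar>) + \<i> * of_real pi"
      using Ln_minus[of "of_real \<bar>j\<bar>"] jn Ln_of_real[of "\<bar>j\<bar>"] by simp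
    then have "complex_of_real j powr (-1/2) = exp (of_real (- 1/2 * ln \<bar>j\<bar>)) * exp (- (\<i> * of_real (pi / 2)))"
      using jn by (simp add: powr_def exp_add[symmetric] algebra_simps)
    also have "exp (complex_of_real (- 1/2 * ln \<bar>j\<bar>)) = of_real (\<bar>j\<bar> powr (-1/2))"
      using jn by (simp add: powr_def exp_of_real[symmetric])
    also have "exp (- (\<i> * of_real (pi / 2))) = - \<i>"
      by (simp add: exp_eq_polar complex_eq_iff Re_exp Im_exp)
    finally have p: "complex_of_real j powr (-1/2) = of_real (\<bar>j\<bar> powr (-1/2)) * - \<i>" .
    have "autfac (1/2) (mat2 a b c d) x = of_real (\<bar>j\<bar> powr (-1/2)) * (\<i> * of_real \<epsilon>)"
      using p jn c by (auto simp: autfac_def Let_def j(1)[symmetric] \<epsilon>_def sgn_if)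
    then show ?thesis
      unfolding \<epsilon>_def[symmetric] 1 pw[symmetric] by (simp add: mult_ac)
  qed
qed

text \<open>The coefficient of \<open>X ^ n\<close> in \<open>(1 + (c/j) X) powr (- 1/2) * (X / (j\<^sup>2 (1 + (c/j) X))) ^ k\<close>, that is, the matrix of the slash
  action of weight \<open>1/2\<close> on expansion coefficients (\<open>slash_fps_nth\<close>).\<close>

definition slash_coeff :: "real \<Rightarrow> real \<Rightarrow> nat \<Rightarrow> nat \<Rightarrow> complex" where
  "slash_coeff c j n k = of_real ((1 / j\<^sup>2) ^ k * ((-1/2 - real k) gchoose (n - k)) * (c / j) ^ (n - k))"

text \<open>The kernel in the coordinate of the image is \<open>1 / (w - \<alpha>) = X / j\<^sup>2 - c / j\<close> with \<open>X = 1 / (i y)\<close>. The weights \<open>binc\<close> convert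
  its binomial expansion into the slash action.\<close>

lemma slash_coeff_binomial:
  fixes X :: complex
  shows "of_real (binc n) * (of_real (1 / j\<^sup>2) * X - of_real (c / j)) ^ n
    = (\<Sum>k\<le>n. slash_coeff c j n k * (of_real (binc k) * X ^ k))"
proof -
  have "(of_real (1 / j\<^sup>2) * X - of_real (c / j)) ^ n = (of_real (1 / j\<^sup>2) * X + (- of_real (c / j))) ^ n" by simp
  also have "\<dots> = (\<Sum>k\<le>n. of_nat (n choose k) * (of_real (1 / j\<^sup>2) * X) ^ k * (- of_real (c / j)) ^ (n - k))"
    by (rule binomial_ring)
  finally have "of_real (binc n) * (of_real (1 / j\<^sup>2) * X - of_real (c / j)) ^ n
     = (\<Sum>k\<le>n. of_real (binc n) * (of_nat (n choose k) * (of_real (1 / j\<^sup>2) * X) ^ k * (- of_real (c / j)) ^ (n - k)))"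
    by (simp only: sum_distrib_left)
  also have "\<dots> = (\<Sum>k\<le>n. slash_coeff c j n k * (of_real (binc k) * X ^ k))"
  proof (rule sum.cong[OF refl])
    fix k assume "k \<in> {..n}"
    then have k: "k \<le> n" by simp
    have "slash_coeff c j n k * of_real (binc k) = of_real ((1 / j\<^sup>2) ^ k * ((-1) ^ (n - k) * binc n * real (n choose k)) * (c / j) ^ (n - k))"
      unfolding slash_coeff_def gchoose_binc[OF k] using binc_pos[of k] by simp
    moreover have "(- complex_of_real (c / j)) ^ (n - k) = (-1) ^ (n - k) * of_real ((c / j) ^ (n - k))"
      by (simp add: power_minus[of "complex_of_real c / complex_of_real j"])
    ultimately show "of_real (binc n) * (of_nat (n choose k) * (of_real (1 / j\<^sup>2) * X) ^ k * (- of_real (c / j)) ^ (n - k))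
        = slash_coeff c j n k * (of_real (binc k) * X ^ k)"
      unfolding mult.assoc[symmetric, of "slash_coeff c j n k"]
      by (simp only: power_mult_distrib of_real_mult of_real_power of_real_of_nat_eq of_real_minus of_real_1 mult_ac)
  qed
  finally show ?thesis .
qed

text \<open>The \<open>n\<close>-th Taylor coefficient at \<open>z\<close> of the period integral from \<open>\<beta>\<close> to \<open>i\<infinity>\<close>.\<close>

definition period_coeff :: "real \<Rightarrow> nat \<Rightarrow> complex \<Rightarrow> complex" where
  "period_coeff \<beta> n z = C0 * (LBINT y:{0<..}. shadow (Complex \<beta> y) * ker n (Complex \<beta> y - z) * \<i>)"

text \<open>The half circle from \<open>\<alpha>\<close> to \<open>- d / c\<close> is the preimage under \<open>\<delta>\<close> of the vertical line above \<open>\<delta> \<alpha>\<close>. In the parameter \<open>y\<close>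
  of that line the powers of \<open>c w + d\<close> from the modularity of the shadow, from the kernel and from the derivative
  cancel, and the integral over the half circle is the slash action on the coefficients at \<open>\<delta> \<alpha>\<close>.\<close>

theorem theta_coeff_modular:
  fixes a b c d :: int
  assumes det: "a * d - b * c = 1" and a: "[a = 1] (mod 16)" and d: "[d = 1] (mod 16)"
    and c: "[c = 0] (mod 32)" "c \<noteq> 0"
  defines "\<delta> \<equiv> mat2 (of_int a) (of_int b) (of_int c) (of_int d)"
  obtains \<nu> where "norm \<nu> = 1" "\<And>\<alpha> n. \<alpha> \<in> \<rat> \<Longrightarrow> of_int c * \<alpha> + of_int d \<noteq> 0 \<Longrightarrow>
      theta_coeff \<alpha> n - inverse \<nu> * autfac (1/2) \<delta> \<alpha> *
        (\<Sum>k\<le>n. slash_coeff (of_int c) (of_int c * \<alpha> + of_int d) n k * theta_coeff (mob \<delta> \<alpha>) k)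
      = period_coeff (- of_int d / of_int c) n (of_real \<alpha>)"
proof -
  obtain \<kappa> where \<kappa>: "norm \<kappa> = 1" "\<And>w. Im w > 0 \<Longrightarrow>
      shadow ((of_int a * w + of_int b) / (of_int c * w + of_int d))
        = \<kappa> * (- \<i> * of_int (sgn c) * (of_int c * w + of_int d)) powr (3/2) * shadow w"
    using shadow_modular[OF det a d c] by blast
  define \<epsilon> where "\<epsilon> = sgn (real_of_int c)"
  have \<epsilon>: "complex_of_int (sgn c) = of_real \<epsilon>" "\<epsilon> \<noteq> 0" "\<bar>\<epsilon>\<bar> = 1"
    using c(2) by (auto simp: \<epsilon>_def sgn_if)
  define \<nu> where "\<nu> = \<kappa> * (- \<i> * of_real \<epsilon>) powr (3/2)"
  have "norm ((- \<i> * of_real \<epsilon>) powr (3/2)) = norm (- \<i> * complex_of_real \<epsilon>) powr (3/2)"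
    by (subst norm_powr_real_powr') auto
  then have n\<nu>: "norm \<nu> = 1" using \<kappa>(1) \<epsilon>(3) by (simp add: \<nu>_def norm_mult)
  have "theta_coeff \<alpha> n - inverse \<nu> * autfac (1/2) \<delta> \<alpha> *
        (\<Sum>k\<le>n. slash_coeff (of_int c) (of_int c * \<alpha> + of_int d) n k * theta_coeff (mob \<delta> \<alpha>) k)
      = period_coeff (- of_int d / of_int c) n (of_real \<alpha>)"
    if \<alpha>: "\<alpha> \<in> \<rat>" and j0: "of_int c * \<alpha> + of_int d \<noteq> 0" for \<alpha> n
  proof -
    define j where "j = of_int c * \<alpha> + of_int d"
    define s where "s = of_int c * j"
    define \<beta> where "\<beta> = - real_of_int d / of_int c"
    define \<alpha>' where "\<alpha>' = mob \<delta> \<alpha>"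
    define q where "q = (\<lambda>y. 1 - \<i> * of_real (s * y))"
    \<comment> \<open>\<open>w y\<close> is the point that \<open>\<delta>\<close> maps to \<open>\<delta> \<alpha> + i y\<close>, see \<open>W\<close> below, and \<open>c * w y + d = j / q y\<close>\<close>
    define w where "w = (\<lambda>y. of_real \<alpha> + \<i> * of_real (j\<^sup>2 * y) / q y)"
    have j: "j \<noteq> 0" using j0 by (simp add: j_def)
    have c0: "real_of_int c \<noteq> 0" using c by simp
    have s: "s \<noteq> 0" using j c0 by (simp add: s_def)
    have \<beta>: "\<beta> \<in> \<rat>" "\<beta> = \<alpha> - j\<^sup>2 / s"
    proof -
      show "\<beta> \<in> \<rat>" by (simp add: \<beta>_def)
      have "j\<^sup>2 / s = j / of_int c" using j by (simp add: s_def power2_eq_square)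
      then show "\<beta> = \<alpha> - j\<^sup>2 / s" using c0 by (simp add: \<beta>_def j_def field_simps)
    qed
    have \<alpha>'_eq: "\<alpha>' = (of_int a * \<alpha> + of_int b) / j" by (simp add: \<alpha>'_def mob_def \<delta>_def j_def)
    have \<alpha>': "\<alpha>' \<in> \<rat>" using \<alpha> by (simp add: \<alpha>'_eq j_def)
    have q: "Re (q y) = 1" "q y \<noteq> 0" for y by (auto simp: q_def complex_eq_iff)
    have cj: "of_int c * w y + of_int d = of_real j / q y" for y
    proof -
      have "(of_int c * w y + of_int d) * q y = (of_int c * of_real \<alpha> + of_int d) * q y + of_int c * \<i> * of_real (j\<^sup>2 * y)"
        using q(2)[of y] by (simp add: w_def algebra_simps)
      also have "complex_of_int c * of_real \<alpha> + of_int d = of_real j" by (simp add: j_def)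
      also have "of_real j * q y + of_int c * \<i> * of_real (j\<^sup>2 * y) = of_real j"
        by (simp add: q_def s_def algebra_simps power2_eq_square)
      finally show ?thesis using q(2)[of y] by (simp add: eq_divide_eq)
    qed
    have det': "complex_of_int a * of_int d - of_int b * of_int c = 1"
      by (metis det of_int_1 of_int_diff of_int_mult)
    have aj: "of_real \<alpha>' * complex_of_real j = of_int a * of_real \<alpha> + of_int b"
    proof -
      have "\<alpha>' * j = of_int a * \<alpha> + of_int b" using j by (simp add: \<alpha>'_eq)
      then have "complex_of_real (\<alpha>' * j) = of_real (of_int a * \<alpha> + of_int b)" by (simp only:)
      then show ?thesis by simp
    qed
    have W: "(of_int a * w y + of_int b) / (of_int c * w y + of_int d) = Complex \<alpha>' y" for y
    proof -
      have "(of_int a * w y + of_int b) * q y = (of_int a * of_real \<alpha> + of_int b) * q y + of_int a * (\<i> * of_real (j\<^sup>2 * y))"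
        using q(2)[of y] by (simp add: w_def algebra_simps)
      also have "complex_of_int a * of_real \<alpha> + of_int b = of_real \<alpha>' * of_real j"
        unfolding aj ..
      also have "of_real \<alpha>' * of_real j * q y + of_int a * (\<i> * of_real (j\<^sup>2 * y))
         = of_real j * (of_real \<alpha>' + \<i> * of_real y * (of_int a * of_real j - of_real \<alpha>' * of_real s))"
        by (simp add: q_def algebra_simps power2_eq_square)
      also have "of_int a * complex_of_real j - of_real \<alpha>' * of_real s = 1"
      proof -
        have "of_real \<alpha>' * complex_of_real s = of_int c * (of_int a * of_real \<alpha> + of_int b)"
          unfolding aj[symmetric] by (simp add: s_def mult_ac)
        then show ?thesis using det' by (simp add: j_def algebra_simps)
      qed
      finally have "(of_int a * w y + of_int b) * q y = of_real j * Complex \<alpha>' y"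
        by (simp add: Complex_eq)
      then have "of_int a * w y + of_int b = of_real j / q y * Complex \<alpha>' y"
        using q(2)[of y] by (simp add: field_simps)
      then show ?thesis unfolding cj using j q(2)[of y] by simp
    qed
    have Imw: "Im (w y) > 0" if "y > 0" for y
    proof -
      have "Im (w y) = j\<^sup>2 * y / (1 + (s * y)\<^sup>2)" by (simp add: w_def q_def Im_divide power2_eq_square)
      then show ?thesis using that j by (simp add: divide_pos_pos add_pos_nonneg)
    qed
    define cs where "cs = inverse \<kappa> * (- \<i> * of_real \<epsilon> * of_real j) powr (-3/2) * of_real \<bar>j\<bar>"
    have cs: "cs = inverse \<nu> * autfac (1/2) \<delta> \<alpha>"
      using autfac_constant[OF c0 j_def j, of "of_int a" "of_int b"]
      unfolding cs_def \<nu>_def \<delta>_def \<epsilon>_def[symmetric] by (simp only: mult.assoc inverse_mult_distrib)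
    have wa: "w y - of_real \<alpha> = \<i> * of_real (j\<^sup>2 * y) / q y" for y by (simp add: w_def)
    have arc: "shadow (w y) * ker n (w y - of_real \<alpha>) * (\<i> * of_real (j\<^sup>2) / (q y)\<^sup>2)
      = (\<Sum>k\<le>n. cs * slash_coeff (of_int c) j n k * (shadow (Complex \<alpha>' y) * ker k (\<i> * of_real y) * \<i>))" if y: "y > 0" for y
    proof -
      define Q where "Q = q y"
      define J where "J = - \<i> * of_real \<epsilon> * complex_of_real j"
      have J: "J \<noteq> 0" "Re J \<ge> 0" using j \<epsilon>(2) by (simp_all add: J_def)
      have Q: "Re Q > 0" "Q \<noteq> 0" using q by (auto simp: Q_def)
      have "shadow (Complex \<alpha>' y) = \<kappa> * (J / Q) powr (3/2) * shadow (w y)"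
        using \<kappa>(2)[OF Imw[OF y], unfolded W, unfolded cj \<epsilon>(1)] by (simp only: J_def Q_def times_divide_eq_right)
      also have "(J / Q) powr (3/2) = J powr (3/2) / Q powr (3/2)"
        by (rule powr_divide_half_plane) (use J Q in auto)
      finally have sh: "shadow (Complex \<alpha>' y) = \<kappa> * (J powr (3/2) / Q powr (3/2)) * shadow (w y)" .
      have k0: "\<kappa> \<noteq> 0" using \<kappa>(1) by auto
      have Jp: "J powr (3/2) \<noteq> 0" "Q powr (3/2) \<noteq> 0" using J Q by auto
      have sh': "shadow (w y) = inverse \<kappa> * J powr (-3/2) * Q powr (3/2) * shadow (Complex \<alpha>' y)"
      proof -
        have "J powr (-3/2) = inverse (J powr (3/2))" using powr_minus[of J "3/2"] by simp
        then show ?thesis unfolding sh using k0 Jp by (simp add: field_simps)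
      qed
      have pw: "(w y - of_real \<alpha>) powr (-1/2) = inverse (of_real \<bar>j\<bar>) * (\<i> * of_real y) powr (-1/2) * Q powr (1/2)"
      proof -
        have "(w y - of_real \<alpha>) powr (-1/2) = (\<i> * of_real (j\<^sup>2 * y)) powr (-1/2) / Q powr (-1/2)"
          unfolding wa Q_def[symmetric] by (rule powr_divide_half_plane) (use j y Q in auto)
        also have "(\<i> * of_real (j\<^sup>2 * y)) = of_real (j\<^sup>2) * (\<i> * complex_of_real y)" by simp
        also have "\<dots> powr (-1/2) = of_real (j\<^sup>2) powr (-1/2) * (\<i> * of_real y) powr (-1/2)"
          by (intro powr_times_real_left) auto
        also have "complex_of_real (j\<^sup>2) powr (-1/2) = of_real ((j\<^sup>2) powr (-1/2))"
          using powr_of_real[of "j\<^sup>2" "-1/2"] by simp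
        also have "(j\<^sup>2) powr (-1/2) = inverse \<bar>j\<bar>"
          using j by (simp add: powr_minus powr_half_sqrt)
        finally have f: "(w y - of_real \<alpha>) powr (-1/2) = of_real (inverse \<bar>j\<bar>) * (\<i> * of_real y) powr (-1/2) / Q powr (-1/2)" .
        have e: "Q powr (-1/2) = inverse (Q powr (1/2))" using powr_minus[of Q "1/2"] by simp
        show ?thesis unfolding f e by (simp only: divide_inverse inverse_inverse_eq of_real_inverse)
      qed
      have inv: "1 / (w y - of_real \<alpha>) = of_real (1 / j\<^sup>2) * (1 / (\<i> * of_real y)) - of_real (of_int c / j)"
        unfolding wa using j y q(2)[of y] by (simp add: q_def s_def field_simps power2_eq_square)
      have QQ: "Q powr (3/2) * Q powr (1/2) = Q\<^sup>2"
      proof -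
        have "Q powr (3/2) * Q powr (1/2) = Q powr (3/2 + 1/2)" by (rule powr_add[symmetric])
        also have "\<dots> = Q powr (of_nat 2)" by simp
        also have "\<dots> = Q\<^sup>2" using Q by (simp only: powr_nat) simp
        finally show ?thesis .
      qed
      have jj: "complex_of_real (j\<^sup>2) * inverse (of_real \<bar>j\<bar>) = of_real \<bar>j\<bar>"
      proof -
        have "j\<^sup>2 * inverse \<bar>j\<bar> = \<bar>j\<bar>" using j by (simp add: power2_eq_square divide_simps abs_mult_self_eq)
        then show ?thesis by (simp only: of_real_mult[symmetric] of_real_inverse[symmetric])
      qed
      have "shadow (w y) * ker n (w y - of_real \<alpha>) * (\<i> * of_real (j\<^sup>2) / Q\<^sup>2)
        = inverse \<kappa> * J powr (-3/2) * (of_real (j\<^sup>2) * inverse (of_real \<bar>j\<bar>)) * (Q powr (3/2) * Q powr (1/2) / Q\<^sup>2)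
          * (shadow (Complex \<alpha>' y) * (\<i> * of_real y) powr (-1/2) * \<i>) * (of_real (binc n) * (1 / (w y - of_real \<alpha>)) ^ n)"
        unfolding sh' ker_def pw by (simp only: divide_inverse mult_ac)
      also have "\<dots> = cs * (shadow (Complex \<alpha>' y) * (\<i> * of_real y) powr (-1/2) * \<i>) * (of_real (binc n) * (1 / (w y - of_real \<alpha>)) ^ n)"
        unfolding QQ jj using Q by (simp add: cs_def J_def)
      also have "\<dots> = cs * (shadow (Complex \<alpha>' y) * (\<i> * of_real y) powr (-1/2) * \<i>) * (\<Sum>k\<le>n. slash_coeff (of_int c) j n k * (of_real (binc k) * (1 / (\<i> * of_real y)) ^ k))"
        unfolding inv slash_coeff_binomial ..
      also have "\<dots> = (\<Sum>k\<le>n. cs * slash_coeff (of_int c) j n k * (shadow (Complex \<alpha>' y) * ker k (\<i> * of_real y) * \<i>))"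
        unfolding sum_distrib_left ker_def by (intro sum.cong refl) (simp only: mult_ac)
      finally show ?thesis by (simp only: Q_def)
    qed
    have i: "set_integrable lborel {0<..} (\<lambda>y. shadow (Complex \<alpha>' y) * ker k (\<i> * of_real y) * \<i>)" for k
      by (intro shadow_ker_integrable \<alpha>' continuous_intros) auto
    have i': "set_integrable lborel {0<..} (\<lambda>y. cs * slash_coeff (of_int c) j n k * (shadow (Complex \<alpha>' y) * ker k (\<i> * of_real y) * \<i>))" for k
      by (rule set_integrable_mult_right) (rule i)
    have eq_arc: "set_integrable lborel {0<..} (\<lambda>y. shadow (w y) * ker n (w y - of_real \<alpha>) * (\<i> * of_real (j\<^sup>2) / (q y)\<^sup>2))
       = set_integrable lborel {0<..} (\<lambda>y. \<Sum>k<Suc n. cs * slash_coeff (of_int c) j n k * (shadow (Complex \<alpha>' y) * ker k (\<i> * of_real y) * \<i>))"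
      by (rule set_integrable_cong[OF refl refl]) (simp only: arc lessThan_Suc_atMost greaterThan_iff)
    have int_arc: "set_integrable lborel {0<..} (\<lambda>y. shadow (w y) * ker n (w y - of_real \<alpha>) * (\<i> * of_real (j\<^sup>2) / (q y)\<^sup>2))"
      unfolding eq_arc by (rule set_integral_finite_sum(1)[OF i'])
    have "(LBINT y:{0<..}. shadow (w y) * ker n (w y - of_real \<alpha>) * (\<i> * of_real (j\<^sup>2) / (q y)\<^sup>2))
       = (LBINT y:{0<..}. (\<Sum>k<Suc n. cs * slash_coeff (of_int c) j n k * (shadow (Complex \<alpha>' y) * ker k (\<i> * of_real y) * \<i>)))"
      by (rule set_lebesgue_integral_cong, simp, intro allI impI, simp only: arc lessThan_Suc_atMost greaterThan_iff)
    also have "\<dots> = (\<Sum>k<Suc n. LBINT y:{0<..}. cs * slash_coeff (of_int c) j n k * (shadow (Complex \<alpha>' y) * ker k (\<i> * of_real y) * \<i>))"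
      by (rule set_integral_finite_sum(2)[OF i'])
    also have "\<dots> = (\<Sum>k\<le>n. cs * slash_coeff (of_int c) j n k * (LBINT y:{0<..}. shadow (Complex \<alpha>' y) * ker k (\<i> * of_real y) * \<i>))"
      unfolding lessThan_Suc_atMost by (intro sum.cong refl set_integral_mult_right)
    finally have val: "C0 * (LBINT y:{0<..}. shadow (w y) * ker n (w y - of_real \<alpha>) * (\<i> * of_real (j\<^sup>2) / (q y)\<^sup>2))
       = cs * (\<Sum>k\<le>n. slash_coeff (of_int c) j n k * theta_coeff \<alpha>' k)"
      by (simp add: theta_coeff_def sum_distrib_left mult_ac)
    have "theta_coeff \<alpha> n = C0 * ((LBINT y:{0<..}. shadow (w y) * ker n (w y - of_real \<alpha>) * (\<i> * of_real (j\<^sup>2) / (q y)\<^sup>2))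
       + (LBINT y:{0<..}. shadow (Complex \<beta> y) * ker n (Complex \<beta> y - of_real \<alpha>) * \<i>))"
      unfolding theta_coeff_def w_def q_def
      by (subst ideal_triangle[OF \<alpha> \<beta>(1) s j \<beta>(2)]) (use int_arc in \<open>simp_all only: w_def q_def\<close>)
    then have "theta_coeff \<alpha> n = cs * (\<Sum>k\<le>n. slash_coeff (of_int c) j n k * theta_coeff \<alpha>' k) + period_coeff \<beta> n (of_real \<alpha>)"
      unfolding distrib_left val period_coeff_def .
    then show ?thesis unfolding cs \<alpha>'_def \<beta>_def j_def by simp
  qed
  with n\<nu> show ?thesis using that by blast
qed

section \<open>Smoothness and analyticity of the period integrals\<close>

lemma ker_has_derivative:
  assumes "u \<notin> \<real>\<^sub>\<le>\<^sub>0"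
  shows "(ker n has_field_derivative - (of_nat (Suc n) * ker (Suc n) u)) (at u)"
proof -
  have u: "u \<noteq> 0" using assms by auto
  have k: "ker n u = of_real (binc n) * u powr (- (of_nat n + 1/2))" if "u \<noteq> 0" for n u
  proof -
    have "u powr (- (of_nat n + 1/2)) = u powr (-1/2 + (- of_nat n))" by (simp add: algebra_simps)
    also have "\<dots> = u powr (-1/2) * u powr (- of_nat n)" by (rule powr_add)
    also have "u powr (- of_nat n) = (1 / u) ^ n"
      using that by (simp add: powr_minus powr_nat power_one_over inverse_eq_divide)
    finally show ?thesis by (simp add: ker_def mult_ac)
  qed
  have "((\<lambda>u. of_real (binc n) * u powr (- (of_nat n + 1/2))) has_field_derivative
      of_real (binc n) * (- (of_nat n + 1/2) * u powr (- (of_nat n + 1/2) - 1))) (at u)"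
    by (intro DERIV_cmult has_field_derivative_powr assms)
  also have "of_real (binc n) * (- (of_nat n + 1/2) * u powr (- (of_nat n + 1/2) - 1)) = - (of_nat (Suc n) * ker (Suc n) u)"
  proof -
    have e: "- (of_nat n + 1/2) - 1 = - (of_nat (Suc n) + 1/2 :: complex)" by simp
    have "binc n * (real n + 1/2) = real (Suc n) * binc (Suc n)"
    proof -
      have "real n + 1 \<noteq> 0" by (simp add: add_nonneg_eq_0_iff)
      then show ?thesis unfolding binc_Suc of_nat_Suc by (simp add: field_simps)
    qed
    then have "complex_of_real (binc n * (real n + 1/2)) = of_real (real (Suc n) * binc (Suc n))" by (simp only:)
    then have A: "of_real (binc n) * (of_nat n + 1/2) = (of_nat (Suc n) * of_real (binc (Suc n)) :: complex)"
      by simp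
    have "of_real (binc n) * (- (of_nat n + 1/2) * P) = - ((of_real (binc n) * (of_nat n + 1/2)) * P)" for P :: complex
      by (simp only: mult_minus_left mult_minus_right mult.assoc)
    then show ?thesis unfolding k[OF u] e A by (simp only: mult.assoc)
  qed
  finally have 1: "((\<lambda>u. of_real (binc n) * u powr (- (of_nat n + 1/2))) has_field_derivative - (of_nat (Suc n) * ker (Suc n) u)) (at u)" .
  show ?thesis
  proof (rule has_field_derivative_transform_within[OF 1, of "norm u"])
    show "of_real (binc n) * x powr (- (of_nat n + 1/2)) = ker n x" if "dist x u < norm u" for x
      using that by (intro k[symmetric]) auto
  qed (use u in auto)
qed

text \<open>The remainder is bounded uniformly for \<open>z\<close> and \<open>z'\<close> in the closed lower half-plane, by a \<open>moderate\<close> function of \<open>y\<close>.\<close>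

lemma ker_shift_Taylor:
  assumes y: "y > 0" and z: "Im z \<le> 0" "Im z' \<le> 0"
  shows "norm (ker n (Complex \<beta> y - z') - (ker n (Complex \<beta> y - z) + of_nat (Suc n) * ker (Suc n) (Complex \<beta> y - z) * (z' - z)))
    \<le> of_nat (Suc n) * of_nat (Suc (Suc n)) * (y ^ (n + 3) + 1 / y ^ (n + 3)) * norm (z' - z) ^ 2"
proof -
  define f where "f = (\<lambda>i::nat. \<lambda>z. if i = 0 then ker n (Complex \<beta> y - z) else if i = 1 then of_nat (Suc n) * ker (Suc n) (Complex \<beta> y - z)
      else of_nat (Suc n) * (of_nat (Suc (Suc n)) * ker (Suc (Suc n)) (Complex \<beta> y - z)))"
  have d: "((\<lambda>z. ker m (Complex \<beta> y - z)) has_field_derivative of_nat (Suc m) * ker (Suc m) (Complex \<beta> y - z)) (at z)"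
    if "Im z \<le> 0" for m z
  proof -
    have nz: "Complex \<beta> y - z \<notin> \<real>\<^sub>\<le>\<^sub>0" using that y by (auto simp: complex_nonpos_Reals_iff)
    have "((\<lambda>z. Complex \<beta> y - z) has_field_derivative -1) (at z)" by (auto intro!: derivative_eq_intros)
    from DERIV_chain2[OF ker_has_derivative[OF nz] this] show ?thesis by simp
  qed
  have "norm (f 0 z' - (\<Sum>i\<le>1. f i z * (z' - z) ^ i / fact i))
     \<le> (of_nat (Suc n) * of_nat (Suc (Suc n)) * (y ^ (n + 3) + 1 / y ^ (n + 3))) * norm (z' - z) ^ (Suc 1) / fact 1"
  proof (rule complex_Taylor)
    show "convex {z. Im z \<le> 0}" by (rule convex_halfspace_Im_le)
    show "(f i has_field_derivative f (Suc i) x) (at x within {z. Im z \<le> 0})" if x': "x \<in> {z. Im z \<le> 0}" and i: "i \<le> 1" for i x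
    proof (rule has_field_derivative_at_within)
      have x: "Im x \<le> 0" using x' by simp
      consider "i = 0" | "i = 1" using i by linarith
      then show "(f i has_field_derivative f (Suc i) x) (at x)"
      proof cases
        case 1
        then show ?thesis using d[OF x, of n] by (simp add: f_def)
      next
        case 2
        then show ?thesis using DERIV_cmult[OF d[OF x, of "Suc n"], of "of_nat (Suc n)"] by (simp add: f_def)
      qed
    qed
    show "norm (f (Suc 1) x) \<le> of_nat (Suc n) * of_nat (Suc (Suc n)) * (y ^ (n + 3) + 1 / y ^ (n + 3))" if "x \<in> {z. Im z \<le> 0}" for x
    proof -
      have "norm (ker (Suc (Suc n)) (Complex \<beta> y - x)) \<le> y ^ (Suc (Suc n) + 1) + 1 / y ^ (Suc (Suc n) + 1)"
        using that y by (intro ker_Im_ge) auto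
      also have "Suc (Suc n) + 1 = n + 3" by simp
      finally have "real (Suc n) * real (Suc (Suc n)) * norm (ker (Suc (Suc n)) (Complex \<beta> y - x))
        \<le> real (Suc n) * real (Suc (Suc n)) * (y ^ (n + 3) + 1 / y ^ (n + 3))"
        by (intro mult_left_mono) auto
      moreover have "f (Suc 1) x = of_nat (Suc n) * of_nat (Suc (Suc n)) * ker (Suc (Suc n)) (Complex \<beta> y - x)"
        by (simp add: f_def)
      ultimately show ?thesis by (simp only: norm_mult norm_of_nat)
    qed
  qed (use z in auto)
  then show ?thesis by (simp add: f_def power2_eq_square)
qed

text \<open>Differentiation under the integral sign, up to the real line and including the end point \<open>\<beta>\<close>: the growth of the
  derivatives of the kernel as \<open>y\<close> tends to \<open>0\<close> is absorbed by the decay of the shadow.\<close>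

lemma period_coeff_derivative:
  assumes \<beta>: "\<beta> \<in> \<rat>" and z: "Im z \<le> 0"
  shows "(period_coeff \<beta> n has_field_derivative of_nat (Suc n) * period_coeff \<beta> (Suc n) z) (at z within {w. Im w \<le> 0})"
proof -
  define g where "g = (\<lambda>y. shadow (Complex \<beta> y))"
  define m where "m = (\<lambda>y::real. complex_of_real (of_nat (Suc n) * of_nat (Suc (Suc n)) * (y ^ (n + 3) + 1 / y ^ (n + 3))))"
  have "moderate m"
    unfolding moderate_def
  proof
    show "continuous_on {0<..} m" unfolding m_def by (intro continuous_intros) auto
    have "norm (m y) \<le> (of_nat (Suc n) * of_nat (Suc (Suc n))) * (y ^ (n + 3) + 1 / y ^ (n + 3))" if "y > 0" for y
    proof -
      have "0 \<le> real (Suc n) * real (Suc (Suc n)) * (y ^ (n + 3) + 1 / y ^ (n + 3))"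
        using that by (intro mult_nonneg_nonneg add_nonneg_nonneg) auto
      then show ?thesis unfolding m_def norm_of_real by (simp only: abs_of_nonneg)
    qed
    then show "\<exists>C k. \<forall>y>0. norm (m y) \<le> C * (y ^ k + 1 / y ^ k)" by blast
  qed
  then have intm: "set_integrable lborel {0<..} (\<lambda>y. norm (g y * m y))"
    unfolding g_def by (intro set_integrable_norm rapid_integrable rapid_mult shadow_rapid \<beta>)
  define I where "I = (LBINT y:{0<..}. norm (g y * m y))"
  have I: "set_integrable lborel {0<..} (\<lambda>y. g y * ker k (Complex \<beta> y - w) * \<i>)" if "Im w \<le> 0" for k w
    unfolding g_def using that
    by (intro shadow_ker_integrable[OF \<beta>]) (auto simp: Complex_eq intro!: continuous_intros)
  have bound: "norm (period_coeff \<beta> n w - period_coeff \<beta> n z - of_nat (Suc n) * period_coeff \<beta> (Suc n) z * (w - z))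
     \<le> norm C0 * I * norm (w - z) ^ 2" if w: "Im w \<le> 0" for w
  proof -
    define c where "c = of_nat (Suc n) * (w - z)"
    have i1: "set_integrable lborel {0<..} (\<lambda>y. g y * ker n (Complex \<beta> y - w) * \<i> - g y * ker n (Complex \<beta> y - z) * \<i>)"
      by (intro set_integral_diff I z w)
    have i2: "set_integrable lborel {0<..} (\<lambda>y. c * (g y * ker (Suc n) (Complex \<beta> y - z) * \<i>))"
      by (intro set_integrable_mult_right) (rule I[OF z])
    have "period_coeff \<beta> n w - period_coeff \<beta> n z - of_nat (Suc n) * period_coeff \<beta> (Suc n) z * (w - z)
       = C0 * ((LBINT y:{0<..}. g y * ker n (Complex \<beta> y - w) * \<i>) - (LBINT y:{0<..}. g y * ker n (Complex \<beta> y - z) * \<i>)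
           - c * (LBINT y:{0<..}. g y * ker (Suc n) (Complex \<beta> y - z) * \<i>))"
    proof -
      have alg: "C * X - C * Y - N * (C * Z) * D = C * (X - Y - N * D * Z)" for C X Y Z N D :: complex
        by (simp add: algebra_simps)
      show ?thesis unfolding period_coeff_def c_def g_def by (rule alg)
    qed
    also have "c * (LBINT y:{0<..}. g y * ker (Suc n) (Complex \<beta> y - z) * \<i>) = (LBINT y:{0<..}. c * (g y * ker (Suc n) (Complex \<beta> y - z) * \<i>))"
      by (rule set_integral_mult_right[symmetric])
    also have "(LBINT y:{0<..}. g y * ker n (Complex \<beta> y - w) * \<i>) - (LBINT y:{0<..}. g y * ker n (Complex \<beta> y - z) * \<i>)
       = (LBINT y:{0<..}. g y * ker n (Complex \<beta> y - w) * \<i> - g y * ker n (Complex \<beta> y - z) * \<i>)"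
      by (rule set_integral_diff(2)[symmetric]) (rule I[OF w], rule I[OF z])
    also have "(LBINT y:{0<..}. g y * ker n (Complex \<beta> y - w) * \<i> - g y * ker n (Complex \<beta> y - z) * \<i>)
         - (LBINT y:{0<..}. c * (g y * ker (Suc n) (Complex \<beta> y - z) * \<i>))
       = (LBINT y:{0<..}. g y * ker n (Complex \<beta> y - w) * \<i> - g y * ker n (Complex \<beta> y - z) * \<i> - c * (g y * ker (Suc n) (Complex \<beta> y - z) * \<i>))"
      by (rule set_integral_diff(2)[symmetric, OF i1 i2])
    finally have eq: "period_coeff \<beta> n w - period_coeff \<beta> n z - of_nat (Suc n) * period_coeff \<beta> (Suc n) z * (w - z)
       = C0 * (LBINT y:{0<..}. g y * ker n (Complex \<beta> y - w) * \<i> - g y * ker n (Complex \<beta> y - z) * \<i> - c * (g y * ker (Suc n) (Complex \<beta> y - z) * \<i>))" .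
    have i3: "set_integrable lborel {0<..} (\<lambda>y. g y * ker n (Complex \<beta> y - w) * \<i> - g y * ker n (Complex \<beta> y - z) * \<i> - c * (g y * ker (Suc n) (Complex \<beta> y - z) * \<i>))"
      by (rule set_integral_diff(1)[OF i1 i2])
    have "norm (LBINT y:{0<..}. g y * ker n (Complex \<beta> y - w) * \<i> - g y * ker n (Complex \<beta> y - z) * \<i> - c * (g y * ker (Suc n) (Complex \<beta> y - z) * \<i>))
       \<le> (LBINT y:{0<..}. norm (g y * ker n (Complex \<beta> y - w) * \<i> - g y * ker n (Complex \<beta> y - z) * \<i> - c * (g y * ker (Suc n) (Complex \<beta> y - z) * \<i>)))"
      by (rule set_integral_norm_bound[OF i3])
    also have "\<dots> \<le> (LBINT y:{0<..}. norm (w - z) ^ 2 * norm (g y * m y))"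
    proof (rule set_integral_mono)
      fix y :: real assume "y \<in> {0<..}"
      then have y: "y > 0" by simp
      have "g y * ker n (Complex \<beta> y - w) * \<i> - g y * ker n (Complex \<beta> y - z) * \<i> - c * (g y * ker (Suc n) (Complex \<beta> y - z) * \<i>)
        = g y * \<i> * (ker n (Complex \<beta> y - w) - (ker n (Complex \<beta> y - z) + of_nat (Suc n) * ker (Suc n) (Complex \<beta> y - z) * (w - z)))"
        unfolding c_def by (simp add: algebra_simps)
      then have "norm (g y * ker n (Complex \<beta> y - w) * \<i> - g y * ker n (Complex \<beta> y - z) * \<i> - c * (g y * ker (Suc n) (Complex \<beta> y - z) * \<i>))
        = norm (g y) * norm (ker n (Complex \<beta> y - w) - (ker n (Complex \<beta> y - z) + of_nat (Suc n) * ker (Suc n) (Complex \<beta> y - z) * (w - z)))"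
        by (simp only: norm_mult norm_ii mult_1_right)
      also have "\<dots> \<le> norm (g y) * (of_nat (Suc n) * of_nat (Suc (Suc n)) * (y ^ (n + 3) + 1 / y ^ (n + 3)) * norm (w - z) ^ 2)"
        by (intro mult_left_mono ker_shift_Taylor y z w) auto
      also have "of_nat (Suc n) * of_nat (Suc (Suc n)) * (y ^ (n + 3) + 1 / y ^ (n + 3)) \<le> norm (m y)"
        unfolding m_def norm_of_real by (rule abs_ge_self)
      finally show "norm (g y * ker n (Complex \<beta> y - w) * \<i> - g y * ker n (Complex \<beta> y - z) * \<i> - c * (g y * ker (Suc n) (Complex \<beta> y - z) * \<i>))
         \<le> norm (w - z) ^ 2 * norm (g y * m y)"
        by (simp add: norm_mult mult_ac mult_left_mono mult_right_mono)
    qed (rule set_integrable_norm[OF i3], rule set_integrable_mult_right[OF intm])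
    also have "\<dots> = norm (w - z) ^ 2 * I" unfolding I_def by (rule set_integral_mult_right)
    finally have le: "norm (LBINT y:{0<..}. g y * ker n (Complex \<beta> y - w) * \<i> - g y * ker n (Complex \<beta> y - z) * \<i> - c * (g y * ker (Suc n) (Complex \<beta> y - z) * \<i>))
       \<le> norm (w - z) ^ 2 * I" .
    show ?thesis
      unfolding eq norm_mult using mult_left_mono[OF le norm_ge_zero[of C0]] by (simp only: mult_ac)
  qed
  show ?thesis
    unfolding has_field_derivative_iff
  proof (rule LIM_zero_cancel, rule Lim_null_comparison)
    have ev: "eventually (\<lambda>w. w \<noteq> z \<and> Im w \<le> 0) (at z within {w. Im w \<le> 0})"
      by (auto simp: eventually_at_filter)
    show "eventually (\<lambda>w. norm ((period_coeff \<beta> n w - period_coeff \<beta> n z) / (w - z) - of_nat (Suc n) * period_coeff \<beta> (Suc n) z)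
        \<le> norm C0 * I * norm (w - z)) (at z within {w. Im w \<le> 0})"
      using ev
    proof eventually_elim
      case (elim w)
      then have w0: "norm (w - z) > 0" by simp
      have "(period_coeff \<beta> n w - period_coeff \<beta> n z) / (w - z) - of_nat (Suc n) * period_coeff \<beta> (Suc n) z
         = (period_coeff \<beta> n w - period_coeff \<beta> n z - of_nat (Suc n) * period_coeff \<beta> (Suc n) z * (w - z)) / (w - z)"
        using elim by (simp add: diff_divide_distrib)
      then have "norm ((period_coeff \<beta> n w - period_coeff \<beta> n z) / (w - z) - of_nat (Suc n) * period_coeff \<beta> (Suc n) z)
         = norm (period_coeff \<beta> n w - period_coeff \<beta> n z - of_nat (Suc n) * period_coeff \<beta> (Suc n) z * (w - z)) / norm (w - z)"
        by (simp only: norm_divide)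
      also have "\<dots> \<le> (norm C0 * I * norm (w - z) ^ 2) / norm (w - z)"
        using elim by (intro divide_right_mono bound) auto
      also have "\<dots> = norm C0 * I * norm (w - z)" using w0 by (simp add: power2_eq_square)
      finally show ?case .
    qed
    have "((\<lambda>w. norm C0 * I * norm (w - z)) \<longlongrightarrow> norm C0 * I * norm (z - z)) (at z within {w. Im w \<le> 0})"
      by (intro tendsto_intros)
    then show "((\<lambda>w. norm C0 * I * norm (w - z)) \<longlongrightarrow> 0) (at z within {w. Im w \<le> 0})" by simp
  qed
qed

text \<open>On the line above \<open>\<beta>\<close> the distance to \<open>x\<close> is at least \<open>\<bar>x - \<beta>\<bar>\<close>, so the binomial series of the kernel converges uniformly
  and can be integrated term by term.\<close>

lemma period_coeff_power_series:
  assumes \<beta>: "\<beta> \<in> \<rat>" and x: "\<bar>x' - x\<bar> < \<bar>x - \<beta>\<bar>"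
  shows "(\<lambda>n. period_coeff \<beta> n (of_real x) * of_real (x' - x) ^ n) sums period_coeff \<beta> 0 (of_real x')"
proof -
  define h where "h = x' - x"
  define r where "r = \<bar>h\<bar> / \<bar>x - \<beta>\<bar>"
  have r: "0 \<le> r" "r < 1" using x by (auto simp: r_def h_def)
  define g where "g = (\<lambda>y. shadow (Complex \<beta> y))"
  define f where "f = (\<lambda>n y. indicator {0<..} y *\<^sub>R (g y * ker n (Complex \<beta> y - of_real x) * (\<i> * of_real h ^ n)))"
  have I: "set_integrable lborel {0<..} (\<lambda>y. g y * ker k (Complex \<beta> y - of_real x) * c)" for k c x
    unfolding g_def
    by (intro shadow_ker_integrable[OF \<beta>]) (auto simp: Complex_eq intro!: continuous_intros)
  have int: "integrable lborel (f n)" for n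
    using I[of n x "\<i> * of_real h ^ n"] unfolding set_integrable_def f_def .
  define v where "v = (\<lambda>y. indicator {0<..} y *\<^sub>R norm (g y * ker 0 (Complex \<beta> y - of_real x) * 1))"
  have intv: "integrable lborel v"
    using set_integrable_norm[OF I[of 0 x 1]] unfolding set_integrable_def v_def .
  have u: "norm (Complex \<beta> y - of_real x) \<ge> \<bar>x - \<beta>\<bar>" "Complex \<beta> y - of_real x \<noteq> 0" "\<bar>h\<bar> / norm (Complex \<beta> y - of_real x) \<le> r" if "y > 0" for y
  proof -
    show 1: "norm (Complex \<beta> y - of_real x) \<ge> \<bar>x - \<beta>\<bar>"
      using abs_Re_le_cmod[of "Complex \<beta> y - of_real x"] by (simp add: abs_minus_commute)
    show "Complex \<beta> y - of_real x \<noteq> 0" using that by (auto simp: complex_eq_iff)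
    show "\<bar>h\<bar> / norm (Complex \<beta> y - of_real x) \<le> r"
      unfolding r_def using 1 x by (intro divide_left_mono) (auto intro!: mult_pos_pos)
  qed
  have bound: "norm (f n y) \<le> r ^ n * v y" for n y
  proof (cases "y > 0")
    case True
    define w where "w = Complex \<beta> y - of_real x"
    have w: "w \<noteq> 0" using u(2)[OF True] by (simp add: w_def)
    have "norm (ker n w * (\<i> * of_real h ^ n)) = binc n * norm w powr (-1/2) * (\<bar>h\<bar> / norm w) ^ n"
      using norm_ker[OF w, of n] by (simp add: norm_mult norm_power power_divide)
    also have "\<dots> \<le> 1 * norm w powr (-1/2) * r ^ n"
      using binc_bounds[of n] u(3)[OF True] by (intro mult_mono power_mono) (auto simp: w_def)
    also have "\<dots> = r ^ n * norm (ker 0 w)" using norm_ker[OF w, of 0] by simp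
    finally have "norm (g y) * norm (ker n w * (\<i> * of_real h ^ n)) \<le> norm (g y) * (r ^ n * norm (ker 0 w))"
      by (intro mult_left_mono) auto
    then show ?thesis using True by (simp add: f_def v_def w_def norm_mult mult_ac)
  next
    case False
    then show ?thesis by (simp add: f_def v_def)
  qed
  have sumr: "summable (\<lambda>n. r ^ n * c)" for c using r by (intro summable_mult2 summable_geometric) auto
  have AE: "AE y in lborel. summable (\<lambda>n. norm (f n y))"
    by (intro AE_I2 summable_comparison_test'[OF sumr, of 0]) (use bound in auto)
  have sumint: "summable (\<lambda>n. LINT y|lborel. norm (f n y))"
  proof (rule summable_comparison_test'[OF sumr, of 0])
    fix n
    have "(LINT y|lborel. norm (f n y)) \<le> (LINT y|lborel. r ^ n * v y)"
      by (intro integral_mono integrable_norm int integrable_mult_right intv bound)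
    then show "norm (LINT y|lborel. norm (f n y)) \<le> r ^ n * (LINT y|lborel. v y)" by simp
  qed
  have sums: "(\<lambda>n. integral\<^sup>L lborel (f n)) sums (LINT y|lborel. (\<Sum>n. f n y))"
    by (rule sums_integral[OF int AE sumint])
  have F: "(\<Sum>n. f n y) = indicator {0<..} y *\<^sub>R (g y * ker 0 (Complex \<beta> y - of_real x') * \<i>)" for y
  proof (cases "y > 0")
    case True
    define w where "w = Complex \<beta> y - of_real x"
    define t where "t = of_real h / w"
    have w: "w \<noteq> 0" "Im w > 0" using True by (auto simp: w_def complex_eq_iff)
    have "norm t \<le> r" using u(3)[OF True] by (simp add: t_def w_def norm_divide)
    then have t: "norm t < 1" using r by simp
    have "(\<lambda>n. ((-1/2) gchoose n) * (- t) ^ n) sums (1 + (- t)) powr (-1/2)"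
      using t by (intro gen_binomial_complex) auto
    moreover have "((-1/2) gchoose n) * (- t) ^ n = of_real (binc n) * t ^ n" for n
    proof -
      have "complex_of_real ((-1/2) gchoose n) = ((-1/2) gchoose n)"
        by (simp add: gbinomial_prod_rev)
      then show ?thesis by (simp add: binc_def power_minus[of t] mult_ac)
    qed
    ultimately have "(\<lambda>n. of_real (binc n) * t ^ n) sums (1 - t) powr (-1/2)" by simp
    then have s: "(\<lambda>n. g y * \<i> * w powr (-1/2) * (of_real (binc n) * t ^ n)) sums (g y * \<i> * w powr (-1/2) * (1 - t) powr (-1/2))"
      by (rule sums_mult)
    have prod: "w powr (-1/2) * (1 - t) powr (-1/2) = (Complex \<beta> y - of_real x') powr (-1/2)"
    proof -
      have "w * t = of_real h" using w by (simp add: t_def)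
      then have w': "Complex \<beta> y - of_real x' = w * (1 - t)" by (simp add: right_diff_distrib) (simp add: w_def h_def)
      have re: "Re (1 - t) > 0" using t complex_Re_le_cmod[of t] by simp
      have imw: "0 < Im (Ln w)" "Im (Ln w) < pi" using w Im_Ln_pos_lt_imp[of w] by auto
      have t0: "1 - t \<noteq> 0" using re by auto
      have im1: "\<bar>Im (Ln (1 - t))\<bar> < pi / 2" using re t0 Re_Ln_pos_lt by blast
      have ww: "Im (w * (1 - t)) > 0" "w * (1 - t) \<noteq> 0" unfolding w'[symmetric] using True by (auto simp: complex_eq_iff)
      \<comment> \<open>otherwise the product would lie in the lower half-plane\<close>
      have "Im (Ln w + Ln (1 - t)) \<le> pi"
      proof (rule ccontr)
        assume "\<not> Im (Ln w + Ln (1 - t)) \<le> pi"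
        then have gt: "Im (Ln w + Ln (1 - t)) > pi" "Im (Ln w + Ln (1 - t)) < 2 * pi"
          using imw im1 by (auto simp: abs_less_iff)
        have "exp (Ln w + Ln (1 - t)) = w * (1 - t)" using w t0 by (simp add: exp_add)
        then have "Im (exp (Ln w + Ln (1 - t))) > 0" using ww by simp
        then have "sin (Im (Ln w + Ln (1 - t))) > 0" by (simp add: Im_exp zero_less_mult_iff)
        moreover have "sin (Im (Ln w + Ln (1 - t))) \<le> 0" using gt by (intro sin_le_zero) auto
        ultimately show False by simp
      qed
      moreover have "- pi < Im (Ln w + Ln (1 - t))" using imw im1 by (auto simp: abs_less_iff)
      moreover have "exp (Ln w + Ln (1 - t)) = w * (1 - t)" using w t0 by (simp add: exp_add)
      ultimately have "Ln (w * (1 - t)) = Ln w + Ln (1 - t)" by (intro Ln_unique)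
      then show ?thesis unfolding w' using w t0 by (simp add: powr_def distrib_left exp_add[symmetric])
    qed
    have "f n y = g y * \<i> * w powr (-1/2) * (of_real (binc n) * t ^ n)" for n
      using True by (simp add: f_def ker_def w_def[symmetric] t_def power_divide mult_ac)
    then have "(\<lambda>n. f n y) sums (g y * \<i> * (w powr (-1/2) * (1 - t) powr (-1/2)))"
      using s by (simp add: mult.assoc)
    then show ?thesis unfolding prod using True by (simp add: sums_iff ker_def mult_ac)
  next
    case False
    then show ?thesis by (simp add: f_def)
  qed
  have v1: "integral\<^sup>L lborel (f n) = (LBINT y:{0<..}. g y * ker n (Complex \<beta> y - of_real x) * \<i>) * of_real h ^ n" for n
  proof -
    have "integral\<^sup>L lborel (f n) = (LBINT y:{0<..}. (g y * ker n (Complex \<beta> y - of_real x) * \<i>) * of_real h ^ n)"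
      by (simp add: set_lebesgue_integral_def f_def[abs_def] mult.assoc)
    then show ?thesis by simp
  qed
  have "(\<lambda>n. C0 * integral\<^sup>L lborel (f n)) sums (C0 * (LINT y|lborel. (\<Sum>n. f n y)))"
    by (rule sums_mult[OF sums])
  then show ?thesis
    unfolding F v1 unfolding period_coeff_def h_def g_def set_lebesgue_integral_def by (simp only: mult.assoc)
qed

section \<open>The group \<open>Gamma_Theta\<close>\<close>

lemma mat2_mult: "mat2 a b c d ** mat2 e f g h = mat2 (a * e + b * g) (a * f + b * h) (c * e + d * g) (c * f + d * h)"
  by (simp add: matrix_matrix_mult_def vec_eq_iff forall_2 sum_2)

lemma mat2_1: "mat 1 = mat2 1 0 0 1"
  by (simp add: mat_def vec_eq_iff forall_2)

lemma matrix_inv_D: "matrix_inv D_mat = mat2 (1/2) 0 0 1"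
  unfolding matrix_inv_def
proof (rule some_equality)
  show DD: "D_mat ** mat2 (1/2) 0 0 1 = mat 1 \<and> mat2 (1/2) 0 0 1 ** D_mat = mat 1"
    by (simp add: D_mat_def mat2_mult mat2_1)
  fix X assume X: "D_mat ** X = mat 1 \<and> X ** D_mat = mat 1"
  have "X = X ** (D_mat ** mat2 (1/2) 0 0 1)" using DD by simp
  also have "\<dots> = mat2 (1/2) 0 0 1" unfolding matrix_mul_assoc using X by simp
  finally show "X = mat2 (1/2) 0 0 1" .
qed

text \<open>Integrality of the conjugated matrix forces the upper right entry of the element of \<open>Gamma1 16\<close> to be even.\<close>

lemma Gamma_Theta_cases:
  assumes "\<delta> \<in> Gamma_Theta"
  obtains a b c d :: int where
    "\<delta> = mat2 (of_int a) (of_int b) (of_int c) (of_int d)" "a * d - b * c = 1"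
    "[a = 1] (mod 16)" "[d = 1] (mod 16)" "[c = 0] (mod 32)"
    "D_mat ** \<delta> ** matrix_inv D_mat = mat2 (of_int a) (2 * of_int b) (of_int c / 2) (of_int d)"
proof -
  from assms obtain a b' c' d :: int where
    \<delta>: "\<delta> = matrix_inv D_mat ** mat2 (of_int a) (of_int b') (of_int c') (of_int d) ** D_mat" "\<delta> \<in> SL2Z"
    and c': "[c' = 0] (mod 16)" and ad: "[a = 1] (mod 16)" "[d = 1] (mod 16)"
    unfolding Gamma_Theta_def Gamma1_def by blast
  have \<delta>': "\<delta> = mat2 (of_int a) (of_int b' / 2) (2 * of_int c') (of_int d)"
    unfolding \<delta>(1) matrix_inv_D unfolding D_mat_def mat2_mult by (simp add: mult.commute)
  have "\<delta> $ 1 $ 2 \<in> \<int>" using \<delta>(2) by (simp add: SL2Z_def)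
  then obtain b :: int where b: "real_of_int b' / 2 = of_int b" by (auto simp: \<delta>' elim!: Ints_cases)
  define c where "c = 2 * c'"
  have \<delta>'': "\<delta> = mat2 (of_int a) (of_int b) (of_int c) (of_int d)" by (simp add: \<delta>' b c_def)
  have "det \<delta> = 1" using \<delta>(2) by (simp add: SL2Z_def)
  then have "real_of_int (a * d - b * c) = of_int 1" by (simp add: \<delta>'' det_2)
  then have det: "a * d - b * c = 1" by (simp only: of_int_eq_iff)
  have c32: "[c = 0] (mod 32)" using c' by (auto simp: cong_0_iff c_def)
  have "D_mat ** \<delta> ** matrix_inv D_mat = mat2 (of_int a) (2 * of_int b) (of_int c / 2) (of_int d)"
    unfolding \<delta>'' matrix_inv_D unfolding D_mat_def mat2_mult by simp
  with \<delta>'' det ad c32 show ?thesis by (rule that)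
qed

section \<open>The obstruction\<close>

text \<open>The substitution \<open>w \<mapsto> 2 * w\<close> in the integral that defines the obstruction.\<close>

lemma r_psi_scaled:
  assumes c: "c \<noteq> 0"
  shows "r_psi (mat2 a b' (c / 2) d) (2 * \<tau>) = period_coeff (- d / c) 0 \<tau>"
proof -
  define \<beta> where "\<beta> = - d / c"
  define F where "F = (\<lambda>y. let w = Complex (- d / (c / 2)) y in Theta_psi w * (w - 2 * \<tau>) powr (- 1 / 2) * \<i>)"
  have F2: "F (2 * y) = of_real (2 powr (-1/2)) * (shadow (Complex \<beta> y) * ker 0 (Complex \<beta> y - \<tau>) * \<i>)" for y
  proof -
    have w: "Complex (- d / (c / 2)) (2 * y) = 2 * Complex \<beta> y" by (simp add: complex_eq_iff \<beta>_def)
    have "2 * Complex \<beta> y - 2 * \<tau> = of_real 2 * (Complex \<beta> y - \<tau>)" by (simp add: algebra_simps)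
    then have "(2 * Complex \<beta> y - 2 * \<tau>) powr (-1/2) = of_real 2 powr (-1/2) * (Complex \<beta> y - \<tau>) powr (-1/2)"
      by (simp only:) (rule powr_times_real_left, auto)
    also have "complex_of_real 2 powr (-1/2) = of_real (2 powr (-1/2))"
      using powr_of_real[of 2 "-1/2"] by simp
    finally have p: "(2 * Complex \<beta> y - 2 * \<tau>) powr (-1/2) = of_real (2 powr (-1/2)) * (Complex \<beta> y - \<tau>) powr (-1/2)" .
    have k: "ker 0 u = u powr (-1/2)" for u by (simp add: ker_def)
    show ?thesis unfolding F_def w Let_def Theta_psi_double p k by (simp only: mult_ac)
  qed
  have "(LBINT y:{0<..}. F y) = 2 * (LBINT y:{0<..}. F (2 * y))"
  proof -
    have "(LINT y|lborel. indicator {0<..} y *\<^sub>R F y) = \<bar>2\<bar> *\<^sub>R (LINT y|lborel. indicator {0<..} (0 + 2 * y) *\<^sub>R F (0 + 2 * y))"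
      by (rule lborel_integral_real_affine) simp
    moreover have "indicator {0<..} (0 + 2 * y) = (indicator {0<..} y :: real)" for y :: real
      by (simp add: indicator_def)
    ultimately show ?thesis unfolding set_lebesgue_integral_def by (simp add: scaleR_conv_of_real)
  qed
  also have "(LBINT y:{0<..}. F (2 * y)) = of_real (2 powr (-1/2)) * (LBINT y:{0<..}. shadow (Complex \<beta> y) * ker 0 (Complex \<beta> y - \<tau>) * \<i>)"
    unfolding F2 by (rule set_integral_mult_right)
  finally have int: "(LBINT y:{0<..}. F y) = 2 * (of_real (2 powr (-1/2)) * (LBINT y:{0<..}. shadow (Complex \<beta> y) * ker 0 (Complex \<beta> y - \<tau>) * \<i>))" .
  have const: "1 / (2 * csqrt (8 * \<i>)) * (2 * (of_real (2 powr (-1/2)) * X)) = C0 * X" for X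
  proof -
    have "csqrt (8 * \<i>) = (of_real 8 * \<i>) powr (1/2)" by (simp add: csqrt_conv_powr)
    also have "\<dots> = of_real 8 powr (1/2) * \<i> powr (1/2)" by (rule powr_times_real_left) auto
    also have "complex_of_real 8 powr (1/2) = of_real (8 powr (1/2))" using powr_of_real[of 8 "1/2"] by simp
    also have "\<i> powr (1/2) = csqrt \<i>" using csqrt_conv_powr[of \<i>] by simp
    finally have 1: "csqrt (8 * \<i>) = of_real (8 powr (1/2)) * csqrt \<i>" .
    have "(8::real) powr (1/2) = (4 * 2) powr (1/2)" by simp
    also have "\<dots> = 4 powr (1/2) * 2 powr (1/2)" by (rule powr_mult)
    also have "(4::real) powr (1/2) = 2" using powr_half_sqrt[of "4::real"] by simp
    finally have 2: "(8::real) powr (1/2) = 2 * 2 powr (1/2)" .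
    have 3: "(2::real) powr (-1/2) = 1 / 2 powr (1/2)" using powr_minus_divide[of "2::real" "1/2"] by simp
    have 4: "(2::real) powr (1/2) * 2 powr (1/2) = 2" using powr_add[of "2::real" "1/2" "1/2"] by simp
    define r where "r = complex_of_real (2 powr (1/2))"
    have r: "r * r = 2" "r \<noteq> 0" unfolding r_def using 4 by (simp_all flip: of_real_mult)
    define s where "s = csqrt \<i>"
    have "1 / (2 * (2 * r * s)) * (2 * (1 / r * X)) = 1 / (2 * s) * X * (1 / (r * r))"
      by (simp add: mult_ac)
    also have "\<dots> = 1 / (4 * s) * X" unfolding r(1) by simp
    finally have "1 / (2 * (2 * r * s)) * (2 * (1 / r * X)) = 1 / (4 * s) * X" .
    then show ?thesis unfolding 1 2 3 C0_def r_def s_def by (simp only: of_real_mult of_real_divide of_real_1 of_real_numeral)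
  qed
  have "r_psi (mat2 a b' (c / 2) d) (2 * \<tau>) = 1 / (2 * csqrt (8 * \<i>)) * (LBINT y:{0<..}. F y)"
    using c by (simp add: r_psi_def F_def)
  also have "\<dots> = C0 * (LBINT y:{0<..}. shadow (Complex \<beta> y) * ker 0 (Complex \<beta> y - \<tau>) * \<i>)"
    unfolding int by (rule const)
  finally show ?thesis by (simp only: period_coeff_def \<beta>_def)
qed

text \<open>The Taylor coefficients of \<open>R_psi \<delta>\<close>, in terms of the lower row of \<open>\<delta>\<close>.\<close>

definition obstruction_coeff :: "int \<Rightarrow> int \<Rightarrow> nat \<Rightarrow> complex \<Rightarrow> complex" where
  "obstruction_coeff c d n z = (if c = 0 then 0 else period_coeff (- of_int d / of_int c) n z)"

lemma r_psi_eq_obstruction: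
  "r_psi (mat2 (of_int a) (2 * of_int b) (of_int c / 2) (of_int d)) (2 * \<tau>) = obstruction_coeff c d 0 \<tau>"
  using r_psi_scaled[of "of_int c" "of_int a" "2 * of_int b" "of_int d" \<tau>]
  by (simp add: obstruction_coeff_def r_psi_def)

lemma obstruction_coeff_derivative:
  assumes "Im z \<le> 0"
  shows "(obstruction_coeff c d n has_field_derivative of_nat (Suc n) * obstruction_coeff c d (Suc n) z) (at z within {w. Im w \<le> 0})"
proof (cases "c = 0")
  case True
  then show ?thesis by (simp add: obstruction_coeff_def[abs_def])
next
  case False
  then show ?thesis
    using period_coeff_derivative[of "- of_int d / of_int c" z n] assms by (simp add: obstruction_coeff_def[abs_def])
qed

lemma obstruction_extends_smoothly: "extends_smoothly_to_reals (obstruction_coeff c d 0)"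
  unfolding extends_smoothly_to_reals_def
proof (intro exI[of _ "\<lambda>n z. fact n * obstruction_coeff c d n z"] conjI allI impI)
  show "((\<lambda>z. fact n * obstruction_coeff c d n z) has_field_derivative fact (Suc n) * obstruction_coeff c d (Suc n) z) (at z within {w. Im w \<le> 0})"
    if "Im z \<le> 0" for n z
    using DERIV_cmult[OF obstruction_coeff_derivative[OF that, of c d n], of "fact n"] by (simp add: mult_ac)
qed simp

lemma obstruction_vderiv:
  "vderiv n (\<lambda>x. obstruction_coeff c d 0 (of_real x)) = (\<lambda>x. fact n * obstruction_coeff c d n (of_real x))"
  and obstruction_differentiable:
  "(\<lambda>x. fact n * obstruction_coeff c d n (of_real x)) differentiable (at x)"
proof -
  have der: "((\<lambda>x. fact n * obstruction_coeff c d n (of_real x)) has_vector_derivative fact (Suc n) * obstruction_coeff c d (Suc n) (of_real x)) (at x)" for n x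
  proof -
    have "(obstruction_coeff c d n has_field_derivative of_nat (Suc n) * obstruction_coeff c d (Suc n) (of_real x)) (at (of_real x) within range of_real)"
      by (rule has_field_derivative_subset[OF obstruction_coeff_derivative]) auto
    then have "(obstruction_coeff c d n \<circ> of_real has_vector_derivative 1 * (of_nat (Suc n) * obstruction_coeff c d (Suc n) (of_real x))) (at x)"
      by (rule field_vector_diff_chain_within[rotated]) (auto intro!: derivative_eq_intros)
    then have "((\<lambda>x. fact n * obstruction_coeff c d n (of_real x)) has_vector_derivative fact n * (of_nat (Suc n) * obstruction_coeff c d (Suc n) (of_real x))) (at x)"
      unfolding o_def mult_1 by (rule has_vector_derivative_mult_right)
    then show ?thesis by (simp add: mult_ac)
  qed
  show "vderiv n (\<lambda>x. obstruction_coeff c d 0 (of_real x)) = (\<lambda>x. fact n * obstruction_coeff c d n (of_real x))"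
  proof (induction n)
    case (Suc n)
    have "vderiv (Suc n) (\<lambda>x. obstruction_coeff c d 0 (of_real x)) = (\<lambda>x. vector_derivative (\<lambda>x. fact n * obstruction_coeff c d n (of_real x)) (at x))"
      using Suc by (simp add: vderiv_def)
    also have "\<dots> = (\<lambda>x. fact (Suc n) * obstruction_coeff c d (Suc n) (of_real x))"
      by (intro ext vector_derivative_at der)
    finally show ?case .
  qed (simp add: vderiv_def)
  show "(\<lambda>x. fact n * obstruction_coeff c d n (of_real x)) differentiable (at x)"
    using der[of n x] by (rule differentiableI_vector)
qed

lemma obstruction_real_analytic:
  assumes "d \<noteq> 0 \<or> c \<noteq> 0"
  shows "real_analytic_on (\<lambda>x. obstruction_coeff c d 0 (of_real x)) (- {x. of_int c * x + of_int d = 0})"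
  unfolding real_analytic_on_def
proof
  fix x :: real assume x: "x \<in> - {x. of_int c * x + of_int d = 0}"
  show "\<exists>a :: nat \<Rightarrow> complex. \<exists>e>0. \<forall>y. \<bar>y - x\<bar> < e \<longrightarrow>
        (\<lambda>n. a n * of_real (y - x) ^ n) sums obstruction_coeff c d 0 (of_real y)"
  proof (cases "c = 0")
    case True
    then show ?thesis
      by (intro exI[of _ "\<lambda>_. 0"] exI[of _ 1]) (simp add: obstruction_coeff_def)
  next
    case False
    define \<beta> where "\<beta> = - real_of_int d / of_int c"
    have "x \<noteq> \<beta>" using x False by (auto simp: \<beta>_def)
    have "\<beta> \<in> \<rat>" by (simp add: \<beta>_def)
    have "(\<lambda>n. period_coeff \<beta> n (of_real x) * of_real (y - x) ^ n) sums obstruction_coeff c d 0 (of_real y)"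
      if "\<bar>y - x\<bar> < \<bar>x - \<beta>\<bar>" for y
      using period_coeff_power_series[OF \<open>\<beta> \<in> \<rat>\<close> that] False by (simp add: obstruction_coeff_def \<beta>_def)
    then show ?thesis
      using \<open>x \<noteq> \<beta>\<close> by (intro exI[of _ "\<lambda>n. period_coeff \<beta> n (of_real x)"] exI[of _ "\<bar>x - \<beta>\<bar>"]) auto
  qed
qed

section \<open>The transformation law on the whole group\<close>

text \<open>All exponents \<open>r\<^sup>2\<close> with \<open>psi r \<noteq> 0\<close> are \<open>1\<close> modulo \<open>8\<close>, so the shadow is multiplied by one eighth root of unity.\<close>

lemma theta_coeff_translate:
  "theta_coeff (\<alpha> + of_int b) n = echar 1 (of_int b / 8) * theta_coeff \<alpha> n"
proof -
  have tw: "shadow_twist (\<alpha> + of_int b) r = echar 1 (of_int b / 8) * shadow_twist \<alpha> r" for r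
  proof (cases "psi r = 0")
    case False
    then obtain m where m: "r\<^sup>2 = 1 + 8 * m" using psi_odd_square by blast
    have "real_of_int r ^ 2 = of_int (r\<^sup>2)" by simp
    also have "\<dots> = 1 + 8 * of_int m" unfolding m by simp
    finally have "(\<alpha> + of_int b) * of_int r ^ 2 / 8 = of_int b / 8 + \<alpha> * of_int r ^ 2 / 8 + of_int (b * m)"
      by (simp add: distrib_right add_divide_distrib) (simp add: algebra_simps)
    then have "echar 1 ((\<alpha> + of_int b) * of_int r ^ 2 / 8) = echar 1 (of_int b / 8 + \<alpha> * of_int r ^ 2 / 8)"
      by (simp only: echar_add_int)
    then show ?thesis by (simp add: shadow_twist_def echar_add_right)
  qed (simp add: shadow_twist_def)
  have sh: "shadow (Complex (\<alpha> + of_int b) y) = echar 1 (of_int b / 8) * shadow (Complex \<alpha> y)" for y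
  proof -
    have "shadow (of_real x + Complex 0 y) = twisted_theta (shadow_twist x) (Complex 0 y / 4)" for x
      by (rule shadow_shift)
    then have 1: "shadow (Complex x y) = twisted_theta (shadow_twist x) (Complex 0 y / 4)" for x
      by (simp add: Complex_eq)
    have "twisted_theta (shadow_twist (\<alpha> + of_int b)) z = echar 1 (of_int b / 8) * twisted_theta (shadow_twist \<alpha>) z" for z
      unfolding twisted_theta_def infsum_cmult_right'[symmetric] tw by (rule infsum_cong) (simp only: mult_ac)
    then show ?thesis unfolding 1 .
  qed
  show ?thesis
    unfolding theta_coeff_def sh mult.assoc set_integral_mult_right by (simp only: mult.left_commute)
qed

text \<open>For \<open>c = 0\<close> the matrix is a translation, since \<open>a\<close> and \<open>d\<close> are \<open>1\<close> modulo \<open>16\<close>.\<close>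

lemma Theta_coeff_law:
  fixes a b c d :: int
  assumes det: "a * d - b * c = 1" and a: "[a = 1] (mod 16)" and d: "[d = 1] (mod 16)" and c: "[c = 0] (mod 32)"
  defines "\<delta> \<equiv> mat2 (of_int a) (of_int b) (of_int c) (of_int d)"
  shows "\<exists>\<nu>. norm \<nu> = 1 \<and> (\<forall>\<alpha> n. \<alpha> \<in> \<rat> \<longrightarrow> of_int c * \<alpha> + of_int d \<noteq> 0 \<longrightarrow>
      theta_coeff \<alpha> n - inverse \<nu> * autfac (1/2) \<delta> \<alpha> *
        (\<Sum>k\<le>n. slash_coeff (of_int c) (of_int c * \<alpha> + of_int d) n k * theta_coeff (mob \<delta> \<alpha>) k)
      = obstruction_coeff c d n (of_real \<alpha>))"
proof (cases "c = 0")
  case True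
  then have "a * d = 1" using det by simp
  then have "a = 1 \<and> d = 1 \<or> a = -1 \<and> d = -1" by (simp add: zmult_eq_1_iff)
  then have ad: "a = 1" "d = 1" using a by (auto simp: cong_def)
  have \<delta>: "\<delta> = mat2 1 (of_int b) 0 1" by (simp add: \<delta>_def ad True)
  have sc: "(\<Sum>k\<le>n. slash_coeff 0 1 n k * f k) = f n" for n and f :: "nat \<Rightarrow> complex"
  proof -
    have "(\<Sum>k\<le>n. slash_coeff 0 1 n k * f k) = (\<Sum>k\<le>n. if k = n then f n else 0)"
      by (intro sum.cong refl) (auto simp: slash_coeff_def)
    then show ?thesis by simp
  qed
  have af: "autfac (1/2) \<delta> \<alpha> = 1" "mob \<delta> \<alpha> = \<alpha> + of_int b" for \<alpha>
    by (simp_all add: autfac_def mob_def \<delta>)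
  have n1: "norm (echar 1 (of_int b / 8)) = 1" by simp
  then have "echar 1 (of_int b / 8) \<noteq> 0" by (metis norm_zero zero_neq_one)
  then show ?thesis
    using n1 by (intro exI[of _ "echar 1 (of_int b / 8)"])
      (simp add: True ad af sc theta_coeff_translate obstruction_coeff_def)
next
  case False
  have oc: "obstruction_coeff c d n z = period_coeff (- of_int d / of_int c) n z" for n z
    by (simp add: obstruction_coeff_def False)
  obtain \<nu> where 1: "norm \<nu> = 1" and 2: "\<And>\<alpha> n. \<alpha> \<in> \<rat> \<Longrightarrow> of_int c * \<alpha> + of_int d \<noteq> 0 \<Longrightarrow>
      theta_coeff \<alpha> n - inverse \<nu> * autfac (1/2) \<delta> \<alpha> *
        (\<Sum>k\<le>n. slash_coeff (of_int c) (of_int c * \<alpha> + of_int d) n k * theta_coeff (mob \<delta> \<alpha>) k)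
      = period_coeff (- of_int d / of_int c) n (of_real \<alpha>)"
    by (rule theta_coeff_modular[OF det a d c False, folded \<delta>_def]) (rule that; blast)
  show ?thesis
    unfolding oc by (intro exI[of _ \<nu>] conjI allI impI 1 2)
qed

section \<open>The multiplier\<close>

lemma radial_value_theta_psi:
  assumes x: "x \<in> \<rat>"
  shows "radial_value theta_psi (2 * x) = theta_coeff x 0"
proof -
  have "filterlim (\<lambda>t::real. t / 2) (at_right 0) (at_right 0)"
    unfolding filterlim_at
  proof
    show "((\<lambda>t::real. t / 2) \<longlongrightarrow> 0) (at_right 0)" by (auto intro!: tendsto_eq_intros)
    show "\<forall>\<^sub>F t::real in at_right 0. t / 2 \<in> {0<..} \<and> t / 2 \<noteq> 0"
      using eventually_at_right_less[of "0::real"] by eventually_elim auto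
  qed
  then have lim: "((\<lambda>t. Theta (Complex x (t / 2))) \<longlongrightarrow> theta_coeff x 0) (at_right 0)"
    using radial_value_Theta(1)[OF x] by (rule filterlim_compose[rotated])
  have ev: "eventually (\<lambda>t::real. Theta (Complex x (t / 2)) = theta_psi (Complex (2 * x) t)) (at_right 0)"
    using eventually_at_right_less[of "0::real"]
  proof eventually_elim
    case (elim t)
    have "2 * Complex x (t / 2) = Complex (2 * x) t" by (simp add: complex_eq_iff)
    then show ?case using Theta_eq_theta_psi[of "Complex x (t / 2)"] elim by simp
  qed
  have "((\<lambda>t. theta_psi (Complex (2 * x) t)) \<longlongrightarrow> theta_coeff x 0) (at_right 0)"
    by (rule Lim_transform_eventually[OF lim ev])
  then show ?thesis unfolding radial_value_def by (intro tendsto_Lim) auto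
qed

text \<open>On the imaginary axis, where \<open>q\<close> is positive, all terms of the \<open>q\<close>-series are nonnegative and the first is \<open>1\<close>.\<close>

lemma theta_coeff_0_nonzero: "theta_coeff 0 0 \<noteq> 0"
proof -
  have bound: "norm (Theta (Complex 0 t)) \<ge> exp (- pi / 4)" if t: "0 < t" "t < 1" for t
  proof -
    define r where "r = exp (- 2 * pi * t)"
    have r: "0 < r" "r < 1" using t by (simp_all add: r_def)
    have q: "exp (2 * of_real pi * \<i> * Complex 0 t) = of_real r"
      by (simp add: r_def Complex_eq exp_of_real[symmetric] mult_ac)
    define e where "e = (\<lambda>n. r ^ n * (\<Prod>j<n. 1 - r * (r\<^sup>2) ^ j) / (\<Prod>j<n. 1 + r * r * (r\<^sup>2) ^ j))"
    have ft: "fine_term (of_real r) (of_real r) n = of_real (e n)" for n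
      by (simp add: fine_term_def qpoch_def e_def)
    have nonneg: "e n \<ge> 0" for n
    proof -
      have "r * (r\<^sup>2) ^ j \<le> 1" for j
        using r by (intro mult_le_one power_le_one) (auto simp: power_le_one)
      then show ?thesis using r unfolding e_def
        by (intro divide_nonneg_nonneg mult_nonneg_nonneg prod_nonneg) (auto intro!: add_nonneg_nonneg)
    qed
    have "summable (fine_term (of_real r) (of_real r))" using r by (intro fine_summable) auto
    then have sum: "summable e" unfolding ft by (simp only: summable_of_real_iff)
    have "fine_sum (of_real r) (of_real r) = of_real (suminf e)"
      unfolding fine_sum_def ft by (rule suminf_of_real[OF sum, symmetric])
    moreover have "suminf e \<ge> 1"
    proof -
      have "sum e {..<1} \<le> suminf e" by (rule sum_le_suminf[OF sum]) (use nonneg in auto)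
      then show ?thesis by (simp add: e_def)
    qed
    ultimately have f: "norm (fine_sum (of_real r) (of_real r)) \<ge> 1" by simp
    have "norm (exp (2 * of_real pi * \<i> * Complex 0 t * of_real (1/8))) = exp (- pi * t / 4)"
      by (simp add: norm_exp_eq_Re)
    also have "\<dots> \<ge> exp (- pi / 4)" using t by simp
    finally have g: "norm (exp (2 * of_real pi * \<i> * Complex 0 t * of_real (1/8))) \<ge> exp (- pi / 4)" .
    have "exp (- pi / 4) * 1 \<le> norm (exp (2 * of_real pi * \<i> * Complex 0 t * of_real (1/8))) * norm (fine_sum (of_real r) (of_real r))"
      by (intro mult_mono f g) auto
    then show ?thesis
      using Theta_eq_fine_sum[of "Complex 0 t"] t unfolding q by (simp add: norm_mult)
  qed
  have lim: "((\<lambda>t. norm (Theta (Complex 0 t))) \<longlongrightarrow> norm (theta_coeff 0 0)) (at_right 0)"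
    by (intro tendsto_norm radial_value_Theta) auto
  have "eventually (\<lambda>t::real. t \<in> {0<..<1}) (at_right 0)"
    by (rule eventually_at_right_real) simp
  then have "eventually (\<lambda>t. exp (- pi / 4) \<le> norm (Theta (Complex 0 t))) (at_right 0)"
    by eventually_elim (use bound in auto)
  then have "exp (- pi / 4) \<le> norm (theta_coeff 0 0)"
    by (rule tendsto_lowerbound[OF lim]) simp
  then show ?thesis by (metis exp_gt_zero norm_zero not_less)
qed

text \<open>The law determines the multiplier: at \<open>x = - b / a\<close>, which \<open>\<delta>\<close> maps to \<open>0\<close>, the slash term is a nonzero multiple of
  \<open>theta_coeff 0 0\<close>. At the cusp \<open>- d / c\<close>, where \<open>autfac\<close> is \<open>0\<close>, the law holds because the vertical lines above \<open>\<alpha>\<close> and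
  above \<open>- d / c\<close> coincide.\<close>

lemma multiplier:
  fixes a b c d :: int
  assumes det: "a * d - b * c = 1" and a: "[a = 1] (mod 16)" and d: "[d = 1] (mod 16)" and c: "[c = 0] (mod 32)"
  defines "\<delta> \<equiv> mat2 (of_int a) (of_int b) (of_int c) (of_int d)"
    and "\<nu> \<equiv> nu_psi (mat2 (of_int a) (2 * of_int b) (of_int c / 2) (of_int d))"
  shows "norm \<nu> = 1"
    and "\<And>\<alpha> n. \<alpha> \<in> \<rat> \<Longrightarrow> of_int c * \<alpha> + of_int d \<noteq> 0 \<Longrightarrow>
      theta_coeff \<alpha> n - inverse \<nu> * autfac (1/2) \<delta> \<alpha> *
        (\<Sum>k\<le>n. slash_coeff (of_int c) (of_int c * \<alpha> + of_int d) n k * theta_coeff (mob \<delta> \<alpha>) k)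
      = obstruction_coeff c d n (of_real \<alpha>)"
    and "\<And>\<alpha>. \<alpha> \<in> \<rat> \<Longrightarrow> theta_coeff \<alpha> 0 - inverse \<nu> * autfac (1/2) \<delta> \<alpha> * theta_coeff (mob \<delta> \<alpha>) 0 = obstruction_coeff c d 0 (of_real \<alpha>)"
proof -
  define \<gamma> where "\<gamma> = mat2 (of_int a) (2 * of_int b) (of_int c / 2) (of_int d)"
  obtain \<mu> where \<mu>: "norm \<mu> = 1" and law: "\<And>\<alpha> n. \<alpha> \<in> \<rat> \<Longrightarrow> of_int c * \<alpha> + of_int d \<noteq> 0 \<Longrightarrow>
      theta_coeff \<alpha> n - inverse \<mu> * autfac (1/2) \<delta> \<alpha> *
        (\<Sum>k\<le>n. slash_coeff (of_int c) (of_int c * \<alpha> + of_int d) n k * theta_coeff (mob \<delta> \<alpha>) k)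
      = obstruction_coeff c d n (of_real \<alpha>)"
    using Theta_coeff_law[OF det a d c, folded \<delta>_def] by (elim exE conjE) (rule that, auto)
  have law0: "theta_coeff \<alpha> 0 - inverse \<mu> * autfac (1/2) \<delta> \<alpha> * theta_coeff (mob \<delta> \<alpha>) 0 = obstruction_coeff c d 0 (of_real \<alpha>)"
    if \<alpha>: "\<alpha> \<in> \<rat>" for \<alpha>
  proof (cases "of_int c * \<alpha> + of_int d = 0")
    case False
    then show ?thesis using law[OF \<alpha> False, of 0] by (simp add: slash_coeff_def)
  next
    case True
    have "d \<noteq> 0" using d by (auto simp: cong_def)
    then have c0: "c \<noteq> 0" using True by auto
    then have \<alpha>_eq: "\<alpha> = - of_int d / of_int c" using True by (simp add: field_simps)
    have "Complex \<alpha> y - of_real \<alpha> = \<i> * of_real y" for y by (simp add: complex_eq_iff)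
    then have "theta_coeff \<alpha> 0 = period_coeff \<alpha> 0 (of_real \<alpha>)"
      by (simp only: theta_coeff_def period_coeff_def)
    moreover have "autfac (1/2) \<delta> \<alpha> = 0" using True by (simp add: autfac_def \<delta>_def)
    ultimately show ?thesis using c0 by (simp add: obstruction_coeff_def \<alpha>_eq)
  qed
  have af: "autfac (1/2) \<gamma> (2 * x) = autfac (1/2) \<delta> x" for x
    by (simp add: autfac_def \<gamma>_def \<delta>_def)
  have mb: "mob \<gamma> (2 * x) = 2 * mob \<delta> x" for x
    by (simp add: mob_def \<gamma>_def \<delta>_def algebra_simps)
  have mobQ: "mob \<delta> x \<in> \<rat>" if "x \<in> \<rat>" for x
    using that by (simp add: mob_def \<delta>_def)
  have P: "(\<forall>\<alpha>\<in>\<rat>. radial_value theta_psi \<alpha> - slash (1/2) (\<lambda>_. \<nu>') theta_psi \<gamma> \<alpha> = r_psi \<gamma> (of_real \<alpha>))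
     \<longleftrightarrow> (\<forall>x\<in>\<rat>. theta_coeff x 0 - inverse \<nu>' * autfac (1/2) \<delta> x * theta_coeff (mob \<delta> x) 0 = obstruction_coeff c d 0 (of_real x))" (is "?L \<longleftrightarrow> ?R") for \<nu>'
  proof -
    have eq: "radial_value theta_psi (2 * x) - slash (1/2) (\<lambda>_. \<nu>') theta_psi \<gamma> (2 * x) = r_psi \<gamma> (of_real (2 * x))
       \<longleftrightarrow> theta_coeff x 0 - inverse \<nu>' * autfac (1/2) \<delta> x * theta_coeff (mob \<delta> x) 0 = obstruction_coeff c d 0 (of_real x)"
      if x: "x \<in> \<rat>" for x
      using radial_value_theta_psi[OF x] radial_value_theta_psi[OF mobQ[OF x]] r_psi_eq_obstruction[of a b c d "of_real x"]
      by (simp add: slash_def af mb \<gamma>_def[symmetric])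
    show ?thesis
    proof
      assume L: ?L
      show ?R
      proof
        fix x :: real assume x: "x \<in> \<rat>"
        then have "2 * x \<in> \<rat>" by simp
        with L eq[OF x] show "theta_coeff x 0 - inverse \<nu>' * autfac (1/2) \<delta> x * theta_coeff (mob \<delta> x) 0 = obstruction_coeff c d 0 (of_real x)" by blast
      qed
    next
      assume R: ?R
      show ?L
      proof
        fix \<alpha> :: real assume \<alpha>: "\<alpha> \<in> \<rat>"
        then have x: "\<alpha> / 2 \<in> \<rat>" by simp
        have "2 * (\<alpha> / 2) = \<alpha>" by simp
        with R eq[OF x] x show "radial_value theta_psi \<alpha> - slash (1/2) (\<lambda>_. \<nu>') theta_psi \<gamma> \<alpha> = r_psi \<gamma> (of_real \<alpha>)" by metis
      qed
    qed
  qed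
  have "nu_psi \<gamma> = \<mu>"
    unfolding nu_psi_def P
  proof (rule the_equality)
    show "\<forall>x\<in>\<rat>. theta_coeff x 0 - inverse \<mu> * autfac (1/2) \<delta> x * theta_coeff (mob \<delta> x) 0 = obstruction_coeff c d 0 (of_real x)"
      using law0 by blast
  next
    fix \<nu>' assume \<nu>': "\<forall>x\<in>\<rat>. theta_coeff x 0 - inverse \<nu>' * autfac (1/2) \<delta> x * theta_coeff (mob \<delta> x) 0 = obstruction_coeff c d 0 (of_real x)"
    define x where "x = - real_of_int b / of_int a"
    have a0: "real_of_int a \<noteq> 0" using a by (auto simp: cong_def)
    have x: "x \<in> \<rat>" by (simp add: x_def)
    have "real_of_int (a * d - b * c) = 1" by (simp only: det of_int_1)
    then have j: "of_int c * x + of_int d = 1 / real_of_int a" using a0 by (simp add: x_def field_simps)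
    have m0: "mob \<delta> x = 0" using a0 by (simp add: mob_def \<delta>_def x_def)
    have "autfac (1/2) \<delta> x \<noteq> 0" using j a0 by (auto simp: autfac_def \<delta>_def Let_def)
    moreover have "inverse \<nu>' * autfac (1/2) \<delta> x * theta_coeff 0 0 = inverse \<mu> * autfac (1/2) \<delta> x * theta_coeff 0 0"
      using bspec[OF \<nu>' x] law0[OF x] unfolding m0 by (metis diff_left_imp_eq)
    ultimately have "inverse \<nu>' = inverse \<mu>" using theta_coeff_0_nonzero by simp
    then show "\<nu>' = \<mu>" by simp
  qed
  then have \<nu>: "\<nu> = \<mu>" by (simp add: \<nu>_def \<gamma>_def)
  show "norm \<nu> = 1" by (simp add: \<nu> \<mu>)
  show "theta_coeff \<alpha> n - inverse \<nu> * autfac (1/2) \<delta> \<alpha> *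
        (\<Sum>k\<le>n. slash_coeff (of_int c) (of_int c * \<alpha> + of_int d) n k * theta_coeff (mob \<delta> \<alpha>) k)
      = obstruction_coeff c d n (of_real \<alpha>)" if "\<alpha> \<in> \<rat>" "of_int c * \<alpha> + of_int d \<noteq> 0" for \<alpha> n
    unfolding \<nu> by (rule law[OF that])
  show "theta_coeff \<alpha> 0 - inverse \<nu> * autfac (1/2) \<delta> \<alpha> * theta_coeff (mob \<delta> \<alpha>) 0 = obstruction_coeff c d 0 (of_real \<alpha>)" if "\<alpha> \<in> \<rat>" for \<alpha>
    unfolding \<nu> by (rule law0[OF that])
qed

section \<open>The slash operator on power series\<close>

lemma fps_mult_compose_nth:
  fixes F :: "complex fps"
  assumes b0: "fps_nth b 0 = 0"
  shows "fps_nth (F * (a oo b)) n = (\<Sum>k\<le>n. fps_nth a k * fps_nth (F * b ^ k) n)"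
proof -
  have ext: "fps_nth (a oo b) m = (\<Sum>k\<le>n. fps_nth a k * fps_nth (b ^ k) m)" if "m \<le> n" for m
  proof -
    have "fps_nth (a oo b) m = (\<Sum>k\<in>{0..m}. fps_nth a k * fps_nth (b ^ k) m)" by (rule fps_compose_nth)
    also have "\<dots> = (\<Sum>k\<le>n. fps_nth a k * fps_nth (b ^ k) m)"
      using that startsby_zero_power_prefix[OF b0] by (intro sum.mono_neutral_left) auto
    finally show ?thesis .
  qed
  have "fps_nth (F * (a oo b)) n = (\<Sum>i=0..n. fps_nth F i * (\<Sum>k\<le>n. fps_nth a k * fps_nth (b ^ k) (n - i)))"
    unfolding fps_mult_nth by (intro sum.cong refl) (simp add: ext)
  also have "\<dots> = (\<Sum>i=0..n. \<Sum>k\<le>n. fps_nth a k * (fps_nth F i * fps_nth (b ^ k) (n - i)))"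
    unfolding sum_distrib_left by (intro sum.cong refl) (simp only: mult_ac)
  also have "\<dots> = (\<Sum>k\<le>n. \<Sum>i=0..n. fps_nth a k * (fps_nth F i * fps_nth (b ^ k) (n - i)))"
    by (rule sum.swap)
  also have "\<dots> = (\<Sum>k\<le>n. fps_nth a k * fps_nth (F * b ^ k) n)"
    unfolding fps_mult_nth sum_distrib_left ..
  finally show ?thesis .
qed

text \<open>Both factors of the slash operator are binomial series in \<open>(c / j) X\<close>, and the \<open>k\<close>-th power of the inner series shifts
  the exponent \<open>- 1/2\<close> to \<open>- 1/2 - k\<close>.\<close>

lemma slash_fps_nth:
  fixes \<delta> :: "real^2^2"
  assumes j: "j = \<delta> $ 2 $ 1 * x + \<delta> $ 2 $ 2"
  shows "fps_nth (slash_fps (1/2) v \<phi> \<delta> x) n = inverse (v \<delta>) * autfac (1/2) \<delta> x *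
    (\<Sum>k\<le>n. slash_coeff (\<delta> $ 2 $ 1) j n k * fps_nth \<phi> k)"
proof -
  define c where "c = complex_of_real (\<delta> $ 2 $ 1) / complex_of_real j"
  define u where "u = fps_const c * fps_X"
  define B where "B = fps_binomial (complex_of_real (- (1/2))) oo u"
  define g where "g = fps_const (1 / (complex_of_real j)\<^sup>2) * fps_X * inverse (1 + u)"
  have u0: "fps_nth u 0 = 0" by (simp add: u_def)
  have g0: "fps_nth g 0 = 0" by (simp add: g_def)
  have bin: "fps_binomial (s::complex) oo u = Abs_fps (\<lambda>m. c ^ m * (s gchoose m))" for s
    unfolding u_def fps_compose_linear by (simp add: fps_binomial_def)
  have inv: "inverse (1 + u) = fps_binomial (-1) oo u"
  proof -
    have one: "fps_binomial (1::complex) = 1 + fps_X"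
      using fps_binomial_of_nat[of 1, where ?'a = complex] by simp
    have "fps_binomial (-1 :: complex) * fps_binomial 1 = 1"
      unfolding fps_binomial_add_mult[symmetric] by simp
    then have "(fps_binomial (-1 :: complex) * (1 + fps_X)) oo u = 1 oo u" unfolding one by simp
    then have "(fps_binomial (-1) oo u) * (1 + u) = 1"
      by (simp add: fps_compose_mult_distrib[OF u0] fps_compose_add_distrib fps_X_fps_compose_startby0[OF u0])
    then show ?thesis by (metis fps_inverse_unique mult.commute)
  qed
  have Bg: "fps_nth (B * g ^ k) n = slash_coeff (\<delta> $ 2 $ 1) j n k" if k: "k \<le> n" for k
  proof -
    have "B * g ^ k = fps_const ((1 / (complex_of_real j)\<^sup>2) ^ k) * (fps_X ^ k * (B * (fps_binomial (-1) oo u) ^ k))"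
      unfolding g_def inv power_mult_distrib fps_const_power[symmetric] by (simp only: mult_ac)
    also have "B * (fps_binomial (-1) oo u) ^ k = fps_binomial (- (1/2) - of_nat k) oo u"
    proof -
      have "B * (fps_binomial (-1) oo u) ^ k = (fps_binomial (- (1/2)) * fps_binomial (-1) ^ k) oo u"
        unfolding B_def fps_compose_power[OF u0] fps_compose_mult_distrib[OF u0] by simp
      also have "fps_binomial (- (1/2)) * fps_binomial (-1) ^ k = fps_binomial (- (1/2) - of_nat k :: complex)"
      proof (induction k)
        case (Suc k)
        have "fps_binomial (- (1/2)) * fps_binomial (-1) ^ Suc k = fps_binomial (- (1/2)) * fps_binomial (-1) ^ k * fps_binomial (-1 :: complex)"
          by (simp only: power_Suc mult_ac)
        also have "\<dots> = fps_binomial ((- (1/2) - of_nat k) + (-1))"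
          unfolding Suc fps_binomial_add_mult ..
        also have "(- (1/2) - of_nat k) + (-1) = (- (1/2) - of_nat (Suc k) :: complex)" by simp
        finally show ?case .
      qed simp
      finally show ?thesis .
    qed
    finally have "fps_nth (B * g ^ k) n = (1 / (complex_of_real j)\<^sup>2) ^ k * (c ^ (n - k) * ((- (1/2) - of_nat k) gchoose (n - k)))"
      using k by (simp add: fps_X_power_mult_nth bin)
    moreover have "complex_of_real ((-1/2 - real k) gchoose (n - k)) = (- (1/2) - of_nat k) gchoose (n - k)"
      by (simp add: gbinomial_prod_rev)
    ultimately show ?thesis by (simp add: slash_coeff_def c_def mult_ac)
  qed
  have "slash_fps (1/2) v \<phi> \<delta> x = fps_const (inverse (v \<delta>) * autfac (1/2) \<delta> x) * (B * (\<phi> oo g))"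
    unfolding slash_fps_def Let_def j[symmetric] B_def g_def u_def c_def by (simp only: mult.assoc)
  then have "fps_nth (slash_fps (1/2) v \<phi> \<delta> x) n = inverse (v \<delta>) * autfac (1/2) \<delta> x * fps_nth (B * (\<phi> oo g)) n"
    by simp
  also have "fps_nth (B * (\<phi> oo g)) n = (\<Sum>k\<le>n. slash_coeff (\<delta> $ 2 $ 1) j n k * fps_nth \<phi> k)"
    unfolding fps_mult_compose_nth[OF g0] by (intro sum.cong refl) (simp add: Bg)
  finally show ?thesis .
qed

section \<open>Quantum modularity of \<open>Theta\<close>\<close>

theorem theorem3:
  shows "strong_quantum_modular_form (1/2) nu_Theta Gamma_Theta Theta
           (\<lambda>\<delta> x. R_psi \<delta> (of_real x)) \<and>
         (\<forall>\<delta>\<in>Gamma_Theta. \<forall>\<alpha>\<in>\<rat>.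
            radial_value Theta \<alpha> - slash (1/2) nu_Theta Theta \<delta> \<alpha> = R_psi \<delta> (of_real \<alpha>)) \<and>
         (\<forall>\<delta>\<in>Gamma_Theta.
            extends_smoothly_to_reals (R_psi \<delta>) \<and>
            real_analytic_on (\<lambda>x. R_psi \<delta> (of_real x)) (- cusp_preimage \<delta>))"
proof -
  have main: "norm (nu_Theta \<delta>) = 1 \<and>
      (\<forall>x\<in>\<rat> - cusp_preimage \<delta>. Abs_fps (theta_coeff x) - slash_fps (1/2) nu_Theta (Abs_fps (theta_coeff (mob \<delta> x))) \<delta> x
          = taylor_fps (\<lambda>x. R_psi \<delta> (of_real x)) x) \<and>
      smooth_on_reals (\<lambda>x. R_psi \<delta> (of_real x)) \<and> finite (cusp_preimage \<delta>) \<and>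
      (\<forall>\<alpha>\<in>\<rat>. radial_value Theta \<alpha> - slash (1/2) nu_Theta Theta \<delta> \<alpha> = R_psi \<delta> (of_real \<alpha>)) \<and>
      extends_smoothly_to_reals (R_psi \<delta>) \<and>
      real_analytic_on (\<lambda>x. R_psi \<delta> (of_real x)) (- cusp_preimage \<delta>)" if D: "\<delta> \<in> Gamma_Theta" for \<delta>
  proof -
    obtain a b c d :: int where \<delta>: "\<delta> = mat2 (of_int a) (of_int b) (of_int c) (of_int d)"
      and det: "a * d - b * c = 1" and cong: "[a = 1] (mod 16)" "[d = 1] (mod 16)" "[c = 0] (mod 32)"
      and conj: "D_mat ** \<delta> ** matrix_inv D_mat = mat2 (of_int a) (2 * of_int b) (of_int c / 2) (of_int d)"
      by (rule Gamma_Theta_cases[OF D])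
    have R: "R_psi \<delta> = obstruction_coeff c d 0"
      unfolding R_psi_def conj r_psi_eq_obstruction ..
    have nu: "nu_Theta \<delta> = nu_psi (mat2 (of_int a) (2 * of_int b) (of_int c / 2) (of_int d))"
      by (simp add: nu_Theta_def conj)
    note mult = multiplier[OF det cong, folded \<delta> nu]
    have cusp: "cusp_preimage \<delta> = {x. of_int c * x + of_int d = 0}"
      by (simp add: cusp_preimage_def \<delta>)
    have d0: "d \<noteq> 0" using cong(2) by (auto simp: cong_def)
    have "x = - real_of_int d / of_int c" if x: "of_int c * x + of_int d = 0" for x
    proof -
      have "c \<noteq> 0" using d0 x by auto
      then show ?thesis using x by (simp add: field_simps)
    qed
    then have "{x. of_int c * x + of_int d = 0} \<subseteq> {- real_of_int d / of_int c}" by blast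
    then have fin: "finite (cusp_preimage \<delta>)" unfolding cusp by (rule finite_subset) simp
    have smooth: "smooth_on_reals (\<lambda>x. R_psi \<delta> (of_real x))"
      unfolding smooth_on_reals_def R obstruction_vderiv by (intro allI obstruction_differentiable)
    have taylor: "Abs_fps (theta_coeff x) - slash_fps (1/2) nu_Theta (Abs_fps (theta_coeff (mob \<delta> x))) \<delta> x
          = taylor_fps (\<lambda>x. R_psi \<delta> (of_real x)) x" if x: "x \<in> \<rat> - cusp_preimage \<delta>" for x
    proof (rule fps_ext)
      fix n
      have j: "of_int c * x + of_int d = \<delta> $ 2 $ 1 * x + \<delta> $ 2 $ 2" by (simp add: \<delta>)
      have c: "\<delta> $ 2 $ 1 = of_int c" by (simp add: \<delta>)
      have x': "x \<in> \<rat>" "of_int c * x + of_int d \<noteq> 0" using x by (auto simp: cusp)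
      show "fps_nth (Abs_fps (theta_coeff x) - slash_fps (1/2) nu_Theta (Abs_fps (theta_coeff (mob \<delta> x))) \<delta> x) n
          = fps_nth (taylor_fps (\<lambda>x. R_psi \<delta> (of_real x)) x) n"
        using mult(2)[OF x', of n]
        unfolding fps_sub_nth slash_fps_nth[OF j] c taylor_fps_def R obstruction_vderiv fps_nth_Abs_fps by simp
    qed
    have radial: "radial_value Theta \<alpha> - slash (1/2) nu_Theta Theta \<delta> \<alpha> = R_psi \<delta> (of_real \<alpha>)" if \<alpha>: "\<alpha> \<in> \<rat>" for \<alpha>
    proof -
      have "mob \<delta> \<alpha> \<in> \<rat>" using \<alpha> by (simp add: mob_def \<delta>)
      then show ?thesis
        using mult(3)[OF \<alpha>] by (simp add: slash_def radial_value_Theta(2)[OF \<alpha>] radial_value_Theta(2) R)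
    qed
    show ?thesis
      using mult(1) taylor smooth fin radial obstruction_extends_smoothly[of c d] obstruction_real_analytic[of d c] d0
      unfolding R cusp by blast
  qed
  have "strong_quantum_modular_form (1/2) nu_Theta Gamma_Theta Theta (\<lambda>\<delta> x. R_psi \<delta> (of_real x))"
    unfolding strong_quantum_modular_form_def
  proof (intro conjI exI[of _ "\<lambda>x. Abs_fps (theta_coeff x)"] ballI)
    show "norm (nu_Theta \<gamma>) = 1" if "\<gamma> \<in> Gamma_Theta" for \<gamma> using main[OF that] by blast
    show "radial_expansion Theta x (Abs_fps (theta_coeff x))" if "x \<in> \<rat>" for x
      by (rule Theta_radial_expansion[OF that])
    show "Abs_fps (theta_coeff x) - slash_fps (1/2) nu_Theta (Abs_fps (theta_coeff (mob \<gamma> x))) \<gamma> x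
          = taylor_fps (\<lambda>x. R_psi \<gamma> (of_real x)) x" if "\<gamma> \<in> Gamma_Theta" "x \<in> \<rat> - cusp_preimage \<gamma>" for \<gamma> x
      using main[OF that(1)] that(2) by blast
    show "smooth_on_reals (\<lambda>x. R_psi \<gamma> (of_real x))" if "\<gamma> \<in> Gamma_Theta" for \<gamma> using main[OF that] by blast
    show "\<exists>S. finite S \<and> real_analytic_on (\<lambda>x. R_psi \<gamma> (of_real x)) (- S)" if "\<gamma> \<in> Gamma_Theta" for \<gamma>
      using main[OF that] by blast
  qed
  with main show ?thesis by blast
qed

end
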